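(* Let $k$ be a field and let $\Gamma$ and $\Gamma'$ be two finite graphs, with cographic rings $R(\Gamma)$ and $R(\Gamma')$ over $k$. Then $R(\Gamma)\cong R(\Gamma')$ if and only if $[\Gamma]^3_{\rm cyc}=[\Gamma']^3_{\rm cyc}$, i.e. $\Gamma$ and $\Gamma'$ have the same $3$-edge connected class.
   Context: Graphs. A finite graph $\Gamma$ consists of finite sets $V(\Gamma)$ (vertices) and $\overset{\rightarrow}{E}(\Gamma)$ (oriented edges), a fixed-point-free involution $\iota$ of $\overset{\rightarrow}{E}(\Gamma)$, and source and target maps $s,t:\overset{\rightarrow}{E}(\Gamma)\to V(\Gamma)$ with $s(\vec e)=t(\iota(\vec e))$ (loops and multiple edges allowed). $E(\Gamma):=\overset{\rightarrow}{E}(\Gamma)/\iota$; the two orientations of an edge $e$ are $\overset{\rightarrow}{e}$ and $\overset{\leftarrow}{e}$. For $S\subseteq E(\Gamma)$, $\Gamma\setminus S$ is obtained by removing the edges in $S$ and keeping all vertices. An edge $e$ is separating if $\Gamma\setminus\{e\}$ has more connected components than $\Gamma$. A separating pair of edges is a pair of distinct non-separating edges $e_1,e_2$ such that $\Gamma\setminus\{e_1,e_2\}$ has more connected components than $\Gamma$. A circuit is (the edge set of) a cyclic subgraph: connected, without separating edges, with first Betti number $1$. Cyclic equivalence and 3-edge connectivization. Two graphs are cyclic equivalent (or 2-isomorphic) if there is a bijection $\epsilon:E(\Gamma)\to E(\Gamma')$ inducing a bijection on the circuits; the class of $\Gamma$ is $[\Gamma]_{\rm cyc}$. A 3-edge connectivization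 of $\Gamma$ is a graph obtained from $\Gamma$ by contracting all the separating edges and then contracting, for every separating pair of edges, one of the two edges (repeatedly, until there are no separating pairs). Its cyclic equivalence class does not depend on the choices made; it is called the 3-edge connected class of $\Gamma$ and denoted $[\Gamma]^3_{\rm cyc}$. Homology. $\overset{\rightarrow}{C}_1(\Gamma,A)$ is the $A$-module generated by $\overset{\rightarrow}{E}(\Gamma)$ with relations $\overset{\leftarrow}{e}=-\overset{\rightarrow}{e}$; $\partial(\overset{\rightarrow}{e})=t(\overset{\rightarrow}{e})-s(\overset{\rightarrow}{e})$; $H_1(\Gamma,A)=\ker\partial$. The bilinear form on $\overset{\rightarrow}{C}_1(\Gamma,\mathbb R)$ is determined by $(\overset{\rightarrow}{e},\overset{\rightarrow}{e})=1$, $(\overset{\rightarrow}{e},\overset{\leftarrow}{e})=-1$, $(\overset{\rightarrow}{e},\overset{\rightarrow}{f})=0$ for $f\ne e$. Cographic ring. The cographic arrangement is the set of hyperplanes $\{v\in H_1(\Gamma,\mathbb R):(v,e)=0\}$ for those $e\in E(\Gamma)$ with $(\cdot,e)\not\equiv0$ on $H_1(\Gamma,\mathbb R)$. The cographic fan $\mathcal F_\Gamma^\perp$ consists of the closures of the connected components of its complement in $H_1(\Gamma,\mathbb R)$ and all their faces. $R(\Gamma)$ is the $k$-algebra with $k$-basis $\{X^c:c\in H_1(\Gamma,\mathbb Z)\}$ and multiplication $X^cX^{c'}=X^{c+c'}$ if $c,c'$ lie in a common cone of $\mathcal F_\Gamma^\perp$, and $X^cX^{c'}=0$ otherwise. The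 isomorphism $R(\Gamma)\cong R(\Gamma')$ is as rings. *)

theory Defs
  imports
    "HOL-Analysis.Analysis"
    "HOL-Analysis.Finite_Function_Topology"
    "HOL-Algebra.QuotRing"
begin

section \<open>Finite graphs\<close>

text \<open>Darts are the oriented edges; \<open>opp\<close> is the involution exchanging the two orientations.
  The values of \<open>opp\<close>, \<open>src\<close>, \<open>tgt\<close> outside \<open>darts\<close> are irrelevant.\<close>

record ('v, 'e) graph =
  verts :: "'v set"
  darts :: "'e set"
  opp :: "'e \<Rightarrow> 'e"
  src :: "'e \<Rightarrow> 'v"
  tgt :: "'e \<Rightarrow> 'v"

locale finite_graph =
  fixes G :: "('v, 'e) graph"
  assumes finite_verts: "finite (verts G)"
    and finite_darts: "finite (darts G)"
    and src_in: "x \<in> darts G \<Longrightarrow> src G x \<in> verts G"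
    and tgt_in: "x \<in> darts G \<Longrightarrow> tgt G x \<in> verts G"
    and opp_in: "x \<in> darts G \<Longrightarrow> opp G x \<in> darts G"
    and opp_opp: "x \<in> darts G \<Longrightarrow> opp G (opp G x) = x"
    and opp_neq: "x \<in> darts G \<Longrightarrow> opp G x \<noteq> x"
    and src_eq_tgt_opp: "x \<in> darts G \<Longrightarrow> src G x = tgt G (opp G x)"

definition dart_edge :: "('v, 'e) graph \<Rightarrow> 'e \<Rightarrow> 'e set" where
  "dart_edge G x = {x, opp G x}"

definition edges :: "('v, 'e) graph \<Rightarrow> 'e set set" where
  "edges G = dart_edge G ` darts G"

definition delete_edges :: "('v, 'e) graph \<Rightarrow> 'e set set \<Rightarrow> ('v, 'e) graph" where
  "delete_edges G S = G\<lparr>darts := {x \<in> darts G. dart_edge G x \<notin> S}\<rparr>"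

definition joined :: "('v, 'e) graph \<Rightarrow> ('v \<times> 'v) set" where
  "joined G = {(u, v) \<in> verts G \<times> verts G. (u, v) \<in> ((\<lambda>x. (src G x, tgt G x)) ` darts G)\<^sup>*}"

definition num_components :: "('v, 'e) graph \<Rightarrow> nat" where
  "num_components G = card (verts G // joined G)"

definition separating :: "('v, 'e) graph \<Rightarrow> 'e set \<Rightarrow> bool" where
  "separating G e \<longleftrightarrow> e \<in> edges G \<and> num_components G < num_components (delete_edges G {e})"

definition separating_pair :: "('v, 'e) graph \<Rightarrow> 'e set \<Rightarrow> 'e set \<Rightarrow> bool" where
  "separating_pair G e\<^sub>1 e\<^sub>2 \<longleftrightarrow>
     e\<^sub>1 \<in> edges G \<and> e\<^sub>2 \<in> edges G \<and> e\<^sub>1 \<noteq> e\<^sub>2 \<and> \<not> separating G e\<^sub>1 \<and> \<not> separating G e\<^sub>2 \<and>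
     num_components G < num_components (delete_edges G {e\<^sub>1, e\<^sub>2})"


section \<open>Homology\<close>

text \<open>The module of 1-chains, i.e. the free module on the darts modulo \<open>opp x = - x\<close>, is
  realised as the module of antisymmetric functions on the darts: the class of \<open>a\<close> times the dart
  \<open>x\<close> is \<open>dart_chain G x a\<close>. The lemmas \<open>chain_eq_sum_dart_chain\<close> and \<open>sum_dart_chain_eq_0_iff\<close>
  below show that the resulting map from the free module is onto, and that its kernel consists of
  the combinations with equal coefficients at \<open>x\<close> and \<open>opp x\<close>, i.e. of the relations.
  In this model \<open>boundary\<close> and \<open>pairing\<close> (in which every edge is summed over twice) are
  characterised by \<open>boundary_dart_chain\<close> and \<open>pairing_dart_chain\<close>.\<close>

definition chains :: "('v, 'e) graph \<Rightarrow> ('e \<Rightarrow>\<^sub>0 'a::comm_ring_1) set" where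
  "chains G = {c. Poly_Mapping.keys c \<subseteq> darts G \<and>
     (\<forall>x\<in>darts G. Poly_Mapping.lookup c (opp G x) = - Poly_Mapping.lookup c x)}"

definition dart_chain :: "('v, 'e) graph \<Rightarrow> 'e \<Rightarrow> 'a \<Rightarrow> ('e \<Rightarrow>\<^sub>0 'a::comm_ring_1)" where
  "dart_chain G x a = Poly_Mapping.single x a - Poly_Mapping.single (opp G x) a"

definition boundary :: "('v, 'e) graph \<Rightarrow> ('e \<Rightarrow>\<^sub>0 'a::comm_ring_1) \<Rightarrow> 'v \<Rightarrow> 'a" where
  "boundary G c v = (\<Sum>x | x \<in> darts G \<and> tgt G x = v. Poly_Mapping.lookup c x)"

definition H1 :: "('v, 'e) graph \<Rightarrow> ('e \<Rightarrow>\<^sub>0 'a::comm_ring_1) set" where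
  "H1 G = {c \<in> chains G. \<forall>v\<in>verts G. boundary G c v = 0}"

definition pairing :: "('v, 'e) graph \<Rightarrow> ('e \<Rightarrow>\<^sub>0 real) \<Rightarrow> ('e \<Rightarrow>\<^sub>0 real) \<Rightarrow> real" where
  "pairing G c d = (\<Sum>x\<in>darts G. Poly_Mapping.lookup c x * Poly_Mapping.lookup d x) / 2"

definition betti1 :: "('v, 'e) graph \<Rightarrow> nat" where
  "betti1 G = dim (H1 G :: ('e \<Rightarrow>\<^sub>0 real) set)"

context finite_graph
begin

lemma opp_eq_iff: "x \<in> darts G \<Longrightarrow> y \<in> darts G \<Longrightarrow> opp G x = y \<longleftrightarrow> x = opp G y"
  using opp_opp by metis

lemma dart_chain_in_chains:
  assumes "x \<in> darts G"
  shows "dart_chain G x a \<in> chains G"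
proof -
  have "Poly_Mapping.keys (dart_chain G x a) \<subseteq> {x, opp G x}"
    using keys_diff[of "Poly_Mapping.single x a" "Poly_Mapping.single (opp G x) a"]
    by (auto simp: dart_chain_def split: if_splits)
  then show ?thesis
    using assms opp_in[OF assms] opp_eq_iff[of x] opp_eq_iff[OF opp_in[OF assms]] opp_opp[OF assms]
    by (auto simp: chains_def dart_chain_def lookup_minus lookup_single when_def)
qed

lemma dart_chain_opp:
  "x \<in> darts G \<Longrightarrow> dart_chain G (opp G x) a = - dart_chain G x a"
  by (simp add: dart_chain_def opp_opp)

lemma lookup_sum_dart_chain:
  assumes "y \<in> darts G"
  shows "Poly_Mapping.lookup (\<Sum>x\<in>darts G. dart_chain G x (a x)) y = a y - a (opp G y)"
proof -
  have "Poly_Mapping.lookup (\<Sum>x\<in>darts G. dart_chain G x (a x)) y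
      = (\<Sum>x\<in>darts G. (if x = y then a x else 0) - (if x = opp G y then a x else 0))"
    unfolding lookup_sum
    by (rule sum.cong)
       (use assms opp_eq_iff in \<open>auto simp: dart_chain_def lookup_minus lookup_single when_def\<close>)
  also have "\<dots> = a y - a (opp G y)"
    using assms finite_darts opp_in by (simp add: sum_subtractf)
  finally show ?thesis .
qed

lemma sum_dart_chain_eq_0_iff:
  "(\<Sum>x\<in>darts G. dart_chain G x (a x)) = 0 \<longleftrightarrow> (\<forall>x\<in>darts G. a (opp G x) = a x)"
  (is "?s = 0 \<longleftrightarrow> _")
proof
  assume "?s = 0"
  then show "\<forall>x\<in>darts G. a (opp G x) = a x"
    using lookup_sum_dart_chain[where a = a] by fastforce
next
  assume *: "\<forall>x\<in>darts G. a (opp G x) = a x"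
  show "?s = 0"
  proof (rule poly_mapping_eqI)
    fix y
    show "Poly_Mapping.lookup ?s y = Poly_Mapping.lookup 0 y"
    proof (cases "y \<in> darts G")
      case True
      then show ?thesis using lookup_sum_dart_chain[OF True, of a] * by simp
    next
      case False
      have "Poly_Mapping.lookup (dart_chain G x (a x)) y = 0" if "x \<in> darts G" for x
        using False that opp_in
        by (auto simp: dart_chain_def lookup_minus lookup_single when_def)
      then show ?thesis by (simp add: lookup_sum)
    qed
  qed
qed

lemma exists_orientation: "\<exists>D\<subseteq>darts G. \<forall>x\<in>darts G. x \<in> D \<longleftrightarrow> opp G x \<notin> D"
proof -
  define D where "D = {x \<in> darts G. (SOME y. y \<in> dart_edge G x) = x}"
  have "x \<in> D \<longleftrightarrow> opp G x \<notin> D" if x: "x \<in> darts G" for x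
  proof -
    have eq: "dart_edge G (opp G x) = dart_edge G x"
      using opp_opp[OF x] by (auto simp: dart_edge_def)
    have "(SOME y. y \<in> dart_edge G x) \<in> dart_edge G x"
      by (rule someI[of _ x]) (simp add: dart_edge_def)
    then have "(SOME y. y \<in> dart_edge G x) = x \<or> (SOME y. y \<in> dart_edge G x) = opp G x"
      unfolding dart_edge_def by blast
    then show ?thesis
      using x opp_in[OF x] opp_neq[OF x] eq unfolding D_def mem_Collect_eq by metis
  qed
  moreover have "D \<subseteq> darts G"
    by (simp add: D_def)
  ultimately show ?thesis by blast
qed

lemma chain_eq_sum_dart_chain:
  assumes "c \<in> chains G"
  shows "\<exists>a. c = (\<Sum>x\<in>darts G. dart_chain G x (a x))"
proof -
  obtain D where D: "D \<subseteq> darts G" "\<And>x. x \<in> darts G \<Longrightarrow> x \<in> D \<longleftrightarrow> opp G x \<notin> D"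
    using exists_orientation by blast
  define a where "a x = (if x \<in> D then Poly_Mapping.lookup c x else 0)" for x
  have "c = (\<Sum>x\<in>darts G. dart_chain G x (a x))"
  proof (rule poly_mapping_eqI)
    fix y
    show "Poly_Mapping.lookup c y = Poly_Mapping.lookup (\<Sum>x\<in>darts G. dart_chain G x (a x)) y"
    proof (cases "y \<in> darts G")
      case True
      then show ?thesis
        using lookup_sum_dart_chain[OF True, of a] D(2)[OF True] assms
        by (auto simp: a_def chains_def)
    next
      case False
      have "Poly_Mapping.lookup (dart_chain G x (a x)) y = 0" if "x \<in> darts G" for x
        using False that opp_in
        by (auto simp: dart_chain_def lookup_minus lookup_single when_def)
      moreover have "Poly_Mapping.lookup c y = 0"
        using False assms by (auto simp: chains_def in_keys_iff)
      ultimately show ?thesis by (simp add: lookup_sum)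
    qed
  qed
  then show ?thesis by blast
qed

lemma boundary_dart_chain:
  assumes "x \<in> darts G"
  shows "boundary G (dart_chain G x a) v = (a when v = tgt G x) - (a when v = src G x)"
proof -
  let ?T = "{y \<in> darts G. tgt G y = v}"
  have "boundary G (dart_chain G x a) v
      = (\<Sum>y\<in>?T. (if y = x then a else 0) - (if y = opp G x then a else 0))"
    unfolding boundary_def
    by (rule sum.cong) (auto simp: dart_chain_def lookup_minus lookup_single when_def)
  also have "\<dots> = (a when v = tgt G x) - (a when v = src G x)"
    using assms finite_darts opp_in[OF assms] src_eq_tgt_opp[OF assms]
    by (simp add: sum_subtractf when_def eq_commute[of v])
  finally show ?thesis .
qed

lemma pairing_dart_chain:
  assumes "x \<in> darts G" "y \<in> darts G"
  shows "pairing G (dart_chain G x 1) (dart_chain G y 1)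
       = (if y = x then 1 else if y = opp G x then - 1 else 0)"
proof -
  have *: "pairing G c (dart_chain G y 1)
      = (Poly_Mapping.lookup c y - Poly_Mapping.lookup c (opp G y)) / 2" for c
  proof -
    have "(\<Sum>z\<in>darts G. Poly_Mapping.lookup c z * Poly_Mapping.lookup (dart_chain G y 1) z)
        = (\<Sum>z\<in>darts G. (if z = y then Poly_Mapping.lookup c z else 0)
                       - (if z = opp G y then Poly_Mapping.lookup c z else 0))"
      using opp_neq[OF assms(2)] by (intro sum.cong) (auto simp: dart_chain_def lookup_minus lookup_single when_def)
    then show ?thesis
      using assms finite_darts opp_in[OF assms(2)] by (simp add: pairing_def sum_subtractf)
  qed
  have "opp G x = opp G y \<longleftrightarrow> y = x" "x = opp G y \<longleftrightarrow> y = opp G x" "x = y \<longleftrightarrow> y = x"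
    using opp_opp[OF assms(1)] opp_opp[OF assms(2)] by metis+
  then show ?thesis
    unfolding * unfolding dart_chain_def lookup_minus lookup_single when_def
    using opp_neq[OF assms(1)] by (simp split: if_splits)
qed

end


section \<open>Circuits and cyclic equivalence\<close>

definition subgraph :: "('v, 'e) graph \<Rightarrow> ('v, 'e) graph \<Rightarrow> bool" where
  "subgraph H G \<longleftrightarrow> finite_graph H \<and>
     (\<exists>W\<subseteq>verts G. \<exists>D\<subseteq>darts G. H = G\<lparr>verts := W, darts := D\<rparr>)"

definition cyclic_graph :: "('v, 'e) graph \<Rightarrow> bool" where
  "cyclic_graph H \<longleftrightarrow> num_components H = 1 \<and> (\<forall>e. \<not> separating H e) \<and> betti1 H = 1"

definition circuits :: "('v, 'e) graph \<Rightarrow> 'e set set set" where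
  "circuits G = {edges H | H. subgraph H G \<and> cyclic_graph H}"

definition cyclic_equivalent :: "('v, 'e) graph \<Rightarrow> ('w, 'f) graph \<Rightarrow> bool" where
  "cyclic_equivalent G G' \<longleftrightarrow>
     (\<exists>\<epsilon>. bij_betw \<epsilon> (edges G) (edges G') \<and> bij_betw ((`) \<epsilon>) (circuits G) (circuits G'))"

text \<open>To compare graphs over different types, the class of a graph is taken among the finite graphs
  with vertices and darts in \<open>nat\<close>; every finite graph is isomorphic to one of these.\<close>

definition cyc_class :: "('v, 'e) graph \<Rightarrow> (nat, nat) graph set" where
  "cyc_class G = {D. finite_graph D \<and> cyclic_equivalent D G}"


section \<open>3-edge connectivization\<close>

text \<open>Contraction of the edge carrying the dart \<open>x\<close>: the two end points are identified, the
  identified vertex being represented by \<open>src G x\<close>.\<close>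

definition contract :: "('v, 'e) graph \<Rightarrow> 'e \<Rightarrow> ('v, 'e) graph" where
  "contract G x =
     (let q = (\<lambda>v. if v = tgt G x then src G x else v)
      in G\<lparr>verts := q ` verts G, darts := darts G - dart_edge G x,
            src := q \<circ> src G, tgt := q \<circ> tgt G\<rparr>)"

definition contract_separating :: "('v, 'e) graph \<Rightarrow> ('v, 'e) graph \<Rightarrow> bool" where
  "contract_separating G H \<longleftrightarrow>
     (\<exists>x\<in>darts G. separating G (dart_edge G x) \<and> H = contract G x)"

definition contract_separating_pair :: "('v, 'e) graph \<Rightarrow> ('v, 'e) graph \<Rightarrow> bool" where
  "contract_separating_pair G H \<longleftrightarrow>
     (\<exists>x\<in>darts G. \<exists>e. separating_pair G (dart_edge G x) e \<and> H = contract G x)"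

definition three_edge_connectivization :: "('v, 'e) graph \<Rightarrow> ('v, 'e) graph \<Rightarrow> bool" where
  "three_edge_connectivization G H \<longleftrightarrow>
     (\<exists>G\<^sub>1. contract_separating\<^sup>*\<^sup>* G G\<^sub>1 \<and> (\<forall>e. \<not> separating G\<^sub>1 e) \<and>
           contract_separating_pair\<^sup>*\<^sup>* G\<^sub>1 H \<and> (\<forall>e\<^sub>1 e\<^sub>2. \<not> separating_pair H e\<^sub>1 e\<^sub>2))"

text \<open>All 3-edge connectivizations of \<open>G\<close> have the same cyclic equivalence class, so the union
  below is that common class.\<close>

definition three_edge_class :: "('v, 'e) graph \<Rightarrow> (nat, nat) graph set" where
  "three_edge_class G = (\<Union>H\<in>{H. three_edge_connectivization G H}. cyc_class H)"


section \<open>The cographic fan and the cographic ring\<close>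

definition cographic_arrangement :: "('v, 'e) graph \<Rightarrow> ('e \<Rightarrow>\<^sub>0 real) set set" where
  "cographic_arrangement G =
     {{v \<in> H1 G. pairing G v (dart_chain G x 1) = 0} | x.
        x \<in> darts G \<and> (\<exists>v\<in>H1 G. pairing G v (dart_chain G x 1) \<noteq> 0)}"

text \<open>The closure is taken in the normed space of all finitely supported functions, in which the
  finite-dimensional subspace \<open>H1 G\<close> is closed. Note that \<open>face_of\<close> counts the empty set
  as a face.\<close>

definition cographic_fan :: "('v, 'e) graph \<Rightarrow> ('e \<Rightarrow>\<^sub>0 real) set set" where
  "cographic_fan G =
     {F. F \<noteq> {} \<and> (\<exists>C\<in>components (H1 G - \<Union>(cographic_arrangement G)). F face_of closure C)}"

definition in_common_cone :: "('v, 'e) graph \<Rightarrow> ('e \<Rightarrow>\<^sub>0 int) \<Rightarrow> ('e \<Rightarrow>\<^sub>0 int) \<Rightarrow> bool" where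
  "in_common_cone G c c' \<longleftrightarrow>
     (\<exists>\<sigma>\<in>cographic_fan G. Poly_Mapping.map of_int c \<in> \<sigma> \<and> Poly_Mapping.map of_int c' \<in> \<sigma>)"

text \<open>An element of the ring is a finitely supported function on \<open>H1 G\<close> over the integers; the basis
  vector \<open>X\<^sup>c\<close> is \<open>Poly_Mapping.single c 1\<close>.\<close>

definition cographic_ring :: "('v, 'e) graph \<Rightarrow> (('e \<Rightarrow>\<^sub>0 int) \<Rightarrow>\<^sub>0 'k::field) ring" where
  "cographic_ring G =
     \<lparr>carrier = {p. Poly_Mapping.keys p \<subseteq> H1 G},
      mult = (\<lambda>p q. \<Sum>c\<in>Poly_Mapping.keys p. \<Sum>c'\<in>Poly_Mapping.keys q.
                if in_common_cone G c c'
                then Poly_Mapping.single (c + c') (Poly_Mapping.lookup p c * Poly_Mapping.lookup q c')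
                else 0),
      one = Poly_Mapping.single 0 1,
      zero = 0,
      add = (+)\<rparr>"

end

theory Submission
  imports Defs
begin

text \<open>The proof passes through the lattice \<open>L = H\<^sub>1(\<Gamma>, \<int>)\<close> with the coordinates given by an
  orientation. Every nonzero cycle dominates, sign by sign, a cycle with entries in \<open>{0, 1, -1}\<close>,
  the circuits are the minimal supports of \<open>L\<close>, and two elements lie in a common cone of the
  cographic fan iff no coordinate takes opposite signs on them. A separating edge has coordinate zero
  on \<open>L\<close> and a separating pair has coordinates equal up to sign, so contracting these edges does
  not change the ring.

  A cyclic equivalence yields an isomorphism of rings because a unimodular lattice is determined up
  to signs by its minimal supports (Camion): along a shortest path between two columns meeting a new
  row, unimodularity forces the sign of the new entries.

  Conversely, suppose that no coordinate vanishes and no two are proportional. The maximal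
  annihilators of nonzero elements of the ring are the spans of the monomials outside a chamber, and
  one of them lies in a sum of others iff the corresponding chamber contains the intersection of the
  others. Hence a ring isomorphism induces a bijection of chambers that preserves adjacency.
  Distance in the adjacency graph counts separating hyperplanes, so the bijection comes from a
  bijection of the coordinates, which then preserves supports.\<close>

text \<open>The isomorphism is only one of rings: it need not be linear over the field and need not
  send monomials to monomials. So whatever is carried across has to be phrased by zero products and
  sums, and what survives is the pattern of inclusions of intersections of closed chambers in closed
  chambers. This pattern does not see a coordinate that vanishes on the lattice, and it sees two
  proportional coordinates as one wall. That is why this direction passes to 3-edge
  connectivizations first, whereas the uniqueness of signs holds for every graph.

  The real fan enters only through the criterion for a common cone; from then on a chamber is a sign
  pattern of integral cycles, and "close to a point" becomes "a large multiple of the point plus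
  something".

  Independence of the 3-edge connected class from the choices is not established beforehand. It
  comes out of the argument: connectivizations of one graph have isomorphic rings, hence are cyclic
  equivalent. That connectivizations exist, and have copies on the natural numbers, makes the
  classes nonempty, so that their equality carries information.\<close>

section \<open>Signings of a matrix with balanced chordless cycles\<close>

text \<open>The sign condition imposed by total unimodularity on the chordless cycles
  \<open>c 0, r 0, c 1, \<dots>, c n, i\<close> of the bipartite graph of \<open>A\<close>.\<close>

definition balanced :: "'b set \<Rightarrow> 'i set \<Rightarrow> ('b \<Rightarrow> 'i \<Rightarrow> int) \<Rightarrow> bool" where
  "balanced B F A \<longleftrightarrow> (\<forall>n c r i x.
     0 < n \<and> (\<forall>j\<le>n. c j \<in> B) \<and> inj_on c {..n} \<and> (\<forall>j<n. r j \<in> F) \<and> i \<in> F \<and> (\<forall>j\<le>n. x j \<in> {1, -1}) \<and>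
     (\<forall>j<n. \<forall>m\<le>n. A (c m) (r j) \<noteq> 0 \<longleftrightarrow> m = j \<or> m = Suc j) \<and>
     (\<forall>m\<le>n. A (c m) i \<noteq> 0 \<longleftrightarrow> m = 0 \<or> m = n) \<and>
     (\<forall>j<n. x j * A (c j) (r j) + x (Suc j) * A (c (Suc j)) (r j) = 0)
     \<longrightarrow> x 0 * A (c 0) i + x n * A (c n) i = (0::int))"

lemma balancedD:
  assumes "balanced B F A" "0 < n" "\<And>j. j \<le> n \<Longrightarrow> c j \<in> B" "inj_on c {..n}"
    "\<And>j. j < n \<Longrightarrow> r j \<in> F" "i \<in> F" "\<And>j. j \<le> n \<Longrightarrow> x j \<in> {1, -1}"
    "\<And>j m. j < n \<Longrightarrow> m \<le> n \<Longrightarrow> A (c m) (r j) \<noteq> 0 \<longleftrightarrow> m = j \<or> m = Suc j"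
    "\<And>m. m \<le> n \<Longrightarrow> A (c m) i \<noteq> 0 \<longleftrightarrow> m = 0 \<or> m = n"
    "\<And>j. j < n \<Longrightarrow> x j * A (c j) (r j) + x (Suc j) * A (c (Suc j)) (r j) = 0"
  shows "x 0 * A (c 0) i + x n * A (c n) i = 0"
  using assms(1)[unfolded balanced_def, rule_format, of n c r i x] assms(2-) by blast

lemma balanced_mono:
  assumes "balanced B F A" "F' \<subseteq> F"
  shows "balanced B F' A"
  unfolding balanced_def[of B F']
proof (intro allI impI, elim conjE)
  fix n c r i and x :: "nat \<Rightarrow> int"
  assume "0 < n" "\<forall>j\<le>n. c j \<in> B" "inj_on c {..n}" "\<forall>j<n. r j \<in> F'" "i \<in> F'" "\<forall>j\<le>n. x j \<in> {1, -1}"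
    "\<forall>j<n. \<forall>m\<le>n. A (c m) (r j) \<noteq> 0 \<longleftrightarrow> m = j \<or> m = Suc j"
    "\<forall>m\<le>n. A (c m) i \<noteq> 0 \<longleftrightarrow> m = 0 \<or> m = n"
    "\<forall>j<n. x j * A (c j) (r j) + x (Suc j) * A (c (Suc j)) (r j) = 0"
  with assms show "x 0 * A (c 0) i + x n * A (c n) i = 0"
    by (intro balancedD[of B F A n c r i x]) auto
qed

lemma sign_sq: "x \<in> {1, -1::int} \<Longrightarrow> x * x = 1"
  by auto

text \<open>A shortest path has no chords, and chordless paths are governed by \<open>balanced\<close>.\<close>

lemma balanced_path:
  fixes A A' :: "'b \<Rightarrow> 'i \<Rightarrow> int"
  assumes entries: "\<And>b i. A b i \<in> {-1, 0, 1}" "\<And>b i. A' b i \<in> {-1, 0, 1}"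
    and same: "\<And>b i. b \<in> B \<Longrightarrow> i \<in> insert i0 F \<Longrightarrow> A b i \<noteq> 0 \<longleftrightarrow> A' b i \<noteq> 0"
    and bal: "balanced B (insert i0 F) A" "balanced B (insert i0 F) A'"
    and t: "\<And>b. t b \<in> {1, -1}" and s: "\<And>i. s i \<in> {1, -1}"
    and eq: "\<And>b i. b \<in> B \<Longrightarrow> i \<in> F \<Longrightarrow> A' b i = t b * s i * A b i"
    and path: "\<And>j. j \<le> n \<Longrightarrow> c j \<in> B" "\<And>j. j < n \<Longrightarrow> r j \<in> F"
      "\<And>j. j < n \<Longrightarrow> A (c j) (r j) \<noteq> 0" "\<And>j. j < n \<Longrightarrow> A (c (Suc j)) (r j) \<noteq> 0"
      "A (c 0) i0 \<noteq> 0" "A (c n) i0 \<noteq> 0"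
  shows "A (c 0) i0 * A' (c 0) i0 * t (c 0) = A (c n) i0 * A' (c n) i0 * t (c n)"
  using path
proof (induction n arbitrary: c r rule: less_induct)
  case (less n)
  note B = less.prems(1) and F = less.prems(2) and L = less.prems(3) and R = less.prems(4)
    and e = less.prems(5,6)
  show ?case
  proof (cases "n = 0")
    case True
    then show ?thesis by simp
  next
    case n: False
    \<comment> \<open>An interior column that meets \<open>i0\<close> splits the path in two, and a
      row \<open>r j\<close> that meets a column other than \<open>c j\<close> and
      \<open>c (Suc j)\<close> gives a shortcut. What remains is an induced path, which
      \<open>i0\<close> closes up to a chordless cycle.\<close>
    consider (inner) a where "0 < a" "a < n" "A (c a) i0 \<noteq> 0"
      | (chord1) j a where "j < n" "a \<le> n" "a > Suc j" "A (c a) (r j) \<noteq> 0"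
      | (chord2) j a where "j < n" "a < j" "A (c a) (r j) \<noteq> 0"
      | (chordless) "\<And>a. 0 < a \<Longrightarrow> a < n \<Longrightarrow> A (c a) i0 = 0"
         "\<And>j a. j < n \<Longrightarrow> a \<le> n \<Longrightarrow> a > Suc j \<Longrightarrow> A (c a) (r j) = 0"
         "\<And>j a. j < n \<Longrightarrow> a < j \<Longrightarrow> A (c a) (r j) = 0"
      by metis
    then show ?thesis
    proof cases
      case inner
      have "A (c 0) i0 * A' (c 0) i0 * t (c 0) = A (c a) i0 * A' (c a) i0 * t (c a)"
        using inner B F L R e by (intro less.IH[of a c r]) auto
      also have "\<dots> = A (c n) i0 * A' (c n) i0 * t (c n)"
        using less.IH[of "n - a" "\<lambda>m. c (m + a)" "\<lambda>m. r (m + a)"] inner B F L R e by simp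
      finally show ?thesis .
    next
      case chord1
      \<comment> \<open>The \<open>d\<close> columns strictly between are cut out: row
        \<open>r j\<close> now leads from \<open>c j\<close> directly to \<open>c a\<close>.\<close>
      define d where "d = a - Suc j"
      have d: "0 < d" "a = j + d + 1" "j + d + 1 \<le> n" using chord1 by (auto simp: d_def)
      have "A ((\<lambda>m. if m \<le> j then c m else c (m + d)) 0) i0 * A' ((\<lambda>m.
          if m \<le> j then c m else c (m + d)) 0) i0 *
          t ((\<lambda>m. if m \<le> j then c m else c (m + d)) 0) =
          A ((\<lambda>m. if m \<le> j then c m else c (m + d)) (n - d)) i0 * A' ((\<lambda>m.
            if m \<le> j then c m else c (m + d)) (n - d)) i0 *
          t ((\<lambda>m. if m \<le> j then c m else c (m + d)) (n - d))"
      proof (rule less.IH[of "n - d" _ "\<lambda>m. if m \<le> j then r m else r (m + d)"])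
        show "n - d < n" using d n by linarith
      next
        fix m assume "m \<le> n - d"
        then show "(if m \<le> j then c m else c (m + d)) \<in> B" using B d by auto
      next
        fix m assume m: "m < n - d"
        show "(if m \<le> j then r m else r (m + d)) \<in> F" using m F d by auto
        show "A (if m \<le> j then c m else c (m + d)) (if m \<le> j then r m else r (m + d)) \<noteq> 0"
          using m L d by auto
        show "A (if Suc m \<le> j then c (Suc m) else c (Suc m + d)) (if m \<le> j then r m else r (m +
            d)) \<noteq> 0"
        proof (cases "m = j")
          case True
          then show ?thesis using chord1 d by (simp add: add.commute)
        next
          case False
          then show ?thesis using m R[of m] R[of "m + d"] d by auto
        qed
      qed (use e d in auto)
      then show ?thesis using d by auto
    next
      case chord2
      \<comment> \<open>Here row \<open>r j\<close> leads from \<open>c a\<close> directly to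
        \<open>c (Suc j)\<close>.\<close>
      define d where "d = j - a"
      have d: "0 < d" "j = a + d" "a + d < n" using chord2 by (auto simp: d_def)
      have "A ((\<lambda>m. if m \<le> a then c m else c (m + d)) 0) i0 * A' ((\<lambda>m.
          if m \<le> a then c m else c (m + d)) 0) i0 *
          t ((\<lambda>m. if m \<le> a then c m else c (m + d)) 0) =
          A ((\<lambda>m. if m \<le> a then c m else c (m + d)) (n - d)) i0 * A' ((\<lambda>m.
            if m \<le> a then c m else c (m + d)) (n - d)) i0 *
          t ((\<lambda>m. if m \<le> a then c m else c (m + d)) (n - d))"
      proof (rule less.IH[of "n - d" _ "\<lambda>m. if m < a then r m else r (m + d)"])
        show "n - d < n" using d n by linarith
      next
        fix m assume "m \<le> n - d"
        then show "(if m \<le> a then c m else c (m + d)) \<in> B" using B d by auto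
      next
        fix m assume m: "m < n - d"
        show "(if m < a then r m else r (m + d)) \<in> F" using m F d by auto
        show "A (if m \<le> a then c m else c (m + d)) (if m < a then r m else r (m + d)) \<noteq> 0"
        proof (cases "m = a")
          case True
          then show ?thesis using chord2 d by (simp add: add.commute)
        next
          case False
          then show ?thesis using m L[of m] L[of "m + d"] d by auto
        qed
        show "A (if Suc m \<le> a then c (Suc m) else c (Suc m + d)) (if m < a then r m else r (m +
            d)) \<noteq> 0"
          using m R[of m] R[of "m + d"] d by auto
      qed (use e d in auto)
      then show ?thesis using d by auto
    next
      case chordless
      show ?thesis
      proof (cases "c 0 = c n")
        case True
        then show ?thesis by simp
      next
        case ends: False
        have iff: "A (c m) (r j) \<noteq> 0 \<longleftrightarrow> m = j \<or> m = Suc j" if "j < n" "m \<le> n" for j m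
          using that L[of j] R[of j] chordless(2)[of j m] chordless(3)[of j m]
          by (metis linorder_neqE_nat Suc_lessI)
        have iff0: "A (c m) i0 \<noteq> 0 \<longleftrightarrow> m = 0 \<or> m = n" if "m \<le> n" for m
          using that e chordless(1)[of m] by (metis bot_nat_0.not_eq_extremum le_neq_implies_less)
        \<comment> \<open>Equal columns meet the same rows of the path; by \<open>iff\<close> this
          leaves only the two ends, which are distinct.\<close>
        have inj: "inj_on c {..n}"
        proof (rule linorder_inj_onI')
          fix a b assume ab: "a \<in> {..n}" "b \<in> {..n}" "a < b"
          show "c a \<noteq> c b"
          proof
            assume "c a = c b"
            then have "a = j \<or> a = Suc j \<longleftrightarrow> b = j \<or> b = Suc j" if "j < n" for j
              using iff[of j a] iff[of j b] ab that by auto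
            note this[of a] this[of b] this[of "a - 1"]
            with ab have "a = 0" "b = n" by fastforce+
            with \<open>c a = c b\<close> ends show False by simp
          qed
        qed
        \<comment> \<open>Once \<open>x 0 = 1\<close>, cancellation in the rows \<open>r j\<close>
          forces the other signs; dividing by an entry 1 or -1 is multiplying by it.\<close>
        define x where "x = rec_nat 1 (\<lambda>j y. - y * A (c j) (r j) * A (c (Suc j)) (r j))"
        have x0: "x 0 = 1" and xS: "\<And>j. x (Suc j) = - x j * A (c j) (r j) * A (c (Suc j)) (r j)"
          by (simp_all add: x_def)
        have x: "x j \<in> {1, -1}" if "j \<le> n" for j
          using that
        proof (induction j)
          case 0
          then show ?case by (simp add: x0)
        next
          case (Suc j)
          then have "x j \<in> {1, -1}" "A (c j) (r j) \<in> {1, -1}" "A (c (Suc j)) (r j) \<in> {1, -1}"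
            using entries(1)[of "c j" "r j"] entries(1)[of "c (Suc j)" "r j"] L[of j] R[of j]
              by auto
          then show ?case unfolding xS by auto
        qed
        have rel: "x j * A (c j) (r j) + x (Suc j) * A (c (Suc j)) (r j) = 0" if "j < n" for j
        proof -
          have "A (c (Suc j)) (r j) \<in> {1, -1}" using entries(1)[of "c (Suc j)" "r j"] R[OF that]
            by auto
          then show ?thesis unfolding xS by auto
        qed
        \<comment> \<open>Twisted by \<open>t\<close>, the same signs cancel for \<open>A'\<close>:
          the factor \<open>s (r j)\<close> is common to both terms of row
          \<open>r j\<close>.\<close>
        define x' where "x' j = t (c j) * x j" for j
        have x': "x' j \<in> {1, -1}" if "j \<le> n" for j
          using x[OF that] t[of "c j"] by (auto simp: x'_def)
        have rel': "x' j * A' (c j) (r j) + x' (Suc j) * A' (c (Suc j)) (r j) = 0" if "j < n" for j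
        proof -
          have "x' j * A' (c j) (r j) + x' (Suc j) * A' (c (Suc j)) (r j)
            = t (c j) * t (c j) * s (r j) * (x j * A (c j) (r j)) +
              t (c (Suc j)) * t (c (Suc j)) * s (r j) * (x (Suc j) * A (c (Suc j)) (r j))"
            using eq[of "c j" "r j"] eq[of "c (Suc j)" "r j"] that B F by (simp add: x'_def mult_ac)
          also have "\<dots> = s (r j) * (x j * A (c j) (r j) + x (Suc j) * A (c (Suc j)) (r j))"
            using sign_sq[OF t, of "c j"] sign_sq[OF t, of "c (Suc j)"] by (simp add: algebra_simps)
          finally show ?thesis using rel[OF that] by simp
        qed
        have 1: "x 0 * A (c 0) i0 + x n * A (c n) i0 = 0"
          by (rule balancedD[OF bal(1), of n c r i0 x]) (use n B F inj x rel iff iff0 in auto)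
        have 2: "x' 0 * A' (c 0) i0 + x' n * A' (c n) i0 = 0"
        proof (rule balancedD[OF bal(2), of n c r i0 x'])
          show "A' (c m) (r j) \<noteq> 0 \<longleftrightarrow> m = j \<or> m = Suc j" if "j < n" "m \<le> n" for j m
            using iff[OF that] same[of "c m" "r j"] B F that by simp
          show "A' (c m) i0 \<noteq> 0 \<longleftrightarrow> m = 0 \<or> m = n" if "m \<le> n" for m
            using iff0[OF that] same[of "c m" i0] B that by simp
        qed (use n B F inj x' rel' in auto)
        \<comment> \<open>The claim is the product of the two cancellations in row
          \<open>i0\<close>, since squares of signs drop out.\<close>
        have "A (c 0) i0 * A' (c 0) i0 * t (c 0) = (x 0 * A (c 0) i0) * (x' 0 * A' (c 0) i0)"
          by (simp add: x0 x'_def)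
        also have "\<dots> = (x n * A (c n) i0) * (x' n * A' (c n) i0)"
          using 1 2 by (simp add: add_eq_0_iff2)
        also have "\<dots> = x n * x n * A (c n) i0 * A' (c n) i0 * t (c n)"
          by (simp add: x'_def)
        also have "\<dots> = A (c n) i0 * A' (c n) i0 * t (c n)"
          using sign_sq[OF x[of n]] by simp
        finally show ?thesis .
      qed
    qed
  qed
qed

lemma rtrancl_path:
  assumes "(a, b) \<in> {(a, b). a \<in> B \<and> b \<in> B \<and> (\<exists>r\<in>F. P a r \<and> P b r)}\<^sup>*" "a \<in> B"
  shows "\<exists>n c r. c 0 = a \<and> c n = b \<and> (\<forall>j\<le>n. c j \<in> B) \<and>
      (\<forall>j<n::nat. r j \<in> F \<and> P (c j) (r j) \<and> P (c (Suc j)) (r j))"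
proof -
  obtain n where "(a, b) \<in> {(a, b). a \<in> B \<and> b \<in> B \<and> (\<exists>r\<in>F. P a r \<and> P b r)} ^^ n"
    using assms(1) rtrancl_imp_relpow by blast
  then obtain c where c: "c 0 = a" "c n = b"
    "\<And>j. j < n \<Longrightarrow> c j \<in> B \<and> c (Suc j) \<in> B \<and> (\<exists>r\<in>F. P (c j) r \<and> P (c (Suc j)) r)"
    unfolding relpow_fun_conv by auto
  then obtain r where "\<And>j. j < n \<Longrightarrow> r j \<in> F \<and> P (c j) (r j) \<and> P (c (Suc j)) (r j)"
    by metis
  moreover have "c j \<in> B" if "j \<le> n" for j
    using that c(1) c(3)[of "j - 1"] assms(2) by (cases j) auto
  ultimately show ?thesis using c(1,2) by blast
qed

text \<open>Rows are added one at a time. In the new row \<open>i0\<close> both entries and the old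
  column sign multiply to a sign \<open>g\<close>, which has to become 1. It is constant on the
  components of the columns linked by old rows, and such a component can be flipped as a whole,
  together with its rows, without spoiling the old identities.\<close>

theorem balanced_signing_unique:
  fixes A A' :: "'b \<Rightarrow> 'i \<Rightarrow> int"
  assumes "finite F" and entries: "\<And>b i. A b i \<in> {-1, 0, 1}" "\<And>b i. A' b i \<in> {-1, 0, 1}"
    and same: "\<And>b i. b \<in> B \<Longrightarrow> i \<in> F \<Longrightarrow> A b i \<noteq> 0 \<longleftrightarrow> A' b i \<noteq> 0"
    and bal: "balanced B F A" "balanced B F A'"
  shows "\<exists>t s. (\<forall>b. t b \<in> {1, -1}) \<and> (\<forall>i. s i \<in> {1, -1}) \<and> (\<forall>b\<in>B. \<forall>i\<in>F. A' b i = t b * s i * A b i)"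
  using assms(1) same bal
proof (induction F rule: finite_induct)
  case empty
  then show ?case by (intro exI[of _ "\<lambda>_. 1"]) auto
next
  case (insert i0 F)
  have "balanced B F A" "balanced B F A'" using insert.prems balanced_mono by blast+
  then have "\<exists>t s. (\<forall>b. t b \<in> {1, -1}) \<and> (\<forall>i. s i \<in> {1, -1}) \<and> (\<forall>b\<in>B. \<forall>i\<in>F.
      A' b i = t b * s i * A b i)"
  proof (rule insert.IH[rotated])
    show "A b i \<noteq> 0 \<longleftrightarrow> A' b i \<noteq> 0" if "b \<in> B" "i \<in> F" for b i
      using insert.prems(1) that by simp
  qed
  then obtain t s where t: "\<And>b. t b \<in> {1, -1}" and s: "\<And>i. s i \<in> {1, -1}"
    and eq: "\<And>b i. b \<in> B \<Longrightarrow> i \<in> F \<Longrightarrow> A' b i = t b * s i * A b i" by blast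
  define g where "g b = A b i0 * A' b i0 * t b" for b
  define R where "R = {(a, b). a \<in> B \<and> b \<in> B \<and> (\<exists>r\<in>F. A a r \<noteq> 0 \<and> A b r \<noteq> 0)}"
  define N where "N = {b \<in> B. A b i0 \<noteq> 0}"
  have g: "g b \<in> {1, -1}" if "b \<in> N" for b
    using that insert.prems(1)[of b i0] entries(1)[of b i0] entries(2)[of b i0] t[of b]
    by (auto simp: N_def g_def)
  have sym: "sym (R\<^sup>*)" by (intro sym_rtrancl) (auto simp: sym_def R_def)
  have const: "g a = g b" if "(a, b) \<in> R\<^sup>*" "a \<in> N" "b \<in> N" for a b
  proof -
    have "a \<in> B" using that by (simp add: N_def)
    from rtrancl_path[of a b B F "\<lambda>a r. A a r \<noteq> 0", OF that(1)[unfolded R_def] this]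
    obtain n c r where "c 0 = a \<and> c n = b \<and> (\<forall>j\<le>n. c j \<in> B) \<and>
      (\<forall>j<n. r j \<in> F \<and> A (c j) (r j) \<noteq> 0 \<and> A (c (Suc j)) (r j) \<noteq> 0)"
      by (elim exE)
    then have p: "c 0 = a" "c n = b" "\<And>j. j \<le> n \<Longrightarrow> c j \<in> B" "\<And>j. j < n \<Longrightarrow> r j \<in> F"
      "\<And>j. j < n \<Longrightarrow> A (c j) (r j) \<noteq> 0" "\<And>j. j < n \<Longrightarrow> A (c (Suc j)) (r j) \<noteq> 0"
      by blast+
    have "A (c 0) i0 * A' (c 0) i0 * t (c 0) = A (c n) i0 * A' (c n) i0 * t (c n)"
    proof (rule balanced_path[of A A' B i0 F t s n c r, OF entries(1) entries(2) insert.prems(1)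
      insert.prems(2,3) t s eq p(3-6)])
      show "A (c 0) i0 \<noteq> 0" "A (c n) i0 \<noteq> 0" using that(2,3) unfolding p(1,2) N_def by blast+
    qed
    then show ?thesis using p by (simp add: g_def)
  qed
  \<comment> \<open>A component that the new row does not meet keeps its signs, hence the default
    1.\<close>
  define k where "k b = (if \<exists>a\<in>N. (b, a) \<in> R\<^sup>* then g (SOME a. a \<in> N \<and> (b, a) \<in> R\<^sup>*) else 1)" for b
  have kg: "k b = g a" if "a \<in> N" "(b, a) \<in> R\<^sup>*" for a b
  proof -
    have "(SOME a. a \<in> N \<and> (b, a) \<in> R\<^sup>*) \<in> N \<and> (b, SOME a. a \<in> N \<and> (b, a) \<in> R\<^sup>*) \<in> R\<^sup>*"
      by (rule someI[of _ a]) (use that in blast)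
    moreover have "(a, b) \<in> R\<^sup>*" using that sym by (meson symD)
    ultimately have "g a = g (SOME a. a \<in> N \<and> (b, a) \<in> R\<^sup>*)"
      using that const by (meson rtrancl_trans)
    then show ?thesis using that by (auto simp: k_def)
  qed
  have k: "k b \<in> {1, -1}" for b
  proof (cases "\<exists>a\<in>N. (b, a) \<in> R\<^sup>*")
    case True
    then obtain a where "a \<in> N" "(b, a) \<in> R\<^sup>*" by blast
    then show ?thesis using kg g by metis
  qed (simp add: k_def)
  have kR: "k a = k b" if "(a, b) \<in> R" for a b
  proof (cases "\<exists>d\<in>N. (a, d) \<in> R\<^sup>*")
    case True
    then obtain d where d: "d \<in> N" "(a, d) \<in> R\<^sup>*" by blast
    have "(b, a) \<in> R" using that by (auto simp: R_def)
    then have "(b, d) \<in> R\<^sup>*" using d by (meson converse_rtrancl_into_rtrancl)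
    then show ?thesis using d kg by metis
  next
    case False
    then have "\<not> (\<exists>d\<in>N. (b, d) \<in> R\<^sup>*)" using that by (meson converse_rtrancl_into_rtrancl)
    then show ?thesis using False by (simp add: k_def)
  qed
  define t' where "t' b = t b * k b" for b
  \<comment> \<open>An old row is flipped along with the component of the columns it meets; by
    \<open>kR\<close> the choice of the column is immaterial.\<close>
  define s' where "s' i = (if i = i0 then 1 else s i * (if \<exists>b\<in>B. A b i \<noteq> 0 then k (SOME b. b \<in> B \<and>
      A b i \<noteq> 0) else 1))" for i
  have "t' b \<in> {1, -1}" for b using t[of b] k[of b] by (auto simp: t'_def)
  moreover have "s' i \<in> {1, -1}" for i
    using s[of i] k[of "SOME b. b \<in> B \<and> A b i \<noteq> 0"] by (auto simp: s'_def)
  moreover have "A' b i = t' b * s' i * A b i" if b: "b \<in> B" and i: "i \<in> insert i0 F" for b i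
  proof (cases "A b i = 0")
    case True
    then show ?thesis using insert.prems(1)[OF b i] by simp
  next
    case nz: False
    show ?thesis
    proof (cases "i = i0")
      case True
      then have "b \<in> N" using nz b by (simp add: N_def)
      then have "k b = g b" using kg by blast
      then have "t' b * s' i * A b i = (t b * t b) * (A b i0 * A b i0) * A' b i0"
        using True by (simp add: t'_def s'_def g_def)
      moreover have "A b i0 * A b i0 = 1" using nz True entries(1)[of b i0] by auto
      ultimately show ?thesis using sign_sq[OF t, of b] True by simp
    next
      case False
      then have iF: "i \<in> F" using i by simp
      have "(SOME b. b \<in> B \<and> A b i \<noteq> 0) \<in> B \<and> A (SOME b. b \<in> B \<and> A b i \<noteq> 0) i \<noteq> 0"
        by (rule someI[of _ b]) (use b nz in blast)
      then have "(b, SOME b. b \<in> B \<and> A b i \<noteq> 0) \<in> R" using b nz iF by (auto simp: R_def)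
      then have "s' i = s i * k b" using kR b nz False by (auto simp: s'_def)
      then have kk: "t' b * s' i * A b i = (k b * k b) * (t b * s i * A b i)" by (simp add: t'_def)
      show ?thesis by (simp only: kk eq[OF b iF] sign_sq[OF k] mult_1_left)
    qed
  qed
  ultimately show ?case by blast
qed


section \<open>Unimodular lattices are determined by their minimal supports\<close>

abbreviation lk :: "('i \<Rightarrow>\<^sub>0 'a::zero) \<Rightarrow> 'i \<Rightarrow> 'a" where "lk \<equiv> Poly_Mapping.lookup"

text \<open>For the cycles of a graph, \<open>E\<close> will be an orientation: the coordinates at
  the opposite darts are only the negatives, which is why an element is determined by its
  coordinates in \<open>E\<close>.\<close>

locale int_lattice =
  fixes L :: "('i \<Rightarrow>\<^sub>0 int) set" and E :: "'i set"
  assumes finite_E: "finite E"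
    and zero_mem: "0 \<in> L"
    and add_mem: "c \<in> L \<Longrightarrow> d \<in> L \<Longrightarrow> c + d \<in> L"
    and uminus_mem: "c \<in> L \<Longrightarrow> - c \<in> L"
    and eq_0I: "c \<in> L \<Longrightarrow> (\<And>i. i \<in> E \<Longrightarrow> lk c i = 0) \<Longrightarrow> c = 0"
begin

lemma diff_mem: "c \<in> L \<Longrightarrow> d \<in> L \<Longrightarrow> c - d \<in> L"
  using add_mem[of c "- d"] uminus_mem[of d] by simp

lemma cmul_mem: "c \<in> L \<Longrightarrow> frag_cmul k c \<in> L"
  by (rule frag_closure_minus_cmul[where P = "\<lambda>c. c \<in> L"]) (auto intro: zero_mem diff_mem)

lemma sum_mem: "(\<And>b. b \<in> B \<Longrightarrow> f b \<in> L) \<Longrightarrow> (\<Sum>b\<in>B. f b) \<in> L"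
  by (induction B rule: infinite_finite_induct) (auto intro: zero_mem add_mem)

lemma eqI: "c \<in> L \<Longrightarrow> d \<in> L \<Longrightarrow> (\<And>i. i \<in> E \<Longrightarrow> lk c i = lk d i) \<Longrightarrow> c = d"
  using eq_0I[of "c - d"] diff_mem by (simp add: lookup_minus)

end

definition support :: "'i set \<Rightarrow> ('i \<Rightarrow>\<^sub>0 int) \<Rightarrow> 'i set" where
  "support E c = {i \<in> E. lk c i \<noteq> 0}"

definition min_supports :: "('i \<Rightarrow>\<^sub>0 int) set \<Rightarrow> 'i set \<Rightarrow> 'i set set" where
  "min_supports L E = {C \<in> support E ` (L - {0}). \<forall>D\<in>support E ` (L - {0}). D \<subseteq> C \<longrightarrow> D = C}"

text \<open>Unimodularity without determinants, in the form in which it holds for Tutte's regular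
  chain groups.\<close>

locale unimodular_lattice = int_lattice +
  assumes conformal: "c \<in> L \<Longrightarrow> c \<noteq> 0 \<Longrightarrow> \<exists>u\<in>L. u \<noteq> 0 \<and> (\<forall>i\<in>E. lk u i \<in> {0, sgn (lk c i)})"

text \<open>The minimal sets of this kind are the complements of the bases of the matroid whose
  circuits are the minimal supports; for a graph, the complements of spanning forests.\<close>

definition determining :: "('i \<Rightarrow>\<^sub>0 int) set \<Rightarrow> 'i set \<Rightarrow> bool" where
  "determining L B \<longleftrightarrow> (\<forall>c\<in>L. (\<forall>i\<in>B. lk c i = 0) \<longrightarrow> c = 0)"

section \<open>Minimal supports and determining sets\<close>

context int_lattice
begin

lemma min_support_below:
  assumes "c \<in> L" "c \<noteq> 0"
  shows "\<exists>C\<in>min_supports L E. C \<subseteq> support E c"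
proof -
  let ?S = "{D \<in> support E ` (L - {0}). D \<subseteq> support E c}"
  have "finite ?S" by (rule finite_subset[of ?S "Pow E"]) (use finite_E in \<open>auto simp: support_def\<close>)
  moreover have "?S \<noteq> {}" using assms by blast
  ultimately obtain C where C: "C \<in> ?S" "\<forall>D\<in>?S. D \<subseteq> C \<longrightarrow> C = D"
    using finite_has_minimal[of ?S] by blast
  have "C \<in> min_supports L E"
    unfolding min_supports_def
  proof (rule CollectI, intro conjI ballI impI)
    fix D assume "D \<in> support E ` (L - {0})" "D \<subseteq> C"
    with C show "D = C" by blast
  qed (use C in blast)
  then show ?thesis using C by blast
qed

text \<open>A nonzero element that vanishes on \<open>B\<close> has a minimal support below its own,
  and \<open>B\<close> misses it. Being expressed by minimal supports alone, the notion carries over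
  to a second lattice with the same ones.\<close>

lemma determining_iff:
  assumes "B \<subseteq> E"
  shows "determining L B \<longleftrightarrow> (\<forall>C\<in>min_supports L E. B \<inter> C \<noteq> {})"
proof
  assume "determining L B"
  then show "\<forall>C\<in>min_supports L E. B \<inter> C \<noteq> {}"
    using assms by (fastforce simp: determining_def min_supports_def support_def)
next
  assume *: "\<forall>C\<in>min_supports L E. B \<inter> C \<noteq> {}"
  show "determining L B"
    unfolding determining_def
  proof (intro ballI impI, rule ccontr)
    fix c assume c: "c \<in> L" "\<forall>i\<in>B. lk c i = 0" "c \<noteq> 0"
    then obtain C where "C \<in> min_supports L E" "C \<subseteq> support E c"
      using min_support_below by blast
    then show False using * c by (fastforce simp: support_def)
  qed
qed

end

text \<open>The analogue of the fundamental cycles of a spanning forest. The map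
  \<open>\<epsilon>\<close> allows one set \<open>B\<close> to index such systems in two
  lattices.\<close>

definition dual_basis :: "('i \<Rightarrow>\<^sub>0 int) set \<Rightarrow> 'i set \<Rightarrow> 'b set \<Rightarrow> ('b \<Rightarrow> 'i) \<Rightarrow> ('b \<Rightarrow> 'i \<Rightarrow>\<^sub>0 int) \<Rightarrow>
    bool" where
  "dual_basis L E B \<epsilon> v \<longleftrightarrow> \<epsilon> ` B \<subseteq> E \<and> finite B \<and> determining L (\<epsilon> ` B) \<and>
     (\<forall>b\<in>B. v b \<in> L \<and> (\<forall>i\<in>E. lk (v b) i \<in> {-1, 0, 1}) \<and>
        (\<forall>b'\<in>B. lk (v b) (\<epsilon> b') = (if b' = b then 1 else 0)))"

section \<open>Fundamental elements over a minimal determining set\<close>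

context unimodular_lattice
begin

text \<open>Omitting \<open>b\<close> leaves a nonzero element that vanishes at the other
  coordinates of \<open>B\<close>. A conformal part of it vanishes there too, so its entry at
  \<open>b\<close> is 1 or -1.\<close>

lemma ex_dual_basis:
  assumes B: "\<epsilon> ` B \<subseteq> E" "finite B" "inj_on \<epsilon> B" "determining L (\<epsilon> ` B)"
    and min: "\<And>b. b \<in> B \<Longrightarrow> \<not> determining L (\<epsilon> ` (B - {b}))"
  shows "\<exists>v. dual_basis L E B \<epsilon> v"
proof -
  have "\<exists>w. w \<in> L \<and> (\<forall>i\<in>E. lk w i \<in> {-1, 0, 1}) \<and> (\<forall>b'\<in>B. lk w (\<epsilon> b') = (if b' = b then 1 else 0))"
    if b: "b \<in> B" for b
  proof -
    obtain c where c: "c \<in> L" "c \<noteq> 0" "\<And>b'. b' \<in> B \<Longrightarrow> b' \<noteq> b \<Longrightarrow> lk c (\<epsilon> b') = 0"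
      using min[OF b] unfolding determining_def by auto
    obtain u where u: "u \<in> L" "u \<noteq> 0" "\<forall>i\<in>E. lk u i \<in> {0, sgn (lk c i)}"
      using conformal[OF c(1,2)] by blast
    have u0: "lk u (\<epsilon> b') = 0" if "b' \<in> B" "b' \<noteq> b" for b'
      using u(3) c(3)[OF that] B(1) that by fastforce
    have "lk u (\<epsilon> b) \<noteq> 0"
      using B(4) u(1,2) u0 unfolding determining_def by blast
    moreover have ent: "\<forall>i\<in>E. lk u i \<in> {-1, 0, 1}"
      using u(3) by (auto simp: sgn_if split: if_splits)
    ultimately have "lk u (\<epsilon> b) = 1 \<or> lk u (\<epsilon> b) = -1" using B(1) b by blast
    then show ?thesis
    proof
      assume "lk u (\<epsilon> b) = 1"
      then show ?thesis using u(1) ent u0 by (intro exI[of _ u]) auto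
    next
      assume "lk u (\<epsilon> b) = -1"
      then show ?thesis using uminus_mem[OF u(1)] ent u0 by (intro exI[of _ "- u"]) fastforce
    qed
  qed
  then obtain v where "\<forall>b\<in>B. v b \<in> L \<and> (\<forall>i\<in>E. lk (v b) i \<in> {-1, 0, 1}) \<and>
      (\<forall>b'\<in>B. lk (v b) (\<epsilon> b') = (if b' = b then 1 else 0))" by metis
  then show ?thesis using B unfolding dual_basis_def by blast
qed

lemma dual_basis_expand:
  assumes "dual_basis L E B \<epsilon> v" "c \<in> L"
  shows "c = (\<Sum>b\<in>B. frag_cmul (lk c (\<epsilon> b)) (v b))"
proof -
  let ?s = "\<Sum>b\<in>B. frag_cmul (lk c (\<epsilon> b)) (v b)"
  have v: "finite B" "determining L (\<epsilon> ` B)" "\<And>b. b \<in> B \<Longrightarrow> v b \<in> L"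
    "\<And>b b'. b \<in> B \<Longrightarrow> b' \<in> B \<Longrightarrow> lk (v b) (\<epsilon> b') = (if b' = b then 1 else 0)"
    using assms(1) by (auto simp: dual_basis_def)
  have "?s \<in> L" using v by (intro sum_mem cmul_mem) auto
  then have mem: "c - ?s \<in> L" using assms(2) diff_mem by blast
  have "lk ?s (\<epsilon> b') = lk c (\<epsilon> b')" if "b' \<in> B" for b'
  proof -
    have "lk ?s (\<epsilon> b') = (\<Sum>b\<in>B. if b' = b then lk c (\<epsilon> b) else 0)"
      unfolding lookup_sum by (rule sum.cong) (use that v in auto)
    then show ?thesis using that v by simp
  qed
  then have "c - ?s = 0"
    using v(2) mem unfolding determining_def by (auto simp: lookup_minus)
  then show ?thesis by simp
qed

lemma lookup_dual_basis:
  assumes "dual_basis L E B \<epsilon> v" "c \<in> L"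
  shows "lk c i = (\<Sum>b\<in>B. lk c (\<epsilon> b) * lk (v b) i)"
proof -
  have "lk c i = lk (\<Sum>b\<in>B. frag_cmul (lk c (\<epsilon> b)) (v b)) i"
    using dual_basis_expand[OF assms] by simp
  then show ?thesis by (simp add: lookup_sum)
qed

text \<open>Along a chordless path the alternating combination has a conformal piece which must be
  everything, so no entry \<open>2\<close> can occur.\<close>

lemma dual_basis_balanced:
  assumes v: "dual_basis L E B \<epsilon> v" and inj: "inj_on \<epsilon> B" and F: "\<eta> ` F \<subseteq> E"
  shows "balanced B F (\<lambda>b i. if b \<in> B \<and> i \<in> F then lk (v b) (\<eta> i) else 0)" (is "balanced B F ?A")
  unfolding balanced_def
proof (intro allI impI, elim conjE)
  fix n :: nat and c r i and x :: "nat \<Rightarrow> int"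
  assume n: "0 < n" and cB: "\<forall>j\<le>n. c j \<in> B" and injc: "inj_on c {..n}" and rF: "\<forall>j<n. r j \<in> F"
    and iF: "i \<in> F" and x: "\<forall>j\<le>n. x j \<in> {1, -1}"
    and adj: "\<forall>j<n. \<forall>m\<le>n. ?A (c m) (r j) \<noteq> 0 \<longleftrightarrow> m = j \<or> m = Suc j"
    and adji: "\<forall>m\<le>n. ?A (c m) i \<noteq> 0 \<longleftrightarrow> m = 0 \<or> m = n"
    and rel: "\<forall>j<n. x j * ?A (c j) (r j) + x (Suc j) * ?A (c (Suc j)) (r j) = 0"
  have A: "?A b i = lk (v b) (\<eta> i)" if "b \<in> B" "i \<in> F" for b i
    using that by simp
  have ent: "lk (v b) i \<in> {-1, 0, 1}" if "b \<in> B" "i \<in> E" for b i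
    using v that by (auto simp: dual_basis_def)
  have vL: "v b \<in> L" if "b \<in> B" for b using v that by (auto simp: dual_basis_def)
  have delta: "lk (v b) (\<epsilon> b') = (if b' = b then 1 else 0)" if "b \<in> B" "b' \<in> B" for b b'
    using v that by (auto simp: dual_basis_def)
  define w where "w = (\<Sum>j\<le>n. frag_cmul (x j) (v (c j)))"
  have w: "w \<in> L" unfolding w_def using cB vL by (intro sum_mem cmul_mem) auto
  have lkw: "lk w k = (\<Sum>j\<le>n. x j * lk (v (c j)) k)" for k
    by (simp add: w_def lookup_sum)
  have wc: "lk w (\<epsilon> (c m)) = x m" if "m \<le> n" for m
  proof -
    have "lk w (\<epsilon> (c m)) = (\<Sum>j\<le>n. if j = m then x j else 0)"
      unfolding lkw using that cB delta injc by (intro sum.cong) (auto dest: inj_onD)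
    then show ?thesis using that by simp
  qed
  have w0: "lk w (\<epsilon> b) = 0" if "b \<in> B" "b \<notin> c ` {..n}" for b
    unfolding lkw using that cB delta by (intro sum.neutral) auto
  have two: "(\<Sum>j\<le>n. y j * lk (v (c j)) (\<eta> (r l))) =
      y l * lk (v (c l)) (\<eta> (r l)) + y (Suc l) * lk (v (c (Suc l))) (\<eta> (r l))" if "l <
        n" for l and y :: "nat \<Rightarrow> int"
  proof -
    have "(\<Sum>j\<le>n. y j * lk (v (c j)) (\<eta> (r l))) = (\<Sum>j\<in>{l, Suc l}. y j * lk (v (c j)) (\<eta> (r l)))"
      using that adj cB rF by (intro sum.mono_neutral_right) auto
    then show ?thesis by simp
  qed
  have ends: "(\<Sum>j\<le>n. y j * lk (v (c j)) (\<eta> i)) = y 0 * lk (v (c 0)) (\<eta> i) + y n * lk (v (c n)) (\<eta>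
      i)" for y :: "nat \<Rightarrow> int"
  proof -
    have "(\<Sum>j\<le>n. y j * lk (v (c j)) (\<eta> i)) = (\<Sum>j\<in>{0, n}. y j * lk (v (c j)) (\<eta> i))"
      using adji cB iF by (intro sum.mono_neutral_right) auto
    then show ?thesis using n by simp
  qed
  show "x 0 * ?A (c 0) i + x n * ?A (c n) i = 0"
  proof (rule ccontr)
    assume "x 0 * ?A (c 0) i + x n * ?A (c n) i \<noteq> 0"
    then have nz: "x 0 * lk (v (c 0)) (\<eta> i) + x n * lk (v (c n)) (\<eta> i) \<noteq> 0"
      using cB iF by simp
    have \<eta>i: "\<eta> i \<in> E" using F iF by blast
    have "w \<noteq> 0" using wc[of 0] x by auto
    then obtain u where u: "u \<in> L" "u \<noteq> 0" "\<And>k. k \<in> E \<Longrightarrow> lk u k \<in> {0, sgn (lk w k)}"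
      using conformal[OF w] by blast
    have \<epsilon>E: "\<epsilon> b \<in> E" if "b \<in> B" for b using v that by (auto simp: dual_basis_def)
    have uc: "lk u (\<epsilon> (c m)) \<in> {0, x m}" if "m \<le> n" for m
      using u(3)[OF \<epsilon>E] cB x that wc[OF that] by (metis insertE insertI1 insertI2 sgn_1_neg
        sgn_1_pos sgn_minus_1 singletonD sgn_1)
    have u0: "lk u (\<epsilon> b) = 0" if "b \<in> B" "b \<notin> c ` {..n}" for b
      using u(3)[OF \<epsilon>E[OF that(1)]] w0[OF that] by auto
    have lku: "lk u k = (\<Sum>j\<le>n. lk u (\<epsilon> (c j)) * lk (v (c j)) k)" for k
    proof -
      have "lk u k = (\<Sum>b\<in>B. lk u (\<epsilon> b) * lk (v b) k)" by (rule lookup_dual_basis[OF v u(1)])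
      also have "\<dots> = (\<Sum>b\<in>c ` {..n}. lk u (\<epsilon> b) * lk (v b) k)"
        using v cB u0 by (intro sum.mono_neutral_right) (auto simp: dual_basis_def)
      also have "\<dots> = (\<Sum>j\<le>n. lk u (\<epsilon> (c j)) * lk (v (c j)) k)"
        using sum.reindex[OF injc] by simp
      finally show ?thesis .
    qed
    \<comment> \<open>In row \<open>r l\<close> the combination \<open>w\<close> vanishes, hence so
      does its conformal part \<open>u\<close>; the two terms that \<open>u\<close> has there vanish
      together.\<close>
    have step: "lk u (\<epsilon> (c l)) \<noteq> 0 \<longleftrightarrow> lk u (\<epsilon> (c (Suc l))) \<noteq> 0" if l: "l < n" for l
    proof -
      have rl: "\<eta> (r l) \<in> E" using F rF l by blast
      have "lk w (\<eta> (r l)) = 0"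
        unfolding lkw two[OF l] using rel[rule_format, OF l] cB[rule_format, of l] cB[rule_format,
          of "Suc l"] rF l by simp
      then have "lk u (\<eta> (r l)) = 0" using u(3)[OF rl] by auto
      then have "lk u (\<epsilon> (c l)) * lk (v (c l)) (\<eta> (r l)) + lk u (\<epsilon> (c (Suc l))) * lk (v (c (Suc
          l))) (\<eta> (r l)) = 0"
        unfolding lku[of "\<eta> (r l)"] two[OF l] .
      moreover have "lk (v (c l)) (\<eta> (r l)) \<noteq> 0" "lk (v (c (Suc l))) (\<eta> (r l)) \<noteq> 0"
        using adj[rule_format, OF l, of l] adj[rule_format, OF l, of "Suc l"] l cB rF by auto
      ultimately show ?thesis by auto
    qed
    have all: "lk u (\<epsilon> (c m)) \<noteq> 0 \<longleftrightarrow> lk u (\<epsilon> (c 0)) \<noteq> 0" if "m \<le> n" for m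
      using that by (induction m) (auto simp: step)
    have "lk u (\<epsilon> (c 0)) \<noteq> 0"
    proof
      assume "lk u (\<epsilon> (c 0)) = 0"
      then have "lk u k = 0" for k unfolding lku[of k] using all by (intro sum.neutral) auto
      then show False using u(2) by (auto intro: poly_mapping_eqI)
    qed
    \<comment> \<open>So \<open>u\<close> involves all columns, with the coefficients of
      \<open>w\<close>. Its entry at \<open>i\<close> is the sum in question, which is 0, 2 or -2,
      while the entries of \<open>u\<close> are 0, 1 or -1.\<close>
    then have "lk u (\<epsilon> (c m)) = x m" if "m \<le> n" for m using all[OF that] uc[OF that] by auto
    then have "lk u (\<eta> i) = x 0 * lk (v (c 0)) (\<eta> i) + x n * lk (v (c n)) (\<eta> i)"
      unfolding lku[of "\<eta> i"] ends by simp
    moreover have "lk u (\<eta> i) \<in> {-1, 0, 1}" using u(3)[OF \<eta>i] by (auto simp: sgn_if split: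
      if_splits)
    moreover have "x 0 \<in> {1,-1}" "x n \<in> {1,-1}" using x by auto
    moreover have "lk (v (c 0)) (\<eta> i) \<in> {1,-1}" "lk (v (c n)) (\<eta> i) \<in> {1,-1}"
      using ent[OF _ \<eta>i] adji[rule_format, of 0] adji[rule_format, of n] cB iF by fastforce+
    ultimately show False using nz by auto
  qed
qed

text \<open>By the expansion, an element that vanishes at the other basis coordinates is a multiple
  of \<open>v b\<close>; an element supported inside the support of \<open>v b\<close> is of this
  kind.\<close>

lemma dual_basis_min_support:
  assumes v: "dual_basis L E B \<epsilon> v" and b: "b \<in> B"
  shows "support E (v b) \<in> min_supports L E"
    and "d \<in> L \<Longrightarrow> d \<noteq> 0 \<Longrightarrow> (\<forall>b'\<in>B. b' \<noteq> b \<longrightarrow> lk d (\<epsilon> b') = 0) \<Longrightarrow> support E d = support E (v b)"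
proof -
  have fin: "finite B" and \<epsilon>E: "\<epsilon> ` B \<subseteq> E" and vL: "v b \<in> L"
    and delta: "\<And>b'. b' \<in> B \<Longrightarrow> lk (v b) (\<epsilon> b') = (if b' = b then 1 else 0)"
    using v b by (auto simp: dual_basis_def)
  have *: "support E d = support E (v b)"
    if d: "d \<in> L" "d \<noteq> 0" "\<forall>b'\<in>B. b' \<noteq> b \<longrightarrow> lk d (\<epsilon> b') = 0" for d
  proof -
    have lkd: "lk d i = lk d (\<epsilon> b) * lk (v b) i" for i
    proof -
      have "lk d i = (\<Sum>b'\<in>B. lk d (\<epsilon> b') * lk (v b') i)" by (rule lookup_dual_basis[OF v d(1)])
      also have "\<dots> = (\<Sum>b'\<in>{b}. lk d (\<epsilon> b') * lk (v b') i)"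
        using fin b d(3) by (intro sum.mono_neutral_right) auto
      finally show ?thesis by simp
    qed
    have "lk d (\<epsilon> b) \<noteq> 0" using lkd d(2) by (metis mult_zero_left poly_mapping_eqI lookup_zero)
    then show ?thesis using lkd unfolding support_def by (metis (no_types, lifting) mult_eq_0_iff)
  qed
  then show "d \<in> L \<Longrightarrow> d \<noteq> 0 \<Longrightarrow> (\<forall>b'\<in>B. b' \<noteq> b \<longrightarrow> lk d (\<epsilon> b') = 0) \<Longrightarrow> support E d = support E (v b)" .
  have "v b \<noteq> 0" using delta[OF b] by auto
  moreover have "support E d = support E (v b)" if "d \<in> L" "d \<noteq> 0" "support E d \<subseteq> support E (v b)"
    for d
  proof (rule *)
    show "\<forall>b'\<in>B. b' \<noteq> b \<longrightarrow> lk d (\<epsilon> b') = 0"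
    proof (intro ballI impI, rule ccontr)
      fix b' assume "b' \<in> B" "b' \<noteq> b" "lk d (\<epsilon> b') \<noteq> 0"
      then have "\<epsilon> b' \<in> support E (v b)" using that \<epsilon>E by (auto simp: support_def)
      then show False using delta[of b'] \<open>b' \<in> B\<close> \<open>b' \<noteq> b\<close> by (simp add: support_def)
    qed
  qed (use that in auto)
  ultimately show "support E (v b) \<in> min_supports L E"
    using vL unfolding min_supports_def by blast
qed

end

text \<open>Since determining sets correspond, both lattices have dual bases over corresponding
  coordinates. The supports of the basis elements correspond as well, so the two coordinate matrices
  have the same zero pattern, and a balanced signing of a pattern is unique up to signs of rows and
  columns.\<close>

theorem unimodular_unique:
  assumes L: "unimodular_lattice L E" and L': "unimodular_lattice L' E'"
    and \<epsilon>: "bij_betw \<epsilon> E E'" and circ: "(`) \<epsilon> ` min_supports L E = min_supports L' E'"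
  shows "\<exists>\<phi> s. bij_betw \<phi> L L' \<and> (\<forall>c\<in>L. \<forall>d\<in>L. \<phi> (c + d) = \<phi> c + \<phi> d) \<and> (\<forall>i\<in>E. s i \<in> {1, -1}) \<and>
    (\<forall>c\<in>L. \<forall>i\<in>E. lk (\<phi> c) (\<epsilon> i) = s i * lk c i)"
proof -
  interpret L: unimodular_lattice L E by (rule L)
  interpret L': unimodular_lattice L' E' by (rule L')
  have inj: "inj_on \<epsilon> E" and img: "\<epsilon> ` E = E'" using \<epsilon> by (auto simp: bij_betw_def)
  have det: "determining L' (\<epsilon> ` B) \<longleftrightarrow> determining L B" if "B \<subseteq> E" for B
  proof -
    have "\<epsilon> ` B \<inter> \<epsilon> ` C = \<epsilon> ` (B \<inter> C)" if "C \<in> min_supports L E" for C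
      using inj_on_image_Int[OF inj \<open>B \<subseteq> E\<close>, of C] that by (auto simp: min_supports_def support_def)
    then show ?thesis
      using that img by (subst L.determining_iff, simp, subst L'.determining_iff)
        (auto simp: circ[symmetric])
  qed
  have "determining L E" unfolding determining_def using L.eq_0I by blast
  then have "{B. B \<subseteq> E \<and> determining L B} \<noteq> {}" by blast
  moreover have "finite {B. B \<subseteq> E \<and> determining L B}"
    by (rule finite_subset[of _ "Pow E"]) (use L.finite_E in auto)
  ultimately obtain B where "B \<in> {B. B \<subseteq> E \<and> determining L B}"
    and minB: "\<forall>D\<in>{B. B \<subseteq> E \<and> determining L B}. D \<subseteq> B \<longrightarrow> B = D"
    using finite_has_minimal[of "{B. B \<subseteq> E \<and> determining L B}"] by blast
  then have BE: "B \<subseteq> E" and dB: "determining L B" by auto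
  have min: "\<not> determining L (B - {b})" if "b \<in> B" for b
    using minB that BE by blast
  have finB: "finite B" using BE L.finite_E finite_subset by blast
  have injB: "inj_on \<epsilon> B" using inj BE inj_on_subset by blast
  obtain v where v: "dual_basis L E B id v"
    using L.ex_dual_basis[of id B] BE finB dB min by auto
  obtain v' where v': "dual_basis L' E' B \<epsilon> v'"
    using L'.ex_dual_basis[of \<epsilon> B] BE finB dB min det[of B] det[of "B - {_}"] injB img
    by (metis (no_types, lifting) Diff_subset image_mono subset_trans)
  \<comment> \<open>The image of the support of \<open>v b\<close> is the support of some
    \<open>d\<close>; it avoids the other basis coordinates, so \<open>d\<close> is a multiple of
    \<open>v' b\<close>.\<close>
  have supp: "support E' (v' b) = \<epsilon> ` support E (v b)" if b: "b \<in> B" for b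
  proof -
    have "\<epsilon> ` support E (v b) \<in> min_supports L' E'"
      using L.dual_basis_min_support(1)[OF v b] circ by blast
    then have "\<epsilon> ` support E (v b) \<in> support E' ` (L' - {0})"
      unfolding min_supports_def mem_Collect_eq by (rule conjunct1)
    then obtain d where "\<epsilon> ` support E (v b) = support E' d" "d \<in> L' - {0}" by (rule imageE)
    then have d: "d \<in> L'" "d \<noteq> 0" "support E' d = \<epsilon> ` support E (v b)" by simp_all
    have "lk d (\<epsilon> b') = 0" if b': "b' \<in> B" "b' \<noteq> b" for b'
    proof (rule ccontr)
      assume "lk d (\<epsilon> b') \<noteq> 0"
      then have "\<epsilon> b' \<in> support E' d" using b' BE img by (auto simp: support_def)
      then have "\<epsilon> b' \<in> \<epsilon> ` support E (v b)" unfolding d(3) .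
      then have "b' \<in> support E (v b)" using inj b' BE by (auto simp: support_def dest: inj_onD)
      then show False using v b b' by (auto simp: support_def dual_basis_def)
    qed
    then show ?thesis using L'.dual_basis_min_support(2)[OF v' b d(1,2)] d(3) by simp
  qed
  define A where "A b i = (if b \<in> B \<and> i \<in> E then lk (v b) i else 0)" for b i
  define A' where "A' b i = (if b \<in> B \<and> i \<in> E then lk (v' b) (\<epsilon> i) else 0)" for b i
  have same: "A b i \<noteq> 0 \<longleftrightarrow> A' b i \<noteq> 0" if "b \<in> B" "i \<in> E" for b i
  proof -
    have "lk (v' b) (\<epsilon> i) \<noteq> 0 \<longleftrightarrow> \<epsilon> i \<in> support E' (v' b)" using that img by (auto simp: support_def)
    also have "\<dots> \<longleftrightarrow> i \<in> support E (v b)"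
      unfolding supp[OF that(1)] using inj that by (auto simp: support_def dest: inj_onD)
    finally show ?thesis using that by (simp add: A_def A'_def support_def)
  qed
  have "balanced B E A"
    using L.dual_basis_balanced[OF v, of id E] unfolding A_def[abs_def] id_apply by simp
  moreover have "balanced B E A'"
    using L'.dual_basis_balanced[OF v' injB, of \<epsilon> E] img unfolding A'_def[abs_def] by simp
  moreover have "A b i \<in> {-1, 0, 1}" "A' b i \<in> {-1, 0, 1}" for b i
  proof -
    have "\<forall>i\<in>E. lk (v b) i \<in> {-1, 0, 1}" "\<forall>i\<in>E'. lk (v' b) i \<in> {-1, 0, 1}" if "b \<in> B"
      using v v' that unfolding dual_basis_def by blast+
    then show "A b i \<in> {-1, 0, 1}" "A' b i \<in> {-1, 0, 1}"
      unfolding A_def A'_def img[symmetric] by auto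
  qed
  ultimately obtain t s where t: "\<forall>b. t b \<in> {1, -1}" and s: "\<forall>i. s i \<in> {1, -1}"
    and eq: "\<forall>b\<in>B. \<forall>i\<in>E. A' b i = t b * s i * A b i"
    using balanced_signing_unique[OF L.finite_E, of A A' B] same by blast
  have tt: "t b * t b = 1" for b using t sign_sq by blast
  have ss: "s b * s b = 1" for b using s sign_sq by blast
  have vv: "lk (v' b) (\<epsilon> i) = t b * s i * lk (v b) i" if "b \<in> B" "i \<in> E" for b i
    using eq that by (auto simp: A_def A'_def)
  \<comment> \<open>Basis coordinates are carried over. The column signs \<open>t\<close> are
    absorbed here; the row signs \<open>s\<close> stay visible in \<open>\<phi>lk\<close>.\<close>
  define \<phi> where "\<phi> c = (\<Sum>b\<in>B. frag_cmul (lk c b) (frag_cmul (t b) (v' b)))" for c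
  have vL': "v' b \<in> L'" and vL: "v b \<in> L" if "b \<in> B" for b
    using that v v' by (auto simp: dual_basis_def)
  have \<phi>L: "\<phi> c \<in> L'" for c
    unfolding \<phi>_def using vL' by (intro L'.sum_mem L'.cmul_mem) auto
  have \<phi>lk: "lk (\<phi> c) (\<epsilon> i) = s i * lk c i" if "c \<in> L" "i \<in> E" for c i
  proof -
    have "lk (\<phi> c) (\<epsilon> i) = (\<Sum>b\<in>B. lk c b * (t b * lk (v' b) (\<epsilon> i)))"
      by (simp add: \<phi>_def lookup_sum mult.assoc)
    also have "\<dots> = (\<Sum>b\<in>B. s i * (lk c (id b) * lk (v b) i))"
    proof (rule sum.cong)
      fix b assume b: "b \<in> B"
      have "lk c b * (t b * lk (v' b) (\<epsilon> i)) = (t b * t b) * (s i * (lk c b * lk (v b) i))"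
        unfolding vv[OF b that(2)] by (simp only: mult_ac)
      then show "lk c b * (t b * lk (v' b) (\<epsilon> i)) = s i * (lk c (id b) * lk (v b) i)"
        by (simp add: tt)
    qed simp
    also have "\<dots> = s i * lk c i"
      by (simp only: L.lookup_dual_basis[OF v that(1), of i] sum_distrib_left)
    finally show ?thesis .
  qed
  have add: "\<phi> (c + d) = \<phi> c + \<phi> d" for c d
    by (simp add: \<phi>_def lookup_add distrib_right frag_cmul_distrib sum.distrib)
  have "bij_betw \<phi> L L'"
    unfolding bij_betw_def
  proof
    show "inj_on \<phi> L"
    proof (rule inj_onI)
      fix c d assume cd: "c \<in> L" "d \<in> L" "\<phi> c = \<phi> d"
      show "c = d"
      proof (rule L.eqI[OF cd(1,2)])
        fix i assume "i \<in> E"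
        then have "s i * lk c i = s i * lk d i" using \<phi>lk cd by metis
        then show "lk c i = lk d i" using s[rule_format, of i] by auto
      qed
    qed
    show "\<phi> ` L = L'"
    proof
      show "L' \<subseteq> \<phi> ` L"
      proof
        fix c' assume c': "c' \<in> L'"
        define c where "c = (\<Sum>b\<in>B. frag_cmul (lk c' (\<epsilon> b)) (frag_cmul (t b) (v b)))"
        have c: "c \<in> L" unfolding c_def using vL by (intro L.sum_mem L.cmul_mem) auto
        have "\<phi> c = c'"
        proof (rule L'.eqI[OF \<phi>L c'])
          fix i' assume "i' \<in> E'"
          then obtain i where i: "i \<in> E" "i' = \<epsilon> i" using img by blast
          have "lk (\<phi> c) (\<epsilon> i) = s i * (\<Sum>b\<in>B. lk c' (\<epsilon> b) * (t b * lk (v b) i))"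
            using \<phi>lk[OF c i(1)] by (simp add: c_def lookup_sum mult.assoc)
          also have "\<dots> = (\<Sum>b\<in>B. lk c' (\<epsilon> b) * lk (v' b) (\<epsilon> i))"
            unfolding sum_distrib_left by (intro sum.cong refl, subst vv) (use i in \<open>simp_all add:
              mult_ac\<close>)
          also have "\<dots> = lk c' (\<epsilon> i)" by (rule L'.lookup_dual_basis[OF v' c', symmetric])
          finally show "lk (\<phi> c) i' = lk c' i'" by (simp add: i)
        qed
        then show "c' \<in> \<phi> ` L" using c by blast
      qed
    qed (use \<phi>L in blast)
  qed
  then show ?thesis using add \<phi>lk s by blast
qed


section \<open>Rings of compatible exponents\<close>

text \<open>The cographic ring depends on the graph only through its lattice of cycles and the
  relation of lying in a common cone, so both become parameters.\<close>

definition sring :: "'a::ab_group_add set \<Rightarrow> ('a \<Rightarrow> 'a \<Rightarrow> bool) \<Rightarrow> ('a \<Rightarrow>\<^sub>0 'k::field) ring" where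
  "sring L cc =
     \<lparr>carrier = {p. Poly_Mapping.keys p \<subseteq> L},
      mult = (\<lambda>p q. \<Sum>c\<in>Poly_Mapping.keys p. \<Sum>c'\<in>Poly_Mapping.keys q.
                if cc c c' then Poly_Mapping.single (c + c') (lk p c * lk q c') else 0),
      one = Poly_Mapping.single 0 1,
      zero = 0,
      add = (+)\<rparr>"

lemma cographic_ring_eq: "cographic_ring G = sring (H1 G) (in_common_cone G)"
  by (simp add: cographic_ring_def sring_def)

lemma sring_simps [simp]:
  "carrier (sring L cc) = {p. Poly_Mapping.keys p \<subseteq> L}"
  "one (sring L cc) = Poly_Mapping.single 0 1"
  "zero (sring L cc) = 0"
  "add (sring L cc) = (+)"
  by (simp_all add: sring_def)

lemma lookup_sring_mult:
  "lk (mult (sring L cc) p q) e =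
     (\<Sum>c\<in>Poly_Mapping.keys p. \<Sum>d\<in>Poly_Mapping.keys q. if cc c d \<and> c + d = e then lk p c * lk q d
       else 0)"
  unfolding sring_def monoid.simps ring.simps lookup_sum
  by (intro sum.cong) (auto simp: lookup_single when_def)

lemma sring_mult_closed:
  assumes "\<And>c d. c \<in> L \<Longrightarrow> d \<in> L \<Longrightarrow> c + d \<in> L" "p \<in> carrier (sring L cc)" "q \<in> carrier (sring L cc)"
  shows "mult (sring L cc) p q \<in> carrier (sring L cc)"
proof -
  have "e \<in> L" if "lk (mult (sring L cc) p q) e \<noteq> 0" for e
  proof (rule ccontr)
    assume "e \<notin> L"
    then have "lk (mult (sring L cc) p q) e = 0"
      unfolding lookup_sring_mult using assms by (intro sum.neutral ballI) auto
    with that show False by simp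
  qed
  then show ?thesis by (auto simp: in_keys_iff)
qed

text \<open>Besides carrying ring elements along a map of exponents, this serves to relabel the
  darts of a cycle and, with the identity map, to write an element as the sum of its terms.\<close>

definition push :: "('a \<Rightarrow> 'b) \<Rightarrow> ('a \<Rightarrow>\<^sub>0 'k::comm_monoid_add) \<Rightarrow> ('b \<Rightarrow>\<^sub>0 'k)" where
  "push \<phi> p = (\<Sum>c\<in>Poly_Mapping.keys p. Poly_Mapping.single (\<phi> c) (lk p c))"

lemma lookup_push:
  assumes "inj_on \<phi> L" "Poly_Mapping.keys p \<subseteq> L" "c \<in> L"
  shows "lk (push \<phi> p) (\<phi> c) = lk p c"
proof -
  have "lk (push \<phi> p) (\<phi> c) = (\<Sum>d\<in>Poly_Mapping.keys p. if d = c then lk p d else 0)"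
    unfolding push_def lookup_sum using assms
    by (intro sum.cong) (auto simp: lookup_single when_def dest: inj_onD)
  then show ?thesis by (simp add: in_keys_iff)
qed

lemma lookup_push_outside:
  assumes "Poly_Mapping.keys p \<subseteq> L" "e \<notin> \<phi> ` L"
  shows "lk (push \<phi> p) e = 0"
  unfolding push_def lookup_sum using assms
  by (intro sum.neutral) (auto simp: lookup_single when_def)

lemma keys_push:
  assumes "inj_on \<phi> L" "Poly_Mapping.keys p \<subseteq> L"
  shows "Poly_Mapping.keys (push \<phi> p) = \<phi> ` Poly_Mapping.keys p"
proof -
  have "e \<in> Poly_Mapping.keys (push \<phi> p) \<longleftrightarrow> e \<in> \<phi> ` Poly_Mapping.keys p" for e
  proof (cases "e \<in> \<phi> ` L")
    case True
    then obtain c where c: "c \<in> L" "e = \<phi> c" by blast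
    then have "e \<in> \<phi> ` Poly_Mapping.keys p \<longleftrightarrow> c \<in> Poly_Mapping.keys p"
      using assms by (auto dest: inj_onD)
    then show ?thesis using lookup_push[OF assms c(1)] c by (simp add: in_keys_iff)
  next
    case False
    then show ?thesis using lookup_push_outside[OF assms(2) False] assms(2)
      by (auto simp: in_keys_iff)
  qed
  then show ?thesis by blast
qed

lemma sring_iso:
  fixes \<phi> :: "'a::ab_group_add \<Rightarrow> 'b::ab_group_add"
  assumes bij: "bij_betw \<phi> L L'" and zero: "0 \<in> L" "\<phi> 0 = 0"
    and closed: "\<And>c d. c \<in> L \<Longrightarrow> d \<in> L \<Longrightarrow> c + d \<in> L"
    and cc: "\<And>c d. c \<in> L \<Longrightarrow> d \<in> L \<Longrightarrow> cc' (\<phi> c) (\<phi> d) \<longleftrightarrow> cc c d"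
    and add: "\<And>c d. c \<in> L \<Longrightarrow> d \<in> L \<Longrightarrow> \<phi> (c + d) = \<phi> c + \<phi> d"
  shows "(sring L cc :: ('a \<Rightarrow>\<^sub>0 'k::field) ring) \<simeq> (sring L' cc' :: ('b \<Rightarrow>\<^sub>0 'k) ring)"
proof -
  have inj: "inj_on \<phi> L" and img: "\<phi> ` L = L'" using bij by (auto simp: bij_betw_def)
  let ?R = "sring L cc :: ('a \<Rightarrow>\<^sub>0 'k) ring" and ?R' = "sring L' cc' :: ('b \<Rightarrow>\<^sub>0 'k) ring"
  have eqI: "p = q" if "\<And>c. c \<in> L \<Longrightarrow> lk p (\<phi> c) = lk q (\<phi> c)" "\<And>e. e \<notin> L' \<Longrightarrow> lk p e = lk q e"
    for p q :: "'b \<Rightarrow>\<^sub>0 'k"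
  proof (rule poly_mapping_eqI)
    fix e show "lk p e = lk q e"
    proof (cases "e \<in> L'")
      case True
      then obtain c where "c \<in> L" "e = \<phi> c" using img by blast
      then show ?thesis using that(1) by simp
    qed (use that(2) in simp)
  qed
  have push: "lk (push \<phi> p) (\<phi> c) = lk p c" if "p \<in> carrier ?R" "c \<in> L" for p c
    using lookup_push[OF inj _ that(2)] that by simp
  have push0: "lk (push \<phi> p) e = 0" if "p \<in> carrier ?R" "e \<notin> L'" for p e
    using lookup_push_outside[of p L e \<phi>] that img by simp
  have keys: "Poly_Mapping.keys (push \<phi> p) = \<phi> ` Poly_Mapping.keys p" if "p \<in> carrier ?R" for p
    using keys_push[OF inj, of p] that by simp
  have ring_hom: "push \<phi> \<in> ring_hom ?R ?R'"
  proof (rule ring_hom_memI)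
    fix p assume p: "p \<in> carrier ?R"
    show "push \<phi> p \<in> carrier ?R'" using keys[OF p] p img by auto
  next
    fix p q assume p: "p \<in> carrier ?R" and q: "q \<in> carrier ?R"
    have pq: "mult ?R p q \<in> carrier ?R" by (rule sring_mult_closed[OF closed p q])
    have "Poly_Mapping.keys (p + q) \<subseteq> L" using p q keys_add[of p q] by auto
    then have pq': "p + q \<in> carrier ?R" by simp
    show "push \<phi> (add ?R p q) = add ?R' (push \<phi> p) (push \<phi> q)"
      using push[OF pq'] push[OF p] push[OF q] push0[OF pq'] push0[OF p] push0[OF q]
      by (intro eqI) (simp_all add: lookup_add)
    have injp: "inj_on \<phi> (Poly_Mapping.keys p)" and injq: "inj_on \<phi> (Poly_Mapping.keys q)"
      using inj p q by (auto intro: inj_on_subset)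
    have mult: "lk (mult ?R' (push \<phi> p) (push \<phi> q)) e =
        (\<Sum>c\<in>Poly_Mapping.keys p. \<Sum>d\<in>Poly_Mapping.keys q.
            if cc c d \<and> \<phi> (c + d) = e then lk p c * lk q d else 0)" for e
    proof -
      have "lk (mult ?R' (push \<phi> p) (push \<phi> q)) e =
        (\<Sum>c\<in>Poly_Mapping.keys p. \<Sum>d\<in>Poly_Mapping.keys q.
            if cc' (\<phi> c) (\<phi> d) \<and> \<phi> c + \<phi> d = e then lk (push \<phi> p) (\<phi> c) * lk (push \<phi> q) (\<phi> d) else
              0)"
        unfolding lookup_sring_mult keys[OF p] keys[OF q] sum.reindex[OF injp] sum.reindex[OF
          injq] o_def ..
      also have "\<dots> = (\<Sum>c\<in>Poly_Mapping.keys p. \<Sum>d\<in>Poly_Mapping.keys q.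
            if cc c d \<and> \<phi> (c + d) = e then lk p c * lk q d else 0)"
      proof (intro sum.cong refl)
        fix c d assume "c \<in> Poly_Mapping.keys p" "d \<in> Poly_Mapping.keys q"
        then have "c \<in> L" "d \<in> L" using p q by auto
        then show "(if cc' (\<phi> c) (\<phi> d) \<and> \<phi> c + \<phi> d = e then lk (push \<phi> p) (\<phi> c) * lk (push \<phi> q) (\<phi>
            d) else 0)
           = (if cc c d \<and> \<phi> (c + d) = e then lk p c * lk q d else 0)"
          using cc add push[OF p] push[OF q] by simp
      qed
      finally show ?thesis .
    qed
    show "push \<phi> (mult ?R p q) = mult ?R' (push \<phi> p) (push \<phi> q)"
    proof (rule eqI)
      fix e assume e: "e \<in> L"
      have "\<phi> (c + d) = \<phi> e \<longleftrightarrow> c + d = e" if "c \<in> Poly_Mapping.keys p" "d \<in> Poly_Mapping.keys q"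
        for c d
      proof -
        have "c + d \<in> L" using that p q closed by auto
        then show ?thesis using inj e by (auto dest: inj_onD)
      qed
      then show "lk (push \<phi> (mult ?R p q)) (\<phi> e) = lk (mult ?R' (push \<phi> p) (push \<phi> q)) (\<phi> e)"
        unfolding push[OF pq e] mult lookup_sring_mult[of L cc] by (intro sum.cong refl) auto
    next
      fix e assume e: "e \<notin> L'"
      have "\<phi> (c + d) \<noteq> e" if "c \<in> Poly_Mapping.keys p" "d \<in> Poly_Mapping.keys q" for c d
      proof -
        have "c + d \<in> L" using that p q closed by auto
        then show ?thesis using img e by blast
      qed
      then show "lk (push \<phi> (mult ?R p q)) e = lk (mult ?R' (push \<phi> p) (push \<phi> q)) e"
        unfolding push0[OF pq e] mult by (intro sum.neutral[symmetric] ballI) auto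
    qed
  next
    show "push \<phi> (one ?R) = one ?R'" by (simp add: push_def zero)
  qed
  have "inj_on (push \<phi>) (carrier ?R)"
  proof (rule inj_onI)
    fix p q assume pq: "p \<in> carrier ?R" "q \<in> carrier ?R" "push \<phi> p = push \<phi> q"
    show "p = q"
    proof (rule poly_mapping_eqI)
      fix c
      show "lk p c = lk q c"
      proof (cases "c \<in> L")
        case True
        then show ?thesis using push pq by metis
      next
        case False
        then have "c \<notin> Poly_Mapping.keys p" "c \<notin> Poly_Mapping.keys q" using pq by auto
        then show ?thesis by (simp add: in_keys_iff)
      qed
    qed
  qed
  moreover have "q \<in> push \<phi> ` carrier ?R" if q: "q \<in> carrier ?R'" for q
  proof -
    let ?\<psi> = "inv_into L \<phi>"
    have bij': "inj_on ?\<psi> L'" "?\<psi> ` L' = L"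
      using bij_betw_inv_into[OF bij] by (auto simp: bij_betw_def)
    have q': "Poly_Mapping.keys q \<subseteq> L'" using q by simp
    have p: "push ?\<psi> q \<in> carrier ?R" using keys_push[OF bij'(1) q'] q' bij'(2) by auto
    have "push \<phi> (push ?\<psi> q) = q"
    proof (rule eqI)
      fix c assume c: "c \<in> L"
      have "lk (push ?\<psi> q) (?\<psi> (\<phi> c)) = lk q (\<phi> c)"
        using lookup_push[OF bij'(1) q', of "\<phi> c"] c img by blast
      then show "lk (push \<phi> (push ?\<psi> q)) (\<phi> c) = lk q (\<phi> c)"
        using push[OF p c] inv_into_f_f[OF inj c] by simp
    next
      fix e assume e: "e \<notin> L'"
      then have "e \<notin> Poly_Mapping.keys q" using q' by blast
      then show "lk (push \<phi> (push ?\<psi> q)) e = lk q e"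
        using push0[OF p e] by (simp add: in_keys_iff)
    qed
    then show ?thesis by (rule image_eqI[OF sym p])
  qed
  moreover have "push \<phi> ` carrier ?R \<subseteq> carrier ?R'" using ring_hom by (auto simp: ring_hom_def)
  ultimately have "bij_betw (push \<phi>) (carrier ?R) (carrier ?R')"
    unfolding bij_betw_def by blast
  with ring_hom have "push \<phi> \<in> ring_iso ?R ?R'" by (simp add: ring_iso_def)
  then show ?thesis by (auto simp: is_ring_iso_def)
qed

text \<open>The converse direction inverts the bijection of exponents, where the assumptions are
  symmetric, and not the map of rings.\<close>

lemma sring_iso_sym:
  fixes \<phi> :: "'a::ab_group_add \<Rightarrow> 'b::ab_group_add"
  assumes bij: "bij_betw \<phi> L L'" and zero: "0 \<in> L" "\<phi> 0 = 0"
    and closed: "\<And>c d. c \<in> L \<Longrightarrow> d \<in> L \<Longrightarrow> c + d \<in> L"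
    and cc: "\<And>c d. c \<in> L \<Longrightarrow> d \<in> L \<Longrightarrow> cc' (\<phi> c) (\<phi> d) \<longleftrightarrow> cc c d"
    and add: "\<And>c d. c \<in> L \<Longrightarrow> d \<in> L \<Longrightarrow> \<phi> (c + d) = \<phi> c + \<phi> d"
  shows "(sring L' cc' :: ('b \<Rightarrow>\<^sub>0 'k::field) ring) \<simeq> (sring L cc :: ('a \<Rightarrow>\<^sub>0 'k) ring)"
proof (rule sring_iso)
  let ?\<psi> = "inv_into L \<phi>"
  have inj: "inj_on \<phi> L" and img: "\<phi> ` L = L'" using bij by (auto simp: bij_betw_def)
  show "bij_betw ?\<psi> L' L" by (rule bij_betw_inv_into[OF bij])
  show "0 \<in> L'" using zero img by force
  show "?\<psi> 0 = 0" using inv_into_f_f[OF inj zero(1)] zero(2) by simp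
  fix c' d' assume "c' \<in> L'" "d' \<in> L'"
  then obtain c d where cd: "c \<in> L" "d \<in> L" "c' = \<phi> c" "d' = \<phi> d" using img by blast
  then have cd': "c + d \<in> L" "c' + d' = \<phi> (c + d)" using closed add by auto
  show "c' + d' \<in> L'" using cd' img by blast
  show "cc (?\<psi> c') (?\<psi> d') \<longleftrightarrow> cc' c' d'" using cd cc inv_into_f_f[OF inj] by simp
  show "?\<psi> (c' + d') = ?\<psi> c' + ?\<psi> d'" using cd cd' inv_into_f_f[OF inj] by simp
qed

lemma is_ring_iso_trans: "R \<simeq> S \<Longrightarrow> S \<simeq> T \<Longrightarrow> R \<simeq> T"
  using ring_iso_set_trans unfolding is_ring_iso_def by blast


section \<open>Topes of an arrangement in a lattice\<close>

lemma card_sym_diff_triangle: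
  assumes "finite A" "finite B" "finite C"
  shows "card (sym_diff A C) \<le> card (sym_diff A B) + card (sym_diff B C)"
proof -
  have "card (sym_diff A C) \<le> card (sym_diff A B \<union> sym_diff B C)"
    using assms by (intro card_mono) auto
  also have "\<dots> \<le> card (sym_diff A B) + card (sym_diff B C)" by (rule card_Un_le)
  finally show ?thesis .
qed

text \<open>\<open>between\<close> makes the distance in the adjacency graph count the separating
  coordinates, and \<open>wall\<close> makes every coordinate visible in that graph. These are the
  properties of an arrangement by which its coordinates can be reconstructed.\<close>

locale tope_set =
  fixes \<T> :: "'i set set" and E :: "'i set"
  assumes fin: "finite E" and sub: "T \<in> \<T> \<Longrightarrow> T \<subseteq> E"
    and between: "T \<in> \<T> \<Longrightarrow> S \<in> \<T> \<Longrightarrow> 2 \<le> card (sym_diff T S) \<Longrightarrow>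
      \<exists>U\<in>\<T>. U \<noteq> T \<and> U \<noteq> S \<and> sym_diff T U \<subseteq> sym_diff T S"
    and wall: "i \<in> E \<Longrightarrow> \<exists>T\<in>\<T>. sym_diff T {i} \<in> \<T>"
begin

lemma fin_tope: "T \<in> \<T> \<Longrightarrow> finite T"
  using fin sub finite_subset by blast

text \<open>A tope between \<open>T\<close> and \<open>S\<close> splits their distance additively,
  so the bound for adjacent pairs propagates by induction.\<close>

lemma dist_le:
  assumes \<Phi>: "\<And>T. T \<in> \<T> \<Longrightarrow> finite (\<Phi> T)"
    and adj: "\<And>T S. T \<in> \<T> \<Longrightarrow> S \<in> \<T> \<Longrightarrow> card (sym_diff T S) = 1 \<Longrightarrow> card (sym_diff (\<Phi> T) (\<Phi> S)) = 1"
    and "T \<in> \<T>" "S \<in> \<T>"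
  shows "card (sym_diff (\<Phi> T) (\<Phi> S)) \<le> card (sym_diff T S)"
  using assms(3,4)
proof (induction "card (sym_diff T S)" arbitrary: T S rule: less_induct)
  case less
  note T = less.prems(1) and S = less.prems(2)
  have finTS: "finite (sym_diff T S)" using fin_tope T S by simp
  consider "card (sym_diff T S) = 0" | "card (sym_diff T S) = 1" | "2 \<le> card (sym_diff T S)"
    by linarith
  then show ?case
  proof cases
    case 1
    then have "T = S" using finTS by auto
    then show ?thesis by simp
  next
    case 2
    then show ?thesis using adj T S by simp
  next
    case 3
    then obtain U where U: "U \<in> \<T>" "U \<noteq> T" "U \<noteq> S" "sym_diff T U \<subseteq> sym_diff T S"
      using between T S by blast
    have US: "sym_diff U S = sym_diff T S - sym_diff T U" using U(4) by blast
    have split: "card (sym_diff T S) = card (sym_diff T U) + card (sym_diff U S)"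
      unfolding US using U(4) finTS by (metis card_Diff_subset card_mono finite_subset
        le_add_diff_inverse)
    have "sym_diff T U \<noteq> {}" "sym_diff U S \<noteq> {}" using U by blast+
    then have pos: "0 < card (sym_diff T U)" "0 < card (sym_diff U S)"
      using fin_tope T S U by (simp_all add: card_gt_0_iff)
    have "card (sym_diff (\<Phi> T) (\<Phi> S)) \<le> card (sym_diff (\<Phi> T) (\<Phi> U)) + card (sym_diff (\<Phi> U) (\<Phi> S))"
      using \<Phi> T S U(1) by (intro card_sym_diff_triangle) auto
    also have "\<dots> \<le> card (sym_diff T U) + card (sym_diff U S)"
      using less.hyps[of T U] less.hyps[of U S] pos split T S U(1) by linarith
    finally show ?thesis using split by simp
  qed
qed

text \<open>Crossing \<open>i\<close> changes the distance to \<open>U\<close> by exactly 1,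
  downwards if \<open>i\<close> separates \<open>U\<close> from \<open>T\<close>.\<close>

lemma mem_sym_diff_iff_dist:
  assumes "U \<in> \<T>" "T \<in> \<T>" "S \<in> \<T>" "sym_diff T S = {i}"
  shows "i \<in> sym_diff U T \<longleftrightarrow> card (sym_diff U S) < card (sym_diff U T)"
proof -
  have *: "x \<in> T \<longleftrightarrow> x \<notin> S" if "x = i" for x using assms(4) that by blast
  have **: "x \<in> T \<longleftrightarrow> x \<in> S" if "x \<noteq> i" for x using assms(4) that by blast
  have fin: "finite (sym_diff U T)" using fin_tope assms by simp
  show ?thesis
  proof (cases "i \<in> sym_diff U T")
    case True
    have "sym_diff U S = sym_diff U T - {i}"
    proof (rule Set.set_eqI)
      fix x show "x \<in> sym_diff U S \<longleftrightarrow> x \<in> sym_diff U T - {i}"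
        using True *[of x] **[of x] by (cases "x = i") auto
    qed
    then show ?thesis using True card_Diff1_less[OF fin True] by simp
  next
    case False
    have "sym_diff U S = insert i (sym_diff U T)"
    proof (rule Set.set_eqI)
      fix x show "x \<in> sym_diff U S \<longleftrightarrow> x \<in> insert i (sym_diff U T)"
        using False *[of x] **[of x] by (cases "x = i") auto
    qed
    then show ?thesis using False card_insert_disjoint[OF fin False] by simp
  qed
qed

end

text \<open>A coordinate \<open>i\<close> is recovered from an adjacent pair \<open>T, S\<close> separated by \<open>i\<close> alone: the topes on
  the side of \<open>S\<close> are those that are closer to \<open>S\<close> than to \<open>T\<close>.\<close>

lemma tope_graph_relabel:
  assumes "tope_set \<T> E" and "tope_set \<T>' E'" and bij: "bij_betw \<Phi> \<T> \<T>'"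
    and adj: "\<And>T S. T \<in> \<T> \<Longrightarrow> S \<in> \<T> \<Longrightarrow> card (sym_diff (\<Phi> T) (\<Phi> S)) = 1 \<longleftrightarrow> card (sym_diff T S) = 1"
  shows "\<exists>\<epsilon>. bij_betw \<epsilon> E E' \<and>
    (\<forall>T\<in>\<T>. \<forall>S\<in>\<T>. \<forall>i\<in>E. \<epsilon> i \<in> sym_diff (\<Phi> T) (\<Phi> S) \<longleftrightarrow> i \<in> sym_diff T S)"
proof -
  interpret A: tope_set \<T> E by fact
  interpret B: tope_set \<T>' E' by fact
  have inj: "inj_on \<Phi> \<T>" and img: "\<Phi> ` \<T> = \<T>'" using bij by (auto simp: bij_betw_def)
  have \<Phi>: "\<Phi> T \<in> \<T>'" if "T \<in> \<T>" for T using that img by blast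
  have dist: "card (sym_diff (\<Phi> T) (\<Phi> S)) = card (sym_diff T S)" if TS: "T \<in> \<T>" "S \<in> \<T>" for T S
  proof (rule antisym)
    show "card (sym_diff (\<Phi> T) (\<Phi> S)) \<le> card (sym_diff T S)"
      by (rule A.dist_le) (use TS adj \<Phi> B.fin_tope in auto)
    \<comment> \<open>The inverse bijection preserves adjacency as well, so distances cannot shrink
      either.\<close>
    let ?\<Psi> = "inv_into \<T> \<Phi>"
    have \<Psi>: "?\<Psi> U \<in> \<T>" "\<Phi> (?\<Psi> U) = U" if "U \<in> \<T>'" for U
      using that img by (auto simp: inv_into_into f_inv_into_f)
    have "card (sym_diff (?\<Psi> (\<Phi> T)) (?\<Psi> (\<Phi> S))) \<le> card (sym_diff (\<Phi> T) (\<Phi> S))"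
    proof (rule B.dist_le)
      show "finite (?\<Psi> U)" if "U \<in> \<T>'" for U using \<Psi>[OF that] A.fin_tope by blast
      show "card (sym_diff (?\<Psi> U) (?\<Psi> V)) = 1" if "U \<in> \<T>'" "V \<in> \<T>'" "card (sym_diff U V) = 1"
        for U V
        using adj[OF \<Psi>(1)[OF that(1)] \<Psi>(1)[OF that(2)]] \<Psi>(2) that by simp
    qed (use \<Phi> TS in auto)
    then show "card (sym_diff T S) \<le> card (sym_diff (\<Phi> T) (\<Phi> S))"
      using inv_into_f_f[OF inj] TS by simp
  qed
  have "\<exists>i'. \<exists>T\<in>\<T>. \<exists>S\<in>\<T>. sym_diff T S = {i} \<and> sym_diff (\<Phi> T) (\<Phi> S) = {i'}" if i: "i \<in> E" for i
  proof -
    obtain T where T: "T \<in> \<T>" "sym_diff T {i} \<in> \<T>" using A.wall[OF i] by blast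
    have eq: "sym_diff T (sym_diff T {i}) = {i}" by blast
    then have "card (sym_diff (\<Phi> T) (\<Phi> (sym_diff T {i}))) = 1" using adj[OF T] by simp
    then obtain i' where "sym_diff (\<Phi> T) (\<Phi> (sym_diff T {i})) = {i'}" by (rule card_1_singletonE)
    then show ?thesis using T eq by blast
  qed
  then obtain \<epsilon> where \<epsilon>: "\<And>i. i \<in> E \<Longrightarrow> \<exists>T\<in>\<T>. \<exists>S\<in>\<T>. sym_diff T S = {i} \<and> sym_diff (\<Phi> T) (\<Phi> S) = {\<epsilon> i}"
    by metis
  have key: "\<epsilon> i \<in> sym_diff (\<Phi> U) (\<Phi> W) \<longleftrightarrow> i \<in> sym_diff U W" if i: "i \<in> E" and UW: "U \<in> \<T>" "W \<in> \<T>"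
    for i U W
  proof -
    obtain T S where T: "T \<in> \<T>" "S \<in> \<T>" "sym_diff T S = {i}" "sym_diff (\<Phi> T) (\<Phi> S) = {\<epsilon> i}"
      using \<epsilon>[OF i] by blast
    have *: "\<epsilon> i \<in> sym_diff (\<Phi> U) (\<Phi> T) \<longleftrightarrow> i \<in> sym_diff U T" if "U \<in> \<T>" for U
      using A.mem_sym_diff_iff_dist[OF that T(1,2,3)]
        B.mem_sym_diff_iff_dist[OF \<Phi>[OF that] \<Phi>[OF T(1)] \<Phi>[OF T(2)] T(4)] dist that T(1,2) by simp
    \<comment> \<open>Separation is additive modulo 2, so it suffices to compare \<open>U\<close>
      and \<open>W\<close> with one end of the pair that defines
      \<open>\<epsilon> i\<close>.\<close>
    have "i \<in> sym_diff U W \<longleftrightarrow> (i \<in> sym_diff U T) \<noteq> (i \<in> sym_diff W T)" by blast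
    also have "\<dots> \<longleftrightarrow> (\<epsilon> i \<in> sym_diff (\<Phi> U) (\<Phi> T)) \<noteq> (\<epsilon> i \<in> sym_diff (\<Phi> W) (\<Phi> T))"
      using *[OF UW(1)] *[OF UW(2)] by simp
    also have "\<dots> \<longleftrightarrow> \<epsilon> i \<in> sym_diff (\<Phi> U) (\<Phi> W)" by blast
    finally show ?thesis by simp
  qed
  have \<epsilon>E: "\<epsilon> i \<in> E'" if "i \<in> E" for i
  proof -
    obtain T S where T: "T \<in> \<T>" "S \<in> \<T>" "sym_diff (\<Phi> T) (\<Phi> S) = {\<epsilon> i}" using \<epsilon>[OF \<open>i \<in> E\<close>] by blast
    then show ?thesis using B.sub[OF \<Phi>[OF T(1)]] B.sub[OF \<Phi>[OF T(2)]] by blast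
  qed
  have "bij_betw \<epsilon> E E'"
    unfolding bij_betw_def
  proof
    show "inj_on \<epsilon> E"
    proof (rule inj_onI)
      fix i j assume ij: "i \<in> E" "j \<in> E" "\<epsilon> i = \<epsilon> j"
      obtain T S where T: "T \<in> \<T>" "S \<in> \<T>" "sym_diff T S = {i}" using \<epsilon>[OF ij(1)] by blast
      then have "j \<in> sym_diff T S" using key[OF ij(1) T(1,2)] key[OF ij(2) T(1,2)] ij(3) by simp
      then show "i = j" unfolding T(3) by simp
    qed
    have "i' \<in> \<epsilon> ` E" if i'E: "i' \<in> E'" for i'
    proof -
      obtain T' where T': "T' \<in> \<T>'" "sym_diff T' {i'} \<in> \<T>'" using B.wall[OF i'E] by blast
      obtain T where T: "T \<in> \<T>" "T' = \<Phi> T" using T'(1) img by blast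
      obtain S where S: "S \<in> \<T>" "sym_diff T' {i'} = \<Phi> S" using T'(2) img by blast
      have eq: "sym_diff (\<Phi> T) (\<Phi> S) = {i'}" unfolding T(2)[symmetric] S(2)[symmetric] by blast
      then have "card (sym_diff T S) = 1" using adj[OF T(1) S(1)] by simp
      then obtain i where i: "sym_diff T S = {i}" by (rule card_1_singletonE)
      then have iE: "i \<in> E" using A.sub[OF T(1)] A.sub[OF S(1)] by blast
      have "\<epsilon> i \<in> sym_diff (\<Phi> T) (\<Phi> S)" using key[OF iE T(1) S(1)] i by blast
      then have "\<epsilon> i = i'" unfolding eq by blast
      then show ?thesis using iE by blast
    qed
    then show "\<epsilon> ` E = E'" using \<epsilon>E by blast
  qed
  then show ?thesis using key by blast
qed

section \<open>Chambers of an integer lattice\<close>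

definition compat :: "'i set \<Rightarrow> ('i \<Rightarrow>\<^sub>0 int) \<Rightarrow> ('i \<Rightarrow>\<^sub>0 int) \<Rightarrow> bool" where
  "compat E c d \<longleftrightarrow> (\<forall>i\<in>E. 0 \<le> lk c i * lk d i)"

text \<open>A chamber is encoded by the set of coordinates that are positive on it.\<close>

definition topes :: "('i \<Rightarrow>\<^sub>0 int) set \<Rightarrow> 'i set \<Rightarrow> 'i set set" where
  "topes L E = {{i \<in> E. 0 < lk z i} | z. z \<in> L \<and> (\<forall>i\<in>E. lk z i \<noteq> 0)}"

definition tope_cone :: "('i \<Rightarrow>\<^sub>0 int) set \<Rightarrow> 'i set \<Rightarrow> 'i set \<Rightarrow> ('i \<Rightarrow>\<^sub>0 int) set" where
  "tope_cone L E T = {c \<in> L. \<forall>i\<in>E. if i \<in> T then 0 \<le> lk c i else lk c i \<le> 0}"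

text \<open>The coordinates define distinct hyperplanes. Given \<open>nonzero\<close>, being
  proportional is the only obstacle to \<open>nonparallel\<close>, which is stated so as to supply
  points of one wall off another.\<close>

locale simple_lattice = int_lattice +
  assumes nonzero: "i \<in> E \<Longrightarrow> \<exists>c\<in>L. lk c i \<noteq> 0"
    and nonparallel: "i \<in> E \<Longrightarrow> j \<in> E \<Longrightarrow> i \<noteq> j \<Longrightarrow> \<exists>c\<in>L. lk c i = 0 \<and> lk c j \<noteq> 0"

text \<open>A large multiple of an element that is generic for the earlier coordinates absorbs the
  addition of one that is nonzero at the new coordinate.\<close>

lemma ex_generic:
  fixes M :: "('i \<Rightarrow>\<^sub>0 int) set"
  assumes "finite F" "0 \<in> M" and cmul: "\<And>k c. c \<in> M \<Longrightarrow> frag_cmul k c \<in> M"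
    and add: "\<And>c d. c \<in> M \<Longrightarrow> d \<in> M \<Longrightarrow> c + d \<in> M"
    and nz: "\<And>i. i \<in> F \<Longrightarrow> \<exists>c\<in>M. lk c i \<noteq> 0"
  shows "\<exists>g\<in>M. \<forall>i\<in>F. lk g i \<noteq> 0"
  using assms(1) nz
proof (induction F rule: finite_induct)
  case empty
  then show ?case using assms(2) by blast
next
  case (insert i F)
  then obtain g where g: "g \<in> M" "\<forall>j\<in>F. lk g j \<noteq> 0" by auto
  show ?case
  proof (cases "lk g i = 0")
    case False
    then show ?thesis using g by blast
  next
    case True
    obtain v where v: "v \<in> M" "lk v i \<noteq> 0" using insert.prems by blast
    define N where "N = 1 + (\<Sum>j\<in>F. \<bar>lk v j\<bar>)"
    have "lk (frag_cmul N g + v) j \<noteq> 0" if j: "j \<in> F" for j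
    proof
      assume "lk (frag_cmul N g + v) j = 0"
      then have eq: "\<bar>lk v j\<bar> = \<bar>N\<bar> * \<bar>lk g j\<bar>"
        by (simp add: lookup_add eq_neg_iff_add_eq_0 flip: abs_mult)
      have "\<bar>lk v j\<bar> \<le> (\<Sum>j\<in>F. \<bar>lk v j\<bar>)"
        using member_le_sum[of j F "\<lambda>j. \<bar>lk v j\<bar>"] insert.hyps j by simp
      then have "\<bar>lk v j\<bar> < \<bar>N\<bar>" by (simp add: N_def)
      moreover have "1 \<le> \<bar>lk g j\<bar>" using g(2) j by fastforce
      then have "\<bar>N\<bar> * 1 \<le> \<bar>N\<bar> * \<bar>lk g j\<bar>" by (intro mult_left_mono) auto
      ultimately show False using eq by linarith
    qed
    moreover have "lk (frag_cmul N g + v) i \<noteq> 0" using True v by (simp add: lookup_add)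
    ultimately show ?thesis using g v cmul add by (intro bexI[of _ "frag_cmul N g + v"]) auto
  qed
qed

context int_lattice
begin

text \<open>The composition of sign vectors: a large multiple of \<open>c\<close> decides wherever
  \<open>c\<close> is nonzero and leaves the other coordinates to \<open>g\<close>. It stands in for
  a point near \<open>c\<close> in the direction of \<open>g\<close>.\<close>

lemma perturb:
  assumes "c \<in> L" "g \<in> L"
  shows "\<exists>w\<in>L. \<forall>i\<in>E. sgn (lk w i) = (if lk c i = 0 then sgn (lk g i) else sgn (lk c i))"
proof -
  define N where "N = 1 + (\<Sum>i\<in>E. \<bar>lk g i\<bar>)"
  have "sgn (lk (frag_cmul N c + g) i) = sgn (lk c i)" if i: "i \<in> E" "lk c i \<noteq> 0" for i
  proof -
    have "\<bar>lk g i\<bar> \<le> (\<Sum>i\<in>E. \<bar>lk g i\<bar>)"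
      using member_le_sum[of i E "\<lambda>i. \<bar>lk g i\<bar>"] finite_E i by simp
    then have lt: "\<bar>lk g i\<bar> < N" by (simp add: N_def)
    show ?thesis
    proof (cases "0 < lk c i")
      case True
      then have "N * 1 \<le> N * lk c i" using lt by (intro mult_left_mono) auto
      then have "0 < lk (frag_cmul N c + g) i" using lt by (simp add: lookup_add)
      then show ?thesis using True by simp
    next
      case False
      then have "N * lk c i \<le> N * (-1)" using lt i by (intro mult_left_mono) auto
      then have "lk (frag_cmul N c + g) i < 0" using lt by (simp add: lookup_add)
      then show ?thesis using False i by simp
    qed
  qed
  then show ?thesis
    using assms cmul_mem add_mem by (intro bexI[of _ "frag_cmul N c + g"]) (auto simp: lookup_add)
qed

lemma topes_sub: "T \<in> topes L E \<Longrightarrow> T \<subseteq> E"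
  by (auto simp: topes_def)

text \<open>This is the chamber entered from \<open>w\<close> by a small move towards
  \<open>T\<close>.\<close>

lemma topes_signs:
  assumes "w \<in> L" "T \<in> topes L E"
  shows "{i \<in> E. 0 < lk w i \<or> lk w i = 0 \<and> i \<in> T} \<in> topes L E"
proof -
  obtain g where g: "g \<in> L" "\<forall>i\<in>E. lk g i \<noteq> 0" "T = {i \<in> E. 0 < lk g i}"
    using assms(2) by (auto simp: topes_def)
  obtain z where z: "z \<in> L" "\<forall>i\<in>E. sgn (lk z i) = (if lk w i = 0 then sgn (lk g i) else sgn (lk w
      i))"
    using perturb[OF assms(1) g(1)] by blast
  have nz: "lk z i \<noteq> 0" if "i \<in> E" for i
    using z(2) g(2) that by (metis sgn_0 sgn_eq_0_iff)
  have "0 < lk z i \<longleftrightarrow> 0 < lk w i \<or> lk w i = 0 \<and> i \<in> T" if i: "i \<in> E" for i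
  proof -
    have "0 < lk z i \<longleftrightarrow> sgn (lk z i) = 1" by (simp add: sgn_if)
    also have "\<dots> \<longleftrightarrow> 0 < lk w i \<or> lk w i = 0 \<and> i \<in> T"
      using z(2) i g(3) by (auto simp: sgn_if split: if_splits)
    finally show ?thesis .
  qed
  then have "{i \<in> E. 0 < lk w i \<or> lk w i = 0 \<and> i \<in> T} = {i \<in> E. 0 < lk z i}" by blast
  then show ?thesis using z(1) nz by (auto simp: topes_def)
qed

lemma topes_compl:
  assumes "T \<in> topes L E"
  shows "E - T \<in> topes L E"
proof -
  obtain g where g: "g \<in> L" "\<And>i. i \<in> E \<Longrightarrow> lk g i \<noteq> 0" "T = {i \<in> E. 0 < lk g i}"
    using assms by (auto simp: topes_def)
  have "i \<in> E - T \<longleftrightarrow> i \<in> E \<and> 0 < lk (- g) i" for i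
    using g(2)[of i] g(3) by auto
  then have "E - T = {i \<in> E. 0 < lk (- g) i}" by blast
  moreover have "\<forall>i\<in>E. lk (- g) i \<noteq> 0" using g(2) by simp
  ultimately show ?thesis using uminus_mem[OF g(1)] unfolding topes_def by blast
qed

lemma cone_sub: "tope_cone L E T \<subseteq> L"
  by (auto simp: tope_cone_def)

lemma zero_cone: "0 \<in> tope_cone L E T"
  by (simp add: tope_cone_def zero_mem)

lemma add_cone: "c \<in> tope_cone L E T \<Longrightarrow> d \<in> tope_cone L E T \<Longrightarrow> c + d \<in> tope_cone L E T"
  by (fastforce simp: tope_cone_def lookup_add add_mem)

lemma cone_signs: "w \<in> L \<Longrightarrow> w \<in> tope_cone L E {i \<in> E. 0 < lk w i \<or> lk w i = 0 \<and> i \<in> T}"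
  by (auto simp: tope_cone_def)

text \<open>Compatible elements do not cancel in their sum, so every chamber around
  \<open>c + d\<close> contains both.\<close>

lemma compat_iff_cone:
  assumes "c \<in> L" "d \<in> L" "T0 \<in> topes L E"
  shows "compat E c d \<longleftrightarrow> (\<exists>T\<in>topes L E. c \<in> tope_cone L E T \<and> d \<in> tope_cone L E T)"
proof
  assume *: "compat E c d"
  let ?T = "{i \<in> E. 0 < lk (c + d) i \<or> lk (c + d) i = 0 \<and> i \<in> T0}"
  have "if i \<in> ?T then 0 \<le> lk c i \<and> 0 \<le> lk d i else lk c i \<le> 0 \<and> lk d i \<le> 0" if i: "i \<in> E" for i
  proof -
    have "(0 \<le> lk c i \<and> 0 \<le> lk d i) \<or> (lk c i \<le> 0 \<and> lk d i \<le> 0)"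
      using * i by (auto simp: compat_def zero_le_mult_iff)
    then show ?thesis using i by (auto simp: lookup_add)
  qed
  then have "c \<in> tope_cone L E ?T" "d \<in> tope_cone L E ?T" using assms(1,2) unfolding tope_cone_def
    by auto
  then show "\<exists>T\<in>topes L E. c \<in> tope_cone L E T \<and> d \<in> tope_cone L E T"
    using topes_signs[OF add_mem[OF assms(1,2)] assms(3)] by blast
next
  assume "\<exists>T\<in>topes L E. c \<in> tope_cone L E T \<and> d \<in> tope_cone L E T"
  then obtain T where T: "c \<in> tope_cone L E T" "d \<in> tope_cone L E T" by blast
  show "compat E c d"
    unfolding compat_def
  proof
    fix i assume "i \<in> E"
    then show "0 \<le> lk c i * lk d i"
      using T by (cases "i \<in> T") (auto simp: tope_cone_def zero_le_mult_iff)
  qed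
qed

text \<open>Without cancellation the sum remembers the signs of both summands. This will confine the
  factors of a monomial in a cone to that cone.\<close>

lemma cone_addD:
  assumes "c \<in> L" "d \<in> L" "compat E c d" "c + d \<in> tope_cone L E T"
  shows "c \<in> tope_cone L E T" "d \<in> tope_cone L E T"
proof -
  have "if i \<in> T then 0 \<le> lk c i \<and> 0 \<le> lk d i else lk c i \<le> 0 \<and> lk d i \<le> 0" if i: "i \<in> E" for i
  proof -
    have "(0 \<le> lk c i \<and> 0 \<le> lk d i) \<or> (lk c i \<le> 0 \<and> lk d i \<le> 0)"
      using assms(3) i by (auto simp: compat_def zero_le_mult_iff)
    moreover have "if i \<in> T then 0 \<le> lk c i + lk d i else lk c i + lk d i \<le> 0"
      using assms(4) i by (auto simp: tope_cone_def lookup_add)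
    ultimately show ?thesis by (auto split: if_splits)
  qed
  then show "c \<in> tope_cone L E T" "d \<in> tope_cone L E T" using assms(1,2) unfolding tope_cone_def
    by auto
qed

lemma tope_interior:
  assumes "T \<in> topes L E"
  shows "\<exists>z\<in>L. z \<in> tope_cone L E T \<and> (\<forall>S\<in>topes L E. z \<in> tope_cone L E S \<longrightarrow> S = T) \<and> (\<forall>i\<in>E.
      lk z i \<noteq> 0) \<and> T = {i\<in>E. 0 < lk z i}"
proof -
  obtain z where z: "z \<in> L" "\<forall>i\<in>E. lk z i \<noteq> 0" "T = {i \<in> E. 0 < lk z i}"
    using assms by (auto simp: topes_def)
  have "S = T" if "S \<in> topes L E" "z \<in> tope_cone L E S" for S
  proof -
    have "S \<subseteq> E" using that topes_sub by blast
    moreover have "i \<in> S \<longleftrightarrow> 0 < lk z i" if "i \<in> E" for i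
      using \<open>z \<in> tope_cone L E S\<close> that z(2) by (fastforce simp: tope_cone_def split: if_splits)
    ultimately show ?thesis using z(3) by blast
  qed
  moreover have "z \<in> tope_cone L E T" using z by (auto simp: tope_cone_def)
  ultimately show ?thesis using z by blast
qed

text \<open>If \<open>c\<close> vanishes at \<open>i\<close>, then moving from \<open>c\<close>
  towards a chamber and towards the opposite chamber reaches two chambers on different sides of
  \<open>i\<close>. Supports are thus expressed by the incidence of elements with chambers.\<close>

lemma support_iff_topes:
  assumes "c \<in> L" "T0 \<in> topes L E" "i \<in> E"
  shows "i \<in> support E c \<longleftrightarrow>
    (\<forall>T\<in>topes L E. \<forall>S\<in>topes L E. c \<in> tope_cone L E T \<longrightarrow> c \<in> tope_cone L E S \<longrightarrow> i \<notin> sym_diff T S)"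
proof
  assume "i \<in> support E c"
  then have "lk c i \<noteq> 0" by (simp add: support_def)
  then have "i \<in> T \<longleftrightarrow> 0 < lk c i" if "c \<in> tope_cone L E T" for T
    using that assms(3) by (fastforce simp: tope_cone_def split: if_splits)
  then show "\<forall>T\<in>topes L E. \<forall>S\<in>topes L E. c \<in> tope_cone L E T \<longrightarrow> c \<in> tope_cone L E S \<longrightarrow>
      i \<notin> sym_diff T S"
    by blast
next
  assume *: "\<forall>T\<in>topes L E. \<forall>S\<in>topes L E. c \<in> tope_cone L E T \<longrightarrow> c \<in> tope_cone L E S \<longrightarrow>
      i \<notin> sym_diff T S"
  show "i \<in> support E c"
  proof (rule ccontr)
    assume "i \<notin> support E c"
    then have c0: "lk c i = 0" using assms(3) by (simp add: support_def)
    note T1 = topes_compl[OF assms(2)]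
    let ?T = "{i \<in> E. 0 < lk c i \<or> lk c i = 0 \<and> i \<in> T0}"
    let ?S = "{i \<in> E. 0 < lk c i \<or> lk c i = 0 \<and> i \<in> E - T0}"
    have "i \<notin> sym_diff ?T ?S"
      by (rule *[rule_format, OF topes_signs[OF assms(1,2)] topes_signs[OF assms(1) T1]
            cone_signs[OF assms(1)] cone_signs[OF assms(1)]])
    then show False using c0 assms(3) by simp
  qed
qed

end

section \<open>Adjacency of chambers\<close>

context simple_lattice
begin

lemma ex_tope: "\<exists>T. T \<in> topes L E"
  using ex_generic[OF finite_E zero_mem cmul_mem add_mem nonzero] by (auto simp: topes_def)

lemma tope_set: "tope_set (topes L E) E"
proof
  show "finite E" by (rule finite_E)
  show "T \<subseteq> E" if "T \<in> topes L E" for T using that topes_sub by blast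
next
  fix i assume i: "i \<in> E"
  \<comment> \<open>A generic point of wall \<open>i\<close>: the two chambers around it differ in
    \<open>i\<close> alone.\<close>
  have "\<exists>g\<in>{c \<in> L. lk c i = 0}. \<forall>j\<in>E - {i}. lk g j \<noteq> 0"
  proof (rule ex_generic)
    show "\<exists>c\<in>{c \<in> L. lk c i = 0}. lk c j \<noteq> 0" if "j \<in> E - {i}" for j
      using nonparallel[OF i, of j] that by blast
  qed (use finite_E zero_mem cmul_mem add_mem in \<open>auto simp: lookup_add\<close>)
  then obtain w where w: "w \<in> L" "lk w i = 0" "\<forall>j\<in>E - {i}. lk w j \<noteq> 0" by blast
  obtain T0 where T0: "T0 \<in> topes L E" using ex_tope by blast
  note T1 = topes_compl[OF T0]
  let ?T = "{i \<in> E. 0 < lk w i \<or> lk w i = 0 \<and> i \<in> T0}"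
  let ?S = "{i \<in> E. 0 < lk w i \<or> lk w i = 0 \<and> i \<in> E - T0}"
  have eq: "?S = sym_diff ?T {i}"
  proof (rule Set.set_eqI)
    fix j show "j \<in> ?S \<longleftrightarrow> j \<in> sym_diff ?T {i}"
      using i w(2,3) by (cases "j = i") auto
  qed
  have "sym_diff ?T {i} \<in> topes L E"
    by (rule back_subst[of "\<lambda>X. X \<in> topes L E", OF topes_signs[OF w(1) T1] eq])
  then show "\<exists>T\<in>topes L E. sym_diff T {i} \<in> topes L E"
    using topes_signs[OF w(1) T0] by blast
next
  fix T S assume T: "T \<in> topes L E" and S: "S \<in> topes L E" and card: "2 \<le> card (sym_diff T S)"
  obtain a where a: "a \<in> L" "\<forall>i\<in>E. lk a i \<noteq> 0" "T = {i \<in> E. 0 < lk a i}"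
    using T by (auto simp: topes_def)
  obtain b where b: "b \<in> L" "\<forall>i\<in>E. lk b i \<noteq> 0" "S = {i \<in> E. 0 < lk b i}"
    using S by (auto simp: topes_def)
  have "\<not> is_singleton (sym_diff T S)" "sym_diff T S \<noteq> {}"
    using card by (auto simp: is_singleton_altdef simp del: Un_empty)
  then obtain i j where ij: "i \<in> sym_diff T S" "j \<in> sym_diff T S" "i \<noteq> j"
    unfolding is_singleton_def by blast
  have E: "i \<in> E" "j \<in> E" using ij a(3) b(3) by auto
  \<comment> \<open>The segment between the two chambers must cross the walls \<open>i\<close> and
    \<open>j\<close> at different points, so that a chamber strictly between is met. To this end
    \<open>a\<close> is moved inside its chamber until the ratios of entries at \<open>i\<close> and
    at \<open>j\<close> differ.\<close>
  have "\<exists>a'\<in>L. (\<forall>k\<in>E. sgn (lk a' k) = sgn (lk a k)) \<and> \<bar>lk b i\<bar> * \<bar>lk a' j\<bar> \<noteq> \<bar>lk a' i\<bar> * \<bar>lk b j\<bar>"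
  proof (cases "\<bar>lk b i\<bar> * \<bar>lk a j\<bar> = \<bar>lk a i\<bar> * \<bar>lk b j\<bar>")
    case False
    then show ?thesis using a by blast
  next
    case True
    obtain y where y: "y \<in> L" "lk y i = 0" "lk y j \<noteq> 0" using nonparallel[OF E ij(3)] by blast
    \<comment> \<open>\<open>N\<close> exceeds all entries of \<open>y\<close>, so the signs of
      \<open>a\<close> persist; as \<open>y\<close> vanishes at \<open>i\<close> but not at
      \<open>j\<close>, only one side of the equality is disturbed.\<close>
    define N where "N = 1 + (\<Sum>k\<in>E. \<bar>lk y k\<bar>)"
    define a' where "a' = frag_cmul N a + y"
    have big: "\<bar>lk y k\<bar> < N" if "k \<in> E" for k
      using member_le_sum[of k E "\<lambda>k. \<bar>lk y k\<bar>"] finite_E that by (simp add: N_def)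
    have sgn: "sgn (lk a' k) = sgn (lk a k)" if k: "k \<in> E" for k
    proof (cases "0 < lk a k")
      case True
      then have "N * 1 \<le> N * lk a k" using big[OF k] by (intro mult_left_mono) auto
      then have "0 < lk a' k" using big[OF k] by (simp add: a'_def lookup_add)
      then show ?thesis using True by simp
    next
      case False
      then have neg: "lk a k < 0" using a(2) k by force
      then have "N * lk a k \<le> N * (-1)" using big[OF k] by (intro mult_left_mono) auto
      then have "lk a' k < 0" using big[OF k] by (simp add: a'_def lookup_add)
      then show ?thesis using neg by simp
    qed
    have N: "0 < N" using big[OF E(1)] by linarith
    have "\<bar>lk a' j\<bar> \<noteq> N * \<bar>lk a j\<bar>"
    proof (cases "0 < lk a j")
      case True
      then have "0 < lk a' j" using sgn[OF E(2)] by (simp add: sgn_1_pos)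
      then show ?thesis using True y(3) by (simp add: a'_def lookup_add)
    next
      case False
      then have neg: "lk a j < 0" using a(2) E by force
      then have "lk a' j < 0" using sgn[OF E(2)] by (simp add: sgn_1_neg)
      then show ?thesis using neg y(3) by (simp add: a'_def lookup_add)
    qed
    moreover have "0 < \<bar>lk b i\<bar>" using b(2) E by simp
    ultimately have "\<bar>lk b i\<bar> * \<bar>lk a' j\<bar> \<noteq> \<bar>lk b i\<bar> * (N * \<bar>lk a j\<bar>)" by simp
    also have "\<bar>lk b i\<bar> * (N * \<bar>lk a j\<bar>) = N * (\<bar>lk a i\<bar> * \<bar>lk b j\<bar>)" using True by simp
    also have "\<dots> = \<bar>lk a' i\<bar> * \<bar>lk b j\<bar>" using y(2) N by (simp add: a'_def lookup_add abs_mult)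
    finally have "\<bar>lk b i\<bar> * \<bar>lk a' j\<bar> \<noteq> \<bar>lk a' i\<bar> * \<bar>lk b j\<bar>" .
    moreover have "a' \<in> L" using a(1) y(1) cmul_mem add_mem by (simp add: a'_def)
    ultimately show ?thesis using sgn by blast
  qed
  then obtain a' where a': "a' \<in> L" "\<And>k. k \<in> E \<Longrightarrow> sgn (lk a' k) = sgn (lk a k)"
    and ne: "\<bar>lk b i\<bar> * \<bar>lk a' j\<bar> \<noteq> \<bar>lk a' i\<bar> * \<bar>lk b j\<bar>" by blast
  have a'nz: "lk a' k \<noteq> 0" if "k \<in> E" for k using a'(2)[OF that] a(2) that by (metis sgn_eq_0_iff)
  have T': "T = {i \<in> E. 0 < lk a' i}"
    unfolding a(3) using a'(2) by (metis (no_types, lifting) sgn_greater)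
  \<comment> \<open>Up to a positive factor, the point where the segment from \<open>a'\<close> to
    \<open>b\<close> crosses wall \<open>i\<close>.\<close>
  define w where "w = frag_cmul \<bar>lk b i\<bar> a' + frag_cmul \<bar>lk a' i\<bar> b"
  have w: "w \<in> L" using a' b cmul_mem add_mem by (simp add: w_def)
  have lkw: "lk w k = \<bar>lk b i\<bar> * lk a' k + \<bar>lk a' i\<bar> * lk b k" for k
    by (simp add: w_def lookup_add)
  have pos: "0 < \<bar>lk b i\<bar>" "0 < \<bar>lk a' i\<bar>" using b(2) a'nz E by auto
  have opp: "k \<in> T \<longleftrightarrow> k \<notin> S" if "k \<in> {i, j}" for k using that ij by blast
  have wi: "lk w i = 0"
  proof (cases "0 < lk b i")
    case True
    then have "lk a' i < 0" using opp[of i] b(3) T' E a'nz[OF E(1)] by force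
    then show ?thesis using True by (simp add: lkw)
  next
    case False
    then have "0 < lk a' i" "lk b i < 0" using opp[of i] b(2,3) T' E by force+
    then show ?thesis by (simp add: lkw)
  qed
  have wj: "lk w j \<noteq> 0"
  proof (cases "0 < lk b j")
    case True
    then have "lk a' j < 0" using opp[of j] b(3) T' E a'nz[OF E(2)] by force
    then show ?thesis using True ne by (simp add: lkw)
  next
    case False
    then have "0 < lk a' j" "lk b j < 0" using opp[of j] b(2,3) T' E by force+
    then show ?thesis using ne by (simp add: lkw)
  qed
  have same: "(k \<in> T \<longrightarrow> 0 < lk w k) \<and> (k \<notin> T \<longrightarrow> lk w k < 0)" if k: "k \<in> E" "k \<notin> sym_diff T S" for k
  proof (cases "k \<in> T")
    case True
    then have "0 < lk a' k" "0 < lk b k" using k T' b(3) by auto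
    then show ?thesis using pos True by (simp add: lkw add_pos_pos)
  next
    case False
    then have "lk a' k < 0" "lk b k < 0" using k T' b(2,3) a'nz[OF k(1)] by force+
    then show ?thesis using pos False by (simp add: lkw add_neg_neg mult_pos_neg)
  qed
  \<comment> \<open>\<open>X\<close> is the end from which \<open>j\<close> is crossed before
    \<open>i\<close>. Just before reaching \<open>w\<close> from there, \<open>j\<close> has been
    crossed and \<open>i\<close> has not, so the chamber differs from both ends.\<close>
  have *: "\<exists>U\<in>topes L E. U \<noteq> T \<and> U \<noteq> S \<and> sym_diff T U \<subseteq> sym_diff T S"
    if X: "X \<in> topes L E" "i \<in> X \<longleftrightarrow> i \<notin> Y" "{X, Y} = {S, T}" "j \<in> Y \<longleftrightarrow> 0 < lk w j" for X Y
  proof -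
    let ?U = "{k \<in> E. 0 < lk w k \<or> lk w k = 0 \<and> k \<in> X}"
    have "i \<in> ?U \<longleftrightarrow> i \<in> X" "j \<in> ?U \<longleftrightarrow> j \<in> Y" using wi wj E X(4) by auto
    moreover have "j \<in> X \<longleftrightarrow> j \<notin> Y" using opp[of j] X(3) by (auto simp: doubleton_eq_iff)
    ultimately have "?U \<noteq> X" "?U \<noteq> Y" using X(2) by blast+
    then have "?U \<noteq> T" "?U \<noteq> S" using X(3) by (auto simp: doubleton_eq_iff)
    moreover have "sym_diff T ?U \<subseteq> sym_diff T S"
      using same topes_sub[OF T] by fastforce
    ultimately show ?thesis by (intro bexI[of _ ?U] conjI topes_signs[OF w X(1)])
  qed
  show "\<exists>U\<in>topes L E. U \<noteq> T \<and> U \<noteq> S \<and> sym_diff T U \<subseteq> sym_diff T S"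
  proof (cases "j \<in> T \<longleftrightarrow> 0 < lk w j")
    case True
    then show ?thesis using *[of S T] S opp[of i] by blast
  next
    case False
    then have "j \<in> S \<longleftrightarrow> 0 < lk w j" using opp[of j] by blast
    then show ?thesis using *[of T S] T opp[of i] by blast
  qed
qed

text \<open>A facet lies in no third chamber, whereas a chamber between two that are not adjacent
  contains their intersection. The right-hand side speaks only of inclusions between cones, which
  the ring can express.\<close>

lemma adjacent_iff:
  assumes "T \<in> topes L E" "S \<in> topes L E"
  shows "card (sym_diff T S) = 1 \<longleftrightarrow>
    T \<noteq> S \<and> (\<forall>U\<in>topes L E. tope_cone L E T \<inter> tope_cone L E S \<subseteq> tope_cone L E U \<longrightarrow> U \<in> {T, S})"
proof
  assume "card (sym_diff T S) = 1"
  then obtain i where i: "sym_diff T S = {i}" by (rule card_1_singletonE)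
  obtain a where a: "a \<in> L" "\<forall>i\<in>E. lk a i \<noteq> 0" "T = {i \<in> E. 0 < lk a i}"
    using assms(1) by (auto simp: topes_def)
  obtain b where b: "b \<in> L" "\<forall>i\<in>E. lk b i \<noteq> 0" "S = {i \<in> E. 0 < lk b i}"
    using assms(2) by (auto simp: topes_def)
  have iE: "i \<in> E" using i a(3) b(3) by blast
  \<comment> \<open>Up to scaling, the point of the segment from \<open>a\<close> to
    \<open>b\<close> on the only wall between them; all other coordinates keep their common sign
    there.\<close>
  define w where "w = frag_cmul \<bar>lk b i\<bar> a + frag_cmul \<bar>lk a i\<bar> b"
  have w: "w \<in> L" using a b cmul_mem add_mem by (simp add: w_def)
  have lkw: "lk w k = \<bar>lk b i\<bar> * lk a k + \<bar>lk a i\<bar> * lk b k" for k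
    by (simp add: w_def lookup_add)
  have pos: "0 < \<bar>lk b i\<bar>" "0 < \<bar>lk a i\<bar>" using b(2) a(2) iE by auto
  have opp: "i \<in> T \<longleftrightarrow> i \<notin> S" using i by blast
  have wi: "lk w i = 0"
  proof (cases "0 < lk b i")
    case True
    then have "lk a i < 0" using opp a(2,3) b(3) iE by force
    then show ?thesis using True by (simp add: lkw)
  next
    case False
    then have "0 < lk a i" "lk b i < 0" using opp a(3) b(2,3) iE by force+
    then show ?thesis by (simp add: lkw)
  qed
  have same: "(k \<in> T \<longrightarrow> k \<in> S \<and> 0 < lk w k) \<and> (k \<notin> T \<longrightarrow> k \<notin> S \<and> lk w k < 0)" if k: "k \<in> E" "k \<noteq> i"
    for k
  proof (cases "k \<in> T")
    case True
    then have "k \<in> S" using k i by blast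
    then have "0 < lk a k" "0 < lk b k" using True a(3) b(3) by auto
    then show ?thesis using pos True \<open>k \<in> S\<close> by (simp add: lkw add_pos_pos)
  next
    case False
    then have "k \<notin> S" using k i by blast
    then have "lk a k < 0" "lk b k < 0" using k False a(2,3) b(2,3) by force+
    then show ?thesis using pos False \<open>k \<notin> S\<close> by (simp add: lkw add_neg_neg mult_pos_neg)
  qed
  have wT: "w \<in> tope_cone L E T"
    unfolding tope_cone_def using w same wi by (smt (verit) mem_Collect_eq)
  have wS: "w \<in> tope_cone L E S"
    unfolding tope_cone_def using w same wi by (smt (verit) mem_Collect_eq)
  have "U \<in> {T, S}" if U: "U \<in> topes L E" "tope_cone L E T \<inter> tope_cone L E S \<subseteq> tope_cone L E U"
    for U
  proof -
    have "w \<in> tope_cone L E U" using U wT wS by blast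
    then have "k \<in> U \<longleftrightarrow> k \<in> T" if "k \<in> E" "k \<noteq> i" for k
      using same[OF that] that by (fastforce simp: tope_cone_def split: if_splits)
    then have k: "k \<in> U \<longleftrightarrow> k \<in> T" if "k \<noteq> i" for k
      using topes_sub[OF U(1)] topes_sub[OF assms(1)] that by blast
    have kS: "k \<in> S \<longleftrightarrow> k \<in> T" if "k \<noteq> i" for k using i that by blast
    show ?thesis
    proof (cases "i \<in> U \<longleftrightarrow> i \<in> T")
      case True
      then have "U = T" using k by (intro Set.set_eqI) metis
      then show ?thesis by simp
    next
      case False
      then have "U = S" using k kS opp by (intro Set.set_eqI) metis
      then show ?thesis by simp
    qed
  qed
  moreover have "T \<noteq> S" using i by blast
  ultimately show "T \<noteq> S \<and> (\<forall>U\<in>topes L E. tope_cone L E T \<inter> tope_cone L E S \<subseteq> tope_cone L E U \<longrightarrow>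
      U \<in> {T, S})"
    by blast
next
  assume *: "T \<noteq> S \<and> (\<forall>U\<in>topes L E. tope_cone L E T \<inter> tope_cone L E S \<subseteq> tope_cone L E U \<longrightarrow> U \<in> {T,
      S})"
  have "finite (sym_diff T S)" using assms topes_sub finite_E by (metis finite_Diff finite_Un
    finite_subset)
  moreover have "sym_diff T S \<noteq> {}" using * by blast
  ultimately have "0 < card (sym_diff T S)" by (simp only: card_gt_0_iff) simp
  moreover have "\<not> 2 \<le> card (sym_diff T S)"
  proof
    assume "2 \<le> card (sym_diff T S)"
    then obtain U where U: "U \<in> topes L E" "U \<noteq> T" "U \<noteq> S" "sym_diff T U \<subseteq> sym_diff T S"
      using tope_set.between[OF tope_set assms] by blast
    have "tope_cone L E T \<inter> tope_cone L E S \<subseteq> tope_cone L E U"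
    proof
      fix c assume c: "c \<in> tope_cone L E T \<inter> tope_cone L E S"
      have "if k \<in> U then 0 \<le> lk c k else lk c k \<le> 0" if k: "k \<in> E" for k
      proof -
        have "if k \<in> T then 0 \<le> lk c k else lk c k \<le> 0" "if k \<in> S then 0 \<le> lk c k else lk c k \<le> 0"
          using c k by (auto simp: tope_cone_def)
        moreover have "(k \<in> U \<longleftrightarrow> k \<in> T) \<or> (k \<in> U \<longleftrightarrow> k \<in> S)" using U(4) by blast
        ultimately show ?thesis by metis
      qed
      then show "c \<in> tope_cone L E U" using c by (auto simp: tope_cone_def)
    qed
    then show False using * U by blast
  qed
  ultimately show "card (sym_diff T S) = 1" by linarith
qed

end


section \<open>Recovering the minimal supports from the ring\<close>

definition ann :: "('a, 'm) ring_scheme \<Rightarrow> 'a \<Rightarrow> 'a set" where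
  "ann R f = {g \<in> carrier R. mult R f g = zero R}"

text \<open>In a reduced Noetherian ring these are the minimal primes; this form refers to zero
  products only.\<close>

definition max_anns :: "('a, 'm) ring_scheme \<Rightarrow> 'a set set" where
  "max_anns R = {A \<in> ann R ` (carrier R - {zero R}). \<forall>B\<in>ann R ` (carrier R - {zero R}). A \<subseteq> B \<longrightarrow>
      A = B}"

text \<open>The sum of the members of \<open>\<J>\<close> is replaced by all additively closed sets
  that contain them, which are easily carried along a bijection respecting addition.\<close>

definition sum_contains :: "('a, 'm) ring_scheme \<Rightarrow> 'a set set \<Rightarrow> 'a set \<Rightarrow> bool" where
  "sum_contains R \<J> I \<longleftrightarrow> (\<forall>X\<subseteq>carrier R. zero R \<in> X \<longrightarrow> (\<forall>x\<in>X. \<forall>y\<in>X. add R x y \<in> X) \<longrightarrow>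
     (\<forall>J\<in>\<J>. J \<subseteq> X) \<longrightarrow> I \<subseteq> X)"

lemma max_anns_iso:
  assumes h: "bij_betw h (carrier R) (carrier R')" and zero: "h (zero R) = zero R'"
    "zero R \<in> carrier R"
    and closed: "\<And>f g. f \<in> carrier R \<Longrightarrow> g \<in> carrier R \<Longrightarrow> mult R f g \<in> carrier R"
    and mult: "\<And>f g. f \<in> carrier R \<Longrightarrow> g \<in> carrier R \<Longrightarrow> h (mult R f g) = mult R' (h f) (h g)"
  shows "max_anns R' = (`) h ` max_anns R"
proof -
  have inj: "inj_on h (carrier R)" and img: "h ` carrier R = carrier R'" using h
    by (auto simp: bij_betw_def)
  have iff: "mult R' (h f) (h g) = zero R' \<longleftrightarrow> mult R f g = zero R"
    if "f \<in> carrier R" "g \<in> carrier R" for f g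
    using mult[OF that] inj_on_eq_iff[OF inj closed[OF that] zero(2)] zero(1) by simp
  have ann: "ann R' (h f) = h ` ann R f" if f: "f \<in> carrier R" for f
    unfolding ann_def img[symmetric] using iff[OF f] by blast
  have nz: "carrier R' - {zero R'} = h ` (carrier R - {zero R})"
    using inj_on_image_set_diff[OF inj, of "carrier R" "{zero R}"] img zero by simp
  have anns: "ann R' ` (carrier R' - {zero R'}) = (`) h ` ann R ` (carrier R - {zero R})"
    unfolding nz image_image using ann by (intro image_cong) auto
  have sub: "A \<subseteq> carrier R" if "A \<in> ann R ` (carrier R - {zero R})" for A
    using that by (auto simp: ann_def)
  have le: "h ` A \<subseteq> h ` B \<longleftrightarrow> A \<subseteq> B"
    if "A \<in> ann R ` (carrier R - {zero R})" "B \<in> ann R ` (carrier R - {zero R})" for A B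
    using inj_on_image_subset_iff[OF inj sub[OF that(1)] sub[OF that(2)]] .
  have eq: "h ` A = h ` B \<longleftrightarrow> A = B"
    if "A \<in> ann R ` (carrier R - {zero R})" "B \<in> ann R ` (carrier R - {zero R})" for A B
    using inj_on_image_eq_iff[OF inj sub[OF that(1)] sub[OF that(2)]] .
  show ?thesis
  proof (rule Set.set_eqI)
    fix A'
    show "A' \<in> max_anns R' \<longleftrightarrow> A' \<in> (`) h ` max_anns R"
    proof
      assume "A' \<in> max_anns R'"
      then have A': "A' \<in> (`) h ` ann R ` (carrier R - {zero R})"
        "\<forall>B\<in>(`) h ` ann R ` (carrier R - {zero R}). A' \<subseteq> B \<longrightarrow> A' = B"
        unfolding max_anns_def anns by simp_all
      from A'(1) obtain A where A: "A' = h ` A" "A \<in> ann R ` (carrier R - {zero R})"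
        by (rule imageE)
      have "A \<in> max_anns R"
        unfolding max_anns_def
      proof (rule CollectI, intro conjI ballI impI)
        fix B assume B: "B \<in> ann R ` (carrier R - {zero R})" "A \<subseteq> B"
        then have "A' \<subseteq> h ` B" using A by blast
        then have "A' = h ` B" using A'(2) imageI[OF B(1), of "(`) h"] by blast
        then show "A = B" using eq[OF A(2) B(1)] A(1) by simp
      qed (rule A(2))
      then show "A' \<in> (`) h ` max_anns R" using A(1) by blast
    next
      assume "A' \<in> (`) h ` max_anns R"
      then obtain A where A: "A' = h ` A" "A \<in> max_anns R" by (rule imageE)
      from A(2) have A2: "A \<in> ann R ` (carrier R - {zero R})"
        "\<And>B. B \<in> ann R ` (carrier R - {zero R}) \<Longrightarrow> A \<subseteq> B \<Longrightarrow> A = B"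
        unfolding max_anns_def mem_Collect_eq by blast+
      show "A' \<in> max_anns R'"
        unfolding max_anns_def anns
      proof (rule CollectI, intro conjI ballI impI)
        show "A' \<in> (`) h ` ann R ` (carrier R - {zero R})" unfolding A(1) by (rule imageI[OF A2(1)])
        fix B' assume B': "B' \<in> (`) h ` ann R ` (carrier R - {zero R})" "A' \<subseteq> B'"
        from B'(1) obtain B where B: "B' = h ` B" "B \<in> ann R ` (carrier R - {zero R})"
          by (rule imageE)
        then show "A' = B'" using le[OF A2(1) B(2)] A2(2)[OF B(2)] B'(2) A(1) by simp
      qed
    qed
  qed
qed

lemma sum_contains_iso:
  assumes h: "bij_betw h (carrier R) (carrier R')" and zero: "h (zero R) = zero R'"
    "zero R \<in> carrier R"
    and closed: "\<And>f g. f \<in> carrier R \<Longrightarrow> g \<in> carrier R \<Longrightarrow> add R f g \<in> carrier R"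
    and add: "\<And>f g. f \<in> carrier R \<Longrightarrow> g \<in> carrier R \<Longrightarrow> h (add R f g) = add R' (h f) (h g)"
    and sub: "\<And>J. J \<in> \<J> \<Longrightarrow> J \<subseteq> carrier R" "I \<subseteq> carrier R"
  shows "sum_contains R' ((`) h ` \<J>) (h ` I) \<longleftrightarrow> sum_contains R \<J> I"
proof -
  have inj: "inj_on h (carrier R)" and img: "h ` carrier R = carrier R'" using h
    by (auto simp: bij_betw_def)
  show ?thesis
  proof
    assume *: "sum_contains R' ((`) h ` \<J>) (h ` I)"
    show "sum_contains R \<J> I"
      unfolding sum_contains_def
    proof (intro allI impI)
      fix X assume X: "X \<subseteq> carrier R" "zero R \<in> X" "\<forall>x\<in>X. \<forall>y\<in>X. add R x y \<in> X" "\<forall>J\<in>\<J>. J \<subseteq> X"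
      have "h ` I \<subseteq> h ` X"
      proof (rule *[unfolded sum_contains_def, rule_format])
        show "h ` X \<subseteq> carrier R'" using X(1) img by blast
        show "zero R' \<in> h ` X" using X(2) zero(1) by force
        show "add R' x y \<in> h ` X" if xy: "x \<in> h ` X" "y \<in> h ` X" for x y
        proof -
          obtain x0 y0 where x0: "x0 \<in> X" "x = h x0" "y0 \<in> X" "y = h y0" using xy by blast
          then have "add R' x y = h (add R x0 y0)" using add[OF subsetD[OF X(1)] subsetD[OF X(1)]]
            by simp
          then show ?thesis using X(3) x0 by blast
        qed
        show "J \<subseteq> h ` X" if "J \<in> (`) h ` \<J>" for J
          using that X(4) by blast
      qed
      then show "I \<subseteq> X" using inj_on_image_subset_iff[OF inj sub(2) X(1)] by blast
    qed
  next
    assume *: "sum_contains R \<J> I"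
    show "sum_contains R' ((`) h ` \<J>) (h ` I)"
      unfolding sum_contains_def
    proof (intro allI impI)
      fix X assume X: "X \<subseteq> carrier R'" "zero R' \<in> X" "\<forall>x\<in>X. \<forall>y\<in>X. add R' x y \<in> X" "\<forall>J\<in>(`) h ` \<J>.
          J \<subseteq> X"
      have "I \<subseteq> {x \<in> carrier R. h x \<in> X}"
      proof (rule *[unfolded sum_contains_def, rule_format])
        show "{x \<in> carrier R. h x \<in> X} \<subseteq> carrier R" by blast
        show "zero R \<in> {x \<in> carrier R. h x \<in> X}" using X(2) zero by simp
        show "add R x y \<in> {x \<in> carrier R. h x \<in> X}"
          if "x \<in> {x \<in> carrier R. h x \<in> X}" "y \<in> {x \<in> carrier R. h x \<in> X}" for x y
          using that closed[of x y] add[of x y] X(3) by simp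
        show "J \<subseteq> {x \<in> carrier R. h x \<in> X}" if "J \<in> \<J>" for J
        proof -
          have "h ` J \<subseteq> X" using X(4) imageI[OF that, of "(`) h"] by blast
          then show ?thesis using sub(1)[OF that] by blast
        qed
      qed
      then show "h ` I \<subseteq> X" by blast
    qed
  qed
qed

text \<open>The kernel of the projection onto the semigroup ring of the cone, which forgets all
  monomials outside it.\<close>

definition cone_ideal :: "('i \<Rightarrow>\<^sub>0 int) set \<Rightarrow> 'i set \<Rightarrow> 'i set \<Rightarrow> (('i \<Rightarrow>\<^sub>0 int) \<Rightarrow>\<^sub>0 'k::zero) set"
  where
  "cone_ideal L E T = {p. Poly_Mapping.keys p \<subseteq> L \<and> Poly_Mapping.keys p \<inter> tope_cone L E T = {}}"

text \<open>Uniqueness of products: a pair maximising the Euclidean length of \<open>c + d\<close> is determined by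
  its sum, by the parallelogram law.\<close>

lemma (in int_lattice) max_pair_unique:
  fixes N :: "('i \<Rightarrow>\<^sub>0 int) \<Rightarrow> int"
  defines "N \<equiv> \<lambda>c. \<Sum>i\<in>E. lk c i * lk c i"
  assumes L: "c \<in> L" "c' \<in> L" "c' + d' = c + d"
    and max: "N (c + d') \<le> N (c + d)" "N (c' + d) \<le> N (c + d)"
  shows "c' = c"
proof -
  have eq: "lk c' i + lk d' i = lk c i + lk d i" for i
    using arg_cong[OF L(3), of "\<lambda>x. lk x i"] by (simp add: lookup_add)
  have "(\<Sum>i\<in>E. (lk (c + d') i - lk (c' + d) i) * (lk (c + d') i - lk (c' + d) i)) =
      2 * N (c + d') + 2 * N (c' + d) - 4 * N (c + d)"
    unfolding N_def sum_distrib_left sum.distrib[symmetric] sum_subtractf[symmetric]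
  proof (rule sum.cong)
    fix i
    have d': "lk d' i = lk c i + lk d i - lk c' i" using eq[of i] by linarith
    show "(lk (c + d') i - lk (c' + d) i) * (lk (c + d') i - lk (c' + d) i) =
      2 * (lk (c + d') i * lk (c + d') i) + 2 * (lk (c' + d) i * lk (c' + d) i) -
      4 * (lk (c + d) i * lk (c + d) i)"
      unfolding lookup_add d' by (simp add: algebra_simps)
  qed simp
  also have "\<dots> \<le> 0" using max by linarith
  finally have "(\<Sum>i\<in>E. (lk (c + d') i - lk (c' + d) i) * (lk (c + d') i - lk (c' + d) i)) = 0"
    by (simp add: antisym sum_nonneg)
  then have "\<forall>i\<in>E. (lk (c + d') i - lk (c' + d) i) * (lk (c + d') i - lk (c' + d) i) = 0"
    by (subst (asm) sum_nonneg_eq_0_iff) (use finite_E in auto)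
  then have "lk c i + lk d' i = lk c' i + lk d i" if "i \<in> E" for i
    using that by (simp add: lookup_add)
  then have "lk c' i = lk c i" if "i \<in> E" for i using eq[of i] that by fastforce
  then show ?thesis using eqI L by blast
qed

section \<open>Zero products, annihilators and sums of cone ideals\<close>

context simple_lattice
begin

text \<open>The cone ideals are prime and intersect in zero. For primeness, take exponents of
  \<open>p\<close> and \<open>q\<close> in the cone with longest sum: no other pair of exponents
  contributes to that monomial, so its coefficient in the product is not zero.\<close>

lemma sring_mult_eq_0_iff:
  fixes p q :: "('a \<Rightarrow>\<^sub>0 int) \<Rightarrow>\<^sub>0 'k::field"
  assumes cc: "\<And>c d. c \<in> L \<Longrightarrow> d \<in> L \<Longrightarrow> cc c d \<longleftrightarrow> compat E c d"
    and p: "Poly_Mapping.keys p \<subseteq> L" and q: "Poly_Mapping.keys q \<subseteq> L"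
  shows "mult (sring L cc) p q = 0 \<longleftrightarrow> (\<forall>T\<in>topes L E. p \<in> cone_ideal L E T \<or> q \<in> cone_ideal L E T)"
proof
  assume *: "\<forall>T\<in>topes L E. p \<in> cone_ideal L E T \<or> q \<in> cone_ideal L E T"
  obtain T0 where T0: "T0 \<in> topes L E" using ex_tope by blast
  show "mult (sring L cc) p q = 0"
  proof (rule poly_mapping_eqI)
    fix e
    have "\<not> cc c d" if cd: "c \<in> Poly_Mapping.keys p" "d \<in> Poly_Mapping.keys q" for c d
    proof
      assume "cc c d"
      moreover have "c \<in> L" "d \<in> L" using cd p q by auto
      ultimately obtain T where "T \<in> topes L E" "c \<in> tope_cone L E T" "d \<in> tope_cone L E T"
        using cc compat_iff_cone[OF _ _ T0] by blast
      then show False using * cd by (fastforce simp: cone_ideal_def)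
    qed
    then show "lk (mult (sring L cc) p q) e = lk 0 e"
      unfolding lookup_sring_mult by (simp add: sum.neutral)
  qed
next
  assume zero: "mult (sring L cc) p q = 0"
  show "\<forall>T\<in>topes L E. p \<in> cone_ideal L E T \<or> q \<in> cone_ideal L E T"
  proof (rule ccontr)
    assume "\<not> ?thesis"
    then obtain T where T: "T \<in> topes L E" "p \<notin> cone_ideal L E T" "q \<notin> cone_ideal L E T" by blast
    define A where "A = (Poly_Mapping.keys p \<inter> tope_cone L E T) \<times> (Poly_Mapping.keys q \<inter> tope_cone
        L E T)"
    have fin: "finite A" by (simp add: A_def)
    have ne: "A \<noteq> {}" using T p q by (auto simp: A_def cone_ideal_def)
    define N where "N = (\<lambda>c :: _ \<Rightarrow>\<^sub>0 int. \<Sum>i\<in>E. lk c i * lk c i)"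
    have "Max ((\<lambda>(c, d). N (c + d)) ` A) \<in> (\<lambda>(c, d). N (c + d)) ` A"
      using fin ne by (intro Max_in) auto
    then obtain c d where cd: "(c, d) \<in> A" "Max ((\<lambda>(c, d). N (c + d)) ` A) = N (c + d)" by auto
    have max: "N (c' + d') \<le> N (c + d)" if "(c', d') \<in> A" for c' d'
      unfolding cd(2)[symmetric] using fin that by (intro Max_ge) auto
    have c: "c \<in> Poly_Mapping.keys p" "c \<in> tope_cone L E T" and d: "d \<in> Poly_Mapping.keys q"
      "d \<in> tope_cone L E T"
      using cd(1) by (auto simp: A_def)
    have cL: "c \<in> L" and dL: "d \<in> L" using c d cone_sub by blast+
    \<comment> \<open>A compatible pair with this sum lies in the same cone by
      \<open>cone_addD\<close>, so its mixed sums with \<open>c\<close> and \<open>d\<close> compete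
      in the maximum too.\<close>
    have uniq: "cc c' d' \<and> c' + d' = c + d \<longleftrightarrow> c' = c \<and> d' = d"
      if c': "c' \<in> Poly_Mapping.keys p" and d': "d' \<in> Poly_Mapping.keys q" for c' d'
    proof
      assume "cc c' d' \<and> c' + d' = c + d"
      then have *: "cc c' d'" "c' + d' = c + d" by auto
      have L': "c' \<in> L" "d' \<in> L" using c' d' p q by auto
      have "c' + d' \<in> tope_cone L E T" unfolding *(2) using c d add_cone by blast
      then have "c' \<in> tope_cone L E T" "d' \<in> tope_cone L E T" using cone_addD[OF L'] *(1) cc[OF
        L'] by blast+
      then have "N (c + d') \<le> N (c + d)" "N (c' + d) \<le> N (c + d)"
        using c d c' d' by (auto intro!: max simp: A_def)
      then have "c' = c" using max_pair_unique[OF cL L'(1) *(2)] by (simp add: N_def)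
      then show "c' = c \<and> d' = d" using *(2) by simp
    next
      assume eq: "c' = c \<and> d' = d"
      have "compat E c d" using compat_iff_cone[OF cL dL T(1)] T(1) c d by blast
      then show "cc c' d' \<and> c' + d' = c + d" using eq cc[OF cL dL] by simp
    qed
    have "lk (mult (sring L cc) p q) (c + d) =
      (\<Sum>c'\<in>Poly_Mapping.keys p. \<Sum>d'\<in>Poly_Mapping.keys q. if c' = c then
        if d' = d then lk p c' * lk q d' else 0 else 0)"
      unfolding lookup_sring_mult
    proof (intro sum.cong refl)
      fix c' d' assume "c' \<in> Poly_Mapping.keys p" "d' \<in> Poly_Mapping.keys q"
      then show "(if cc c' d' \<and> c' + d' = c + d then lk p c' * lk q d' else 0) =
        (if c' = c then if d' = d then lk p c' * lk q d' else 0 else 0)"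
        unfolding uniq[OF \<open>c' \<in> _\<close> \<open>d' \<in> _\<close>] by simp
    qed
    also have "\<dots> = (\<Sum>c'\<in>Poly_Mapping.keys p. if c' = c then lk p c' * lk q d else 0)"
      using d(1) by (intro sum.cong) auto
    also have "\<dots> = lk p c * lk q d" using c(1) by simp
    finally show False using zero c(1) d(1) by (simp add: in_keys_iff)
  qed
qed

lemma single_cone_ideal:
  "a \<noteq> 0 \<Longrightarrow> Poly_Mapping.single c a \<in> cone_ideal L E T \<longleftrightarrow> c \<in> L \<and> c \<notin> tope_cone L E T"
  by (auto simp: cone_ideal_def)

text \<open>A monomial interior to the chamber \<open>S\<close> belongs to every cone ideal except
  that of \<open>S\<close>.\<close>

lemma cone_ideal_mono_eq:
  assumes "T \<in> topes L E" "S \<in> topes L E"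
    and "(cone_ideal L E T :: (_ \<Rightarrow>\<^sub>0 'k::field) set) \<subseteq> cone_ideal L E S"
  shows "T = S"
proof -
  obtain z where z: "z \<in> L" "z \<in> tope_cone L E S" "\<And>U. U \<in> topes L E \<Longrightarrow> z \<in> tope_cone L E U \<Longrightarrow> U = S"
    using tope_interior[OF assms(2)] by blast
  have "(Poly_Mapping.single z 1 :: _ \<Rightarrow>\<^sub>0 'k) \<notin> cone_ideal L E S"
    unfolding single_cone_ideal[OF one_neq_zero] using z(2) by simp
  then have "(Poly_Mapping.single z 1 :: _ \<Rightarrow>\<^sub>0 'k) \<notin> cone_ideal L E T" using assms(3) by blast
  then have "z \<in> tope_cone L E T" unfolding single_cone_ideal[OF one_neq_zero] using z(1) by simp
  then show ?thesis using z(3) assms(1) by blast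
qed

text \<open>A monomial interior to \<open>T\<close> is annihilated exactly by the ideal of
  \<open>T\<close>. The annihilator of an arbitrary nonzero element is contained in the ideal of any
  chamber around one of its exponents.\<close>

lemma max_anns_sring:
  assumes cc: "\<And>c d. c \<in> L \<Longrightarrow> d \<in> L \<Longrightarrow> cc c d \<longleftrightarrow> compat E c d"
  shows "max_anns (sring L cc :: (_ \<Rightarrow>\<^sub>0 'k::field) ring) = cone_ideal L E ` topes L E"
proof -
  let ?R = "sring L cc :: (_ \<Rightarrow>\<^sub>0 'k) ring"
  have principal: "\<exists>f\<in>carrier ?R - {zero ?R}. ann ?R f = cone_ideal L E T" if T: "T \<in> topes L E"
    for T
  proof -
    obtain z where z: "z \<in> L" "z \<in> tope_cone L E T" "\<And>U. U \<in> topes L E \<Longrightarrow> z \<in> tope_cone L E U \<Longrightarrow>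
        U = T"
      using tope_interior[OF T] by blast
    let ?f = "Poly_Mapping.single z (1::'k)"
    have kf: "Poly_Mapping.keys ?f \<subseteq> L" using z(1) by simp
    have "mult ?R ?f g = 0 \<longleftrightarrow> g \<in> cone_ideal L E T" if "Poly_Mapping.keys g \<subseteq> L" for g
    proof -
      have "?f \<in> cone_ideal L E S \<longleftrightarrow> z \<notin> tope_cone L E S" for S
        unfolding single_cone_ideal[OF one_neq_zero] using z(1) by simp
      then have "mult ?R ?f g = 0 \<longleftrightarrow> (\<forall>S\<in>topes L E. z \<notin> tope_cone L E S \<or> g \<in> cone_ideal L E S)"
        using sring_mult_eq_0_iff[OF cc kf that] by simp
      also have "\<dots> \<longleftrightarrow> g \<in> cone_ideal L E T" using z(2,3) T by metis
      finally show ?thesis .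
    qed
    then have "ann ?R ?f = cone_ideal L E T"
      unfolding ann_def by (auto simp: cone_ideal_def)
    moreover have "?f \<noteq> 0" by (metis keys_eq_empty keys_single insert_not_empty zero_neq_one)
    ultimately show ?thesis using kf by (intro bexI[of _ ?f]) auto
  qed
  have below: "\<exists>T\<in>topes L E. ann ?R f \<subseteq> cone_ideal L E T" if f: "f \<in> carrier ?R - {zero ?R}" for f
  proof -
    have kf: "Poly_Mapping.keys f \<subseteq> L" "f \<noteq> 0" using f by auto
    then have "Poly_Mapping.keys f \<noteq> {}" by simp
    then obtain c where c: "c \<in> Poly_Mapping.keys f" by blast
    then have cL: "c \<in> L" using kf by blast
    obtain T0 where T0: "T0 \<in> topes L E" using ex_tope by blast
    obtain T where T: "T \<in> topes L E" "c \<in> tope_cone L E T"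
      using topes_signs[OF cL T0] cone_signs[OF cL] by blast
    have "f \<notin> cone_ideal L E T" using c T by (auto simp: cone_ideal_def)
    then have "g \<in> cone_ideal L E T" if "g \<in> ann ?R f" for g
      using that sring_mult_eq_0_iff[OF cc kf(1), of g] T(1) by (auto simp: ann_def)
    then show ?thesis using T(1) by blast
  qed
  show ?thesis
  proof (rule Set.set_eqI)
    fix A
    show "A \<in> max_anns ?R \<longleftrightarrow> A \<in> cone_ideal L E ` topes L E"
    proof
      assume "A \<in> max_anns ?R"
      then obtain f where f: "f \<in> carrier ?R - {zero ?R}" "A = ann ?R f"
        and max: "\<And>B. B \<in> ann ?R ` (carrier ?R - {zero ?R}) \<Longrightarrow> A \<subseteq> B \<Longrightarrow> A = B"
        unfolding max_anns_def by blast
      obtain T where T: "T \<in> topes L E" "A \<subseteq> cone_ideal L E T" using below[OF f(1)] f(2) by blast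
      obtain g where g: "g \<in> carrier ?R - {zero ?R}" "ann ?R g = cone_ideal L E T"
        using principal[OF T(1)] by blast
      have "A = ann ?R g" using max[OF imageI[OF g(1)]] T(2) g(2) by simp
      then show "A \<in> cone_ideal L E ` topes L E" using T(1) g(2) by blast
    next
      assume "A \<in> cone_ideal L E ` topes L E"
      then obtain T where T: "T \<in> topes L E" "A = cone_ideal L E T" by blast
      obtain g where g: "g \<in> carrier ?R - {zero ?R}" "ann ?R g = cone_ideal L E T"
        using principal[OF T(1)] by blast
      show "A \<in> max_anns ?R"
        unfolding max_anns_def
      proof (rule CollectI, intro conjI ballI impI)
        show "A \<in> ann ?R ` (carrier ?R - {zero ?R})" using T(2) g by (intro image_eqI[of _ _ g])
          auto
        fix B assume B: "B \<in> ann ?R ` (carrier ?R - {zero ?R})" "A \<subseteq> B"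
        then obtain f where f: "f \<in> carrier ?R - {zero ?R}" "B = ann ?R f" by blast
        then obtain S where S: "S \<in> topes L E" "B \<subseteq> cone_ideal L E S" using below by blast
        have "T = S" by (rule cone_ideal_mono_eq[OF T(1) S(1)]) (use T B S in blast)
        then show "A = B" using T B S by blast
      qed
    qed
  qed
qed

text \<open>The sum of the cone ideals is spanned by the monomials outside the intersection of the
  cones, and spans of monomials are compared monomial by monomial.\<close>

lemma sum_contains_sring:
  assumes \<A>: "\<A> \<subseteq> topes L E" "\<A> \<noteq> {}" and T: "T \<in> topes L E"
  shows "sum_contains (sring L cc :: (_ \<Rightarrow>\<^sub>0 'k::field) ring) (cone_ideal L E ` \<A>) (cone_ideal L E
      T) \<longleftrightarrow>
    (\<Inter>S\<in>\<A>. tope_cone L E S) \<subseteq> tope_cone L E T"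
proof
  let ?R = "sring L cc :: (_ \<Rightarrow>\<^sub>0 'k) ring"
  assume *: "sum_contains ?R (cone_ideal L E ` \<A>) (cone_ideal L E T)"
  let ?X = "{p :: _ \<Rightarrow>\<^sub>0 'k. Poly_Mapping.keys p \<subseteq> L \<and> Poly_Mapping.keys p \<inter> (\<Inter>S\<in>\<A>.
      tope_cone L E S) = {}}"
  have X: "cone_ideal L E T \<subseteq> ?X"
  proof (rule *[unfolded sum_contains_def, rule_format])
    show "?X \<subseteq> carrier ?R" by auto
    show "zero ?R \<in> ?X" by simp
    show "add ?R x y \<in> ?X" if "x \<in> ?X" "y \<in> ?X" for x y
      using that keys_add[of x y] by auto
    show "J \<subseteq> ?X" if "J \<in> cone_ideal L E ` \<A>" for J
      using that by (auto simp: cone_ideal_def)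
  qed
  show "(\<Inter>S\<in>\<A>. tope_cone L E S) \<subseteq> tope_cone L E T"
  proof
    fix c assume c: "c \<in> (\<Inter>S\<in>\<A>. tope_cone L E S)"
    show "c \<in> tope_cone L E T"
    proof (rule ccontr)
      assume "c \<notin> tope_cone L E T"
      moreover have "c \<in> L" using c \<A>(2) cone_sub by blast
      ultimately have "Poly_Mapping.single c (1::'k) \<in> cone_ideal L E T"
        unfolding single_cone_ideal[OF one_neq_zero] by simp
      then have "Poly_Mapping.single c (1::'k) \<in> ?X" using X by (rule subsetD[rotated])
      then show False using c by simp
    qed
  qed
next
  let ?R = "sring L cc :: (_ \<Rightarrow>\<^sub>0 'k) ring"
  assume *: "(\<Inter>S\<in>\<A>. tope_cone L E S) \<subseteq> tope_cone L E T"
  show "sum_contains ?R (cone_ideal L E ` \<A>) (cone_ideal L E T)"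
    unfolding sum_contains_def
  proof (intro allI impI subsetI)
    fix X and p :: "_ \<Rightarrow>\<^sub>0 'k"
    assume X: "zero ?R \<in> X" "\<forall>x\<in>X. \<forall>y\<in>X. add ?R x y \<in> X" "\<forall>J\<in>cone_ideal L E ` \<A>. J \<subseteq> X"
    assume p: "p \<in> cone_ideal L E T"
    have single: "Poly_Mapping.single c (lk p c) \<in> X" if c: "c \<in> Poly_Mapping.keys p" for c
    proof -
      have "c \<in> L" "c \<notin> tope_cone L E T" using c p by (auto simp: cone_ideal_def)
      then obtain S where "S \<in> \<A>" "c \<notin> tope_cone L E S" using * by blast
      then have "Poly_Mapping.single c (lk p c) \<in> cone_ideal L E S"
        using single_cone_ideal[of "lk p c" c S] c \<open>c \<in> L\<close> by (simp add: in_keys_iff)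
      then show ?thesis using X(3) \<open>S \<in> \<A>\<close> by blast
    qed
    have "(\<Sum>c\<in>A. Poly_Mapping.single c (lk p c)) \<in> X" if "finite A" "A \<subseteq> Poly_Mapping.keys p" for A
      using that by (induction A rule: finite_induct) (use X single in auto)
    from this[OF finite_keys subset_refl]
    have "push id p \<in> X" by (simp add: push_def)
    moreover have "push id p = p"
    proof (rule poly_mapping_eqI)
      fix c show "lk (push id p) c = lk p c"
        using lookup_push[of id UNIV p c] by simp
    qed
    ultimately show "p \<in> X" by simp
  qed
qed

end

text \<open>The chambers around \<open>c\<close> determine its support. An element \<open>c'\<close>
  of largest support in the intersection of their images is a relative interior point of it, so the
  chambers around \<open>c'\<close> are exactly those images, and its support is the corresponding
  one.\<close>

lemma support_transfer:
  assumes "simple_lattice L E" "simple_lattice L' E'"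
    and \<Phi>: "bij_betw \<Phi> (topes L E) (topes L' E')" and \<epsilon>: "bij_betw \<epsilon> E E'"
    and key: "\<And>T S i. T \<in> topes L E \<Longrightarrow> S \<in> topes L E \<Longrightarrow> i \<in> E \<Longrightarrow>
        \<epsilon> i \<in> sym_diff (\<Phi> T) (\<Phi> S) \<longleftrightarrow> i \<in> sym_diff T S"
    and cl: "\<And>\<A> T. \<A> \<subseteq> topes L E \<Longrightarrow> \<A> \<noteq> {} \<Longrightarrow> T \<in> topes L E \<Longrightarrow>
        (\<Inter>S\<in>\<A>. tope_cone L' E' (\<Phi> S)) \<subseteq> tope_cone L' E' (\<Phi> T) \<longleftrightarrow> (\<Inter>S\<in>\<A>. tope_cone L E S) \<subseteq>
          tope_cone L E T"
    and c: "c \<in> L"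
  shows "\<epsilon> ` support E c \<in> support E' ` L'"
proof -
  interpret A: simple_lattice L E by fact
  interpret B: simple_lattice L' E' by fact
  have img: "\<Phi> ` topes L E = topes L' E'" using \<Phi> by (auto simp: bij_betw_def)
  obtain T0 where T0: "T0 \<in> topes L E" using A.ex_tope by blast
  define K where "K = {T \<in> topes L E. c \<in> tope_cone L E T}"
  have K: "K \<subseteq> topes L E" "K \<noteq> {}"
    using A.topes_signs[OF c T0] A.cone_signs[OF c, of T0] by (auto simp: K_def)
  define X where "X = (\<Inter>S\<in>K. tope_cone L' E' (\<Phi> S))"
  have XL: "X \<subseteq> L'" using K(2) B.cone_sub unfolding X_def by blast
  have X0: "0 \<in> X" using B.zero_cone by (simp add: X_def)
  have "card (support E' d) \<le> card E'" for d
    using B.finite_E by (auto intro!: card_mono simp: support_def)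
  then have fin: "finite ((\<lambda>d. card (support E' d)) ` X)"
    by (intro finite_subset[OF _ finite_atMost[of "card E'"]]) auto
  have "Max ((\<lambda>d. card (support E' d)) ` X) \<in> (\<lambda>d. card (support E' d)) ` X"
    using X0 by (intro Max_in fin) auto
  then obtain c' where "c' \<in> X" "card (support E' c') = Max ((\<lambda>d. card (support E' d)) ` X)" by auto
  then have c': "c' \<in> X" "\<And>d. d \<in> X \<Longrightarrow> card (support E' d) \<le> card (support E' c')"
    using Max_ge[OF fin] by simp_all
  have c'L: "c' \<in> L'" using c' XL by blast
  have iff: "X \<subseteq> tope_cone L' E' T \<longleftrightarrow> c' \<in> tope_cone L' E' T" for T
  proof
    assume cT: "c' \<in> tope_cone L' E' T"
    show "X \<subseteq> tope_cone L' E' T"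
    proof
      fix d assume d: "d \<in> X"
      then have dL: "d \<in> L'" using XL by blast
      obtain S where S: "S \<in> K" using K(2) by blast
      have cS: "c' \<in> tope_cone L' E' (\<Phi> S)" "d \<in> tope_cone L' E' (\<Phi> S)" using c'(1) d S
        by (auto simp: X_def)
      have sum: "c' + d \<in> X" using c'(1) d B.add_cone by (auto simp: X_def)
      have pm: "if i \<in> \<Phi> S then 0 \<le> lk c' i \<and> 0 \<le> lk d i else lk c' i \<le> 0 \<and> lk d i \<le> 0"
        if "i \<in> E'" for i
        using cS that by (auto simp: tope_cone_def)
      \<comment> \<open>Both lie in one chamber, so supports unite without cancellation, and
        maximality puts the support of \<open>d\<close> inside that of \<open>c'\<close>.\<close>
      have supp: "support E' (c' + d) = support E' c' \<union> support E' d"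
      proof (rule Set.set_eqI)
        fix i show "i \<in> support E' (c' + d) \<longleftrightarrow> i \<in> support E' c' \<union> support E' d"
          using pm[of i] by (auto simp: support_def lookup_add split: if_splits)
      qed
      have "support E' c' = support E' (c' + d)"
        using c'(2)[OF sum] B.finite_E unfolding supp
        by (intro card_seteq) (auto simp: support_def)
      then have sub: "support E' d \<subseteq> support E' c'" unfolding supp by blast
      have "if i \<in> T then 0 \<le> lk d i else lk d i \<le> 0" if i: "i \<in> E'" for i
      proof (cases "lk d i = 0")
        case False
        then have "lk c' i \<noteq> 0" using sub i by (auto simp: support_def)
        moreover have "if i \<in> T then 0 \<le> lk c' i else lk c' i \<le> 0" using cT i
          by (auto simp: tope_cone_def)
        ultimately show ?thesis using pm[OF i] by (auto split: if_splits)
      qed simp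
      then show "d \<in> tope_cone L' E' T" using dL by (auto simp: tope_cone_def)
    qed
  qed (use c'(1) in blast)
  have K': "c' \<in> tope_cone L' E' (\<Phi> T) \<longleftrightarrow> T \<in> K" if T: "T \<in> topes L E" for T
  proof -
    have "c' \<in> tope_cone L' E' (\<Phi> T) \<longleftrightarrow> (\<Inter>S\<in>K. tope_cone L E S) \<subseteq> tope_cone L E T"
      using iff cl[OF K T] unfolding X_def by blast
    also have "\<dots> \<longleftrightarrow> T \<in> K" using T by (auto simp: K_def)
    finally show ?thesis .
  qed
  have supp: "\<epsilon> i \<in> support E' c' \<longleftrightarrow> i \<in> support E c" if i: "i \<in> E" for i
  proof -
    have \<epsilon>i: "\<epsilon> i \<in> E'" using \<epsilon> i by (auto simp: bij_betw_def)
    have "\<Phi> T0 \<in> topes L' E'" using T0 img by blast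
    then have "\<epsilon> i \<in> support E' c' \<longleftrightarrow>
        (\<forall>T\<in>topes L E. \<forall>S\<in>topes L E. c' \<in> tope_cone L' E' (\<Phi> T) \<longrightarrow> c' \<in> tope_cone L' E' (\<Phi> S) \<longrightarrow>
           \<epsilon> i \<notin> sym_diff (\<Phi> T) (\<Phi> S))"
      using B.support_iff_topes[OF c'L _ \<epsilon>i, of "\<Phi> T0"] unfolding img[symmetric]
        by (simp only: ball_simps)
    also have "\<dots> \<longleftrightarrow> (\<forall>T\<in>topes L E. \<forall>S\<in>topes L E. c \<in> tope_cone L E T \<longrightarrow> c \<in> tope_cone L E S \<longrightarrow>
        i \<notin> sym_diff T S)"
      using K' key[OF _ _ i] by (simp add: K_def)
    also have "\<dots> \<longleftrightarrow> i \<in> support E c" using A.support_iff_topes[OF c T0 i] by simp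
    finally show ?thesis .
  qed
  have "support E' c' = \<epsilon> ` support E c"
  proof (rule Set.set_eqI)
    fix i'
    show "i' \<in> support E' c' \<longleftrightarrow> i' \<in> \<epsilon> ` support E c"
    proof
      assume i': "i' \<in> support E' c'"
      then have "i' \<in> \<epsilon> ` E" using \<epsilon> by (auto simp: bij_betw_def support_def)
      then obtain i where "i \<in> E" "i' = \<epsilon> i" by blast
      then show "i' \<in> \<epsilon> ` support E c" using supp i' by blast
    next
      assume "i' \<in> \<epsilon> ` support E c"
      then obtain i where i: "i \<in> support E c" "i' = \<epsilon> i" by blast
      then have "i \<in> E" by (simp add: support_def)
      then show "i' \<in> support E' c'" using supp i by blast
    qed
  qed
  then show ?thesis using c'L by (intro image_eqI[of _ _ c']) auto
qed

lemma (in int_lattice) support_empty_iff: "c \<in> L \<Longrightarrow> support E c = {} \<longleftrightarrow> c = 0"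
  using eq_0I by (auto simp: support_def)

text \<open>In this form the minimal supports depend only on the set of all supports, which is what
  the bijection of coordinates is shown to preserve.\<close>

lemma (in int_lattice) min_supports_alt:
  "min_supports L E = {C \<in> support E ` L - {{}}. \<forall>D\<in>support E ` L - {{}}. D \<subseteq> C \<longrightarrow> D = C}"
proof -
  have "support E ` (L - {0}) = support E ` L - {{}}"
    using support_empty_iff by blast
  then show ?thesis by (simp add: min_supports_def)
qed

lemma image_minimals:
  assumes inj: "inj_on \<epsilon> E" and sub: "\<S> \<subseteq> Pow E"
  shows "(`) \<epsilon> ` {C \<in> \<S> - {{}}. \<forall>D\<in>\<S> - {{}}. D \<subseteq> C \<longrightarrow> D = C} =
    {C \<in> (`) \<epsilon> ` \<S> - {{}}. \<forall>D\<in>(`) \<epsilon> ` \<S> - {{}}. D \<subseteq> C \<longrightarrow> D = C}" (is "?l = ?r")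
proof -
  have le: "\<epsilon> ` C \<subseteq> \<epsilon> ` D \<longleftrightarrow> C \<subseteq> D" if "C \<in> \<S>" "D \<in> \<S>" for C D
    using inj_on_image_subset_iff[OF inj] sub that by blast
  have eq: "\<epsilon> ` C = \<epsilon> ` D \<longleftrightarrow> C = D" if "C \<in> \<S>" "D \<in> \<S>" for C D
    using inj_on_image_eq_iff[OF inj] sub that by blast
  have diff: "(`) \<epsilon> ` \<S> - {{}} = (`) \<epsilon> ` (\<S> - {{}})" by auto
  have gen: "{X \<in> f ` Q. \<forall>Y\<in>f ` Q. P Y X} = f ` {C \<in> Q. \<forall>D\<in>Q. P (f D) (f C)}"
    for f :: "'a set \<Rightarrow> 'b set" and Q P by blast
  have "?r = (`) \<epsilon> ` {C \<in> \<S> - {{}}. \<forall>D\<in>\<S> - {{}}. \<epsilon> ` D \<subseteq> \<epsilon> ` C \<longrightarrow> \<epsilon> ` D = \<epsilon> ` C}"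
    unfolding diff by (rule gen)
  also have "{C \<in> \<S> - {{}}. \<forall>D\<in>\<S> - {{}}. \<epsilon> ` D \<subseteq> \<epsilon> ` C \<longrightarrow> \<epsilon> ` D = \<epsilon> ` C} =
      {C \<in> \<S> - {{}}. \<forall>D\<in>\<S> - {{}}. D \<subseteq> C \<longrightarrow> D = C}"
    using le eq by (intro Collect_cong conj_cong ball_cong refl) simp
  finally show ?thesis ..
qed

theorem sring_iso_min_supports:
  assumes "simple_lattice L E" "simple_lattice L' E'"
    and cc: "\<And>c d. c \<in> L \<Longrightarrow> d \<in> L \<Longrightarrow> cc c d \<longleftrightarrow> compat E c d"
    and cc': "\<And>c d. c \<in> L' \<Longrightarrow> d \<in> L' \<Longrightarrow> cc' c d \<longleftrightarrow> compat E' c d"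
    and iso: "(sring L cc :: (_ \<Rightarrow>\<^sub>0 'k::field) ring) \<simeq> (sring L' cc' :: (_ \<Rightarrow>\<^sub>0 'k) ring)"
  shows "\<exists>\<epsilon>. bij_betw \<epsilon> E E' \<and> (`) \<epsilon> ` min_supports L E = min_supports L' E'"
proof -
  interpret A: simple_lattice L E by fact
  interpret B: simple_lattice L' E' by fact
  let ?R = "sring L cc :: (_ \<Rightarrow>\<^sub>0 'k) ring" and ?R' = "sring L' cc' :: (_ \<Rightarrow>\<^sub>0 'k) ring"
  let ?I = "cone_ideal L E :: _ \<Rightarrow> (_ \<Rightarrow>\<^sub>0 'k) set" and ?I' = "cone_ideal L' E' :: _ \<Rightarrow> (_ \<Rightarrow>\<^sub>0 'k) set"
  obtain h where h: "h \<in> ring_hom ?R ?R'" "bij_betw h (carrier ?R) (carrier ?R')"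
    using iso by (auto simp: is_ring_iso_def ring_iso_def)
  have inj: "inj_on h (carrier ?R)" using h(2) by (simp add: bij_betw_def)
  have closed: "add ?R f g \<in> carrier ?R" if "f \<in> carrier ?R" "g \<in> carrier ?R" for f g
    using that keys_add[of f g] by auto
  have zero: "zero ?R \<in> carrier ?R" by simp
  have "h 0 = h 0 + h 0" using ring_hom_add[OF h(1) zero zero] by simp
  then have h0: "h (zero ?R) = zero ?R'" by simp
  note hmult = ring_hom_mult[OF h(1)] and hadd = ring_hom_add[OF h(1)]
  have mclosed: "mult ?R f g \<in> carrier ?R" if "f \<in> carrier ?R" "g \<in> carrier ?R" for f g
    by (rule sring_mult_closed[OF A.add_mem that])
  have "max_anns ?R' = (`) h ` max_anns ?R"
    by (rule max_anns_iso[OF h(2) h0 zero mclosed hmult])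
  then have anns: "?I' ` topes L' E' = (`) h ` ?I ` topes L E"
    unfolding A.max_anns_sring[OF cc, simplified] B.max_anns_sring[OF cc', simplified] .
  have Isub: "?I T \<subseteq> carrier ?R" for T by (auto simp: cone_ideal_def)
  have "\<exists>T'\<in>topes L' E'. ?I' T' = h ` ?I T" if "T \<in> topes L E" for T
  proof -
    have "h ` ?I T \<in> ?I' ` topes L' E'" unfolding anns using that by blast
    then show ?thesis by (auto simp: image_iff)
  qed
  then obtain \<Phi> where \<Phi>: "\<And>T. T \<in> topes L E \<Longrightarrow> \<Phi> T \<in> topes L' E' \<and> ?I' (\<Phi> T) = h ` ?I T" by metis
  have bij: "bij_betw \<Phi> (topes L E) (topes L' E')"
    unfolding bij_betw_def
  proof
    show "inj_on \<Phi> (topes L E)"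
    proof (rule inj_onI)
      fix T S assume TS: "T \<in> topes L E" "S \<in> topes L E" "\<Phi> T = \<Phi> S"
      then have "h ` ?I T = h ` ?I S" using \<Phi>[OF TS(1)] \<Phi>[OF TS(2)] by metis
      then have "?I T = ?I S" using inj_on_image_eq_iff[OF inj Isub Isub] by blast
      then show "T = S" using A.cone_ideal_mono_eq[OF TS(1,2)] by blast
    qed
    have "T' \<in> \<Phi> ` topes L E" if T': "T' \<in> topes L' E'" for T'
    proof -
      have "?I' T' \<in> (`) h ` ?I ` topes L E" unfolding anns[symmetric] using T' by blast
      then obtain T where T: "T \<in> topes L E" "?I' T' = h ` ?I T" by blast
      then have "?I' T' = ?I' (\<Phi> T)" using \<Phi>[OF T(1)] by simp
      then have "T' = \<Phi> T" using B.cone_ideal_mono_eq[OF T'] \<Phi>[OF T(1)] by blast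
      then show ?thesis using T(1) by blast
    qed
    then show "\<Phi> ` topes L E = topes L' E'" using \<Phi> by blast
  qed
  have img: "\<Phi> ` topes L E = topes L' E'" using bij by (simp add: bij_betw_def)
  have cl: "(\<Inter>S\<in>\<A>. tope_cone L' E' (\<Phi> S)) \<subseteq> tope_cone L' E' (\<Phi> T) \<longleftrightarrow> (\<Inter>S\<in>\<A>.
      tope_cone L E S) \<subseteq> tope_cone L E T"
    if \<A>: "\<A> \<subseteq> topes L E" "\<A> \<noteq> {}" and T: "T \<in> topes L E" for \<A> T
  proof -
    have "(\<Inter>S\<in>\<Phi> ` \<A>. tope_cone L' E' S) \<subseteq> tope_cone L' E' (\<Phi> T) \<longleftrightarrow>
        sum_contains ?R' (?I' ` \<Phi> ` \<A>) (?I' (\<Phi> T))"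
      by (rule B.sum_contains_sring[symmetric]) (use \<A> T img in auto)
    also have "?I' ` \<Phi> ` \<A> = (`) h ` ?I ` \<A>"
      unfolding image_image using \<Phi> \<A>(1) by (intro image_cong) auto
    also have "?I' (\<Phi> T) = h ` ?I T" using \<Phi> T by blast
    also have "sum_contains ?R' ((`) h ` ?I ` \<A>) (h ` ?I T) \<longleftrightarrow> sum_contains ?R (?I ` \<A>) (?I T)"
      by (rule sum_contains_iso[OF h(2) h0 zero closed hadd]) (use Isub in auto)
    also have "\<dots> \<longleftrightarrow> (\<Inter>S\<in>\<A>. tope_cone L E S) \<subseteq> tope_cone L E T"
      by (rule A.sum_contains_sring[OF \<A> T])
    finally show ?thesis by simp
  qed
  have adj: "card (sym_diff (\<Phi> T) (\<Phi> S)) = 1 \<longleftrightarrow> card (sym_diff T S) = 1"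
    if TS: "T \<in> topes L E" "S \<in> topes L E" for T S
  proof -
    have "\<Phi> T \<in> topes L' E'" "\<Phi> S \<in> topes L' E'" using \<Phi> TS by blast+
    then have "card (sym_diff (\<Phi> T) (\<Phi> S)) = 1 \<longleftrightarrow> \<Phi> T \<noteq> \<Phi> S \<and>
       (\<forall>U\<in>topes L E. tope_cone L' E' (\<Phi> T) \<inter> tope_cone L' E' (\<Phi> S) \<subseteq> tope_cone L' E' (\<Phi> U) \<longrightarrow> \<Phi> U
         \<in> {\<Phi> T, \<Phi> S})"
      unfolding B.adjacent_iff[OF \<open>\<Phi> T \<in> _\<close> \<open>\<Phi> S \<in> _\<close>] img[symmetric] by (simp only: ball_simps)
    also have "\<dots> \<longleftrightarrow> T \<noteq> S \<and> (\<forall>U\<in>topes L E. tope_cone L E T \<inter> tope_cone L E S \<subseteq> tope_cone L E U \<longrightarrow>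
        U \<in> {T, S})"
    proof -
      have "tope_cone L' E' (\<Phi> T) \<inter> tope_cone L' E' (\<Phi> S) \<subseteq> tope_cone L' E' (\<Phi> U) \<longleftrightarrow>
          tope_cone L E T \<inter> tope_cone L E S \<subseteq> tope_cone L E U"
        if "U \<in> topes L E" for U
        using cl[of "{T, S}" U] TS that by simp
      moreover have "\<Phi> U = \<Phi> V \<longleftrightarrow> U = V" if "U \<in> topes L E" "V \<in> topes L E" for U V
        using bij that by (auto simp: bij_betw_def dest: inj_onD)
      ultimately show ?thesis using TS by simp
    qed
    also have "\<dots> \<longleftrightarrow> card (sym_diff T S) = 1" using A.adjacent_iff[OF TS] by simp
    finally show ?thesis .
  qed
  obtain \<epsilon> where ex: "bij_betw \<epsilon> E E' \<and>
    (\<forall>T\<in>topes L E. \<forall>S\<in>topes L E. \<forall>i\<in>E. \<epsilon> i \<in> sym_diff (\<Phi> T) (\<Phi> S) \<longleftrightarrow> i \<in> sym_diff T S)"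
    using tope_graph_relabel[OF A.tope_set B.tope_set bij] adj by metis
  then have \<epsilon>: "bij_betw \<epsilon> E E'" by (rule conjunct1)
  have key: "\<epsilon> i \<in> sym_diff (\<Phi> T) (\<Phi> S) \<longleftrightarrow> i \<in> sym_diff T S"
    if "T \<in> topes L E" "S \<in> topes L E" "i \<in> E" for T S i
    using ex that by blast
  have "\<epsilon> ` support E c \<in> support E' ` L'" if "c \<in> L" for c
  proof (rule support_transfer[OF assms(1,2) bij \<epsilon> _ _ that])
    show "\<epsilon> i \<in> sym_diff (\<Phi> T) (\<Phi> S) \<longleftrightarrow> i \<in> sym_diff T S"
      if "T \<in> topes L E" "S \<in> topes L E" "i \<in> E" for T S i by (rule key[OF that])
    show "(\<Inter>S\<in>\<A>. tope_cone L' E' (\<Phi> S)) \<subseteq> tope_cone L' E' (\<Phi> T) \<longleftrightarrow> (\<Inter>S\<in>\<A>.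
        tope_cone L E S) \<subseteq> tope_cone L E T"
      if "\<A> \<subseteq> topes L E" "\<A> \<noteq> {}" "T \<in> topes L E" for \<A> T by (rule cl[OF that])
  qed
  then have sub: "(`) \<epsilon> ` support E ` L \<subseteq> support E' ` L'" by blast
  let ?\<Psi> = "inv_into (topes L E) \<Phi>" and ?\<eta> = "inv_into E \<epsilon>"
  have \<Psi>: "?\<Psi> T \<in> topes L E" "\<Phi> (?\<Psi> T) = T" if "T \<in> topes L' E'" for T
    using that img by (auto simp: inv_into_into f_inv_into_f)
  have \<eta>: "?\<eta> i \<in> E" "\<epsilon> (?\<eta> i) = i" if "i \<in> E'" for i
    using that \<epsilon> by (auto simp: inv_into_into f_inv_into_f bij_betw_def)
  have sub': "?\<eta> ` support E' c \<in> support E ` L" if "c \<in> L'" for c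
  proof (rule support_transfer[OF assms(2,1) bij_betw_inv_into[OF bij] bij_betw_inv_into[OF \<epsilon>] _ _
    that])
    fix T S i assume "T \<in> topes L' E'" "S \<in> topes L' E'" "i \<in> E'"
    then show "?\<eta> i \<in> sym_diff (?\<Psi> T) (?\<Psi> S) \<longleftrightarrow> i \<in> sym_diff T S"
      using key[of "?\<Psi> T" "?\<Psi> S" "?\<eta> i"] \<Psi> \<eta> by simp
  next
    fix \<A> T assume \<A>: "\<A> \<subseteq> topes L' E'" "\<A> \<noteq> {}" "T \<in> topes L' E'"
    have "(\<Inter>S\<in>?\<Psi> ` \<A>. tope_cone L' E' (\<Phi> S)) \<subseteq> tope_cone L' E' (\<Phi> (?\<Psi> T)) \<longleftrightarrow> (\<Inter>S\<in>?\<Psi> ` \<A>.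
        tope_cone L E S) \<subseteq> tope_cone L E (?\<Psi> T)"
      by (rule cl) (use \<A> \<Psi> in auto)
    moreover have "(\<Inter>S\<in>?\<Psi> ` \<A>. tope_cone L' E' (\<Phi> S)) = (\<Inter>S\<in>\<A>. tope_cone L' E' S)"
      using \<Psi>(2) \<A>(1) by (auto simp: subset_iff)
    ultimately show "(\<Inter>S\<in>\<A>. tope_cone L E (?\<Psi> S)) \<subseteq> tope_cone L E (?\<Psi> T) \<longleftrightarrow> (\<Inter>S\<in>\<A>.
        tope_cone L' E' S) \<subseteq> tope_cone L' E' T"
      using \<Psi>(2)[OF \<A>(3)] by simp
  qed
  have "support E' ` L' \<subseteq> (`) \<epsilon> ` support E ` L"
  proof
    fix D assume "D \<in> support E' ` L'"
    then obtain c where c: "c \<in> L'" "D = support E' c" by blast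
    have "\<epsilon> ` ?\<eta> ` D = D"
      unfolding image_image using \<eta>(2) c(2) by (auto simp: support_def)
    then show "D \<in> (`) \<epsilon> ` support E ` L" using sub'[OF c(1)] c(2) by (metis imageI)
  qed
  with sub have "(`) \<epsilon> ` support E ` L = support E' ` L'" by blast
  moreover have "inj_on \<epsilon> E" using \<epsilon> by (simp add: bij_betw_def)
  moreover have "support E ` L \<subseteq> Pow E" by (auto simp: support_def)
  ultimately have "(`) \<epsilon> ` min_supports L E = min_supports L' E'"
    unfolding A.min_supports_alt B.min_supports_alt by (subst image_minimals) auto
  then show ?thesis using \<epsilon> by blast
qed


section \<open>Cycles and cuts\<close>

lemma sum_when_inj:
  fixes a :: "'a::comm_monoid_add"
  assumes "finite W" "inj_on g W"
  shows "(\<Sum>v\<in>W. a when w = g v) = (if w \<in> g ` W then a else 0)"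
proof -
  have "(\<Sum>v\<in>W. a when w = g v) = (\<Sum>y\<in>g ` W. if w = y then a else 0)"
    by (simp add: sum.reindex[OF assms(2)] when_def)
  then show ?thesis using assms(1) by simp
qed

text \<open>The classes of \<open>s\<close> are images of those of \<open>r\<close>, and the
  distinct classes of \<open>a\<close> and \<open>b\<close> have the same image.\<close>

lemma card_quotient_less:
  assumes "finite A" and r: "equiv A r" and s: "equiv A s" and "r \<subseteq> s" and ab: "(a, b) \<in> s" "(a,
      b) \<notin> r"
  shows "card (A // s) < card (A // r)"
proof -
  have fin: "finite (A // r)"
    using assms(1) r by (simp add: finite_quotient equiv_type)
  have a: "a \<in> A" "b \<in> A" using ab(1) s by (meson equiv_class_eq_iff)+
  have f: "s `` (r `` {x}) = s `` {x}" if "x \<in> A" for x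
  proof -
    have "(x, x) \<in> r" using equiv_class_self[OF r that] by simp
    moreover have "trans s" using s by (simp add: equiv_def)
    ultimately show ?thesis using \<open>r \<subseteq> s\<close> by (auto dest: transD)
  qed
  have "A // s = (\<lambda>C. s `` C) ` (A // r)"
    by (simp add: quotient_def image_UN f)
  moreover have "card ((\<lambda>C. s `` C) ` (A // r)) < card (A // r)"
  proof (rule ccontr)
    assume "\<not> ?thesis"
    then have "card ((\<lambda>C. s `` C) ` (A // r)) = card (A // r)"
      using card_image_le[OF fin, of "\<lambda>C. s `` C"] by linarith
    then have inj: "inj_on (\<lambda>C. s `` C) (A // r)" by (rule eq_card_imp_inj_on[OF fin])
    have "s `` (r `` {a}) = s `` (r `` {b})"
      using f a ab(1) s by (simp add: equiv_class_eq_iff)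
    then have "r `` {a} = r `` {b}" using inj_onD[OF inj] a by (simp add: quotientI)
    then have "(a, b) \<in> r" using r a by (simp add: equiv_class_eq_iff)
    then show False using ab(2) by simp
  qed
  ultimately show ?thesis by simp
qed

lemma darts_delete_edges [simp]:
  "darts (delete_edges G S) = {x \<in> darts G. dart_edge G x \<notin> S}"
  "verts (delete_edges G S) = verts G" "src (delete_edges G S) = src G"
  "tgt (delete_edges G S) = tgt G" "opp (delete_edges G S) = opp G"
  by (simp_all add: delete_edges_def)

context finite_graph
begin

lemma tgt_opp: "x \<in> darts G \<Longrightarrow> tgt G (opp G x) = src G x"
  by (simp add: src_eq_tgt_opp)

lemma src_opp: "x \<in> darts G \<Longrightarrow> src G (opp G x) = tgt G x"
  using src_eq_tgt_opp[of "opp G x"] opp_in opp_opp by simp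

lemma dart_edge_opp: "x \<in> darts G \<Longrightarrow> dart_edge G (opp G x) = dart_edge G x"
  by (auto simp: dart_edge_def opp_opp)

lemma dart_edge_eq_iff:
  "x \<in> darts G \<Longrightarrow> y \<in> darts G \<Longrightarrow> dart_edge G x = dart_edge G y \<longleftrightarrow> x = y \<or> x = opp G y"
  using opp_opp[of x] opp_opp[of y] opp_neq[of x] opp_neq[of y]
  unfolding dart_edge_def doubleton_eq_iff by metis

lemma chains_iff:
  "c \<in> chains G \<longleftrightarrow> (\<forall>x. x \<notin> darts G \<longrightarrow> lk c x = 0) \<and> (\<forall>x\<in>darts G. lk c (opp G x) = - lk c x)"
  by (auto simp: chains_def in_keys_iff)

lemma chain_opp: "c \<in> chains G \<Longrightarrow> x \<in> darts G \<Longrightarrow> lk c (opp G x) = - lk c x"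
  by (simp add: chains_iff)

lemma chain_out: "c \<in> chains G \<Longrightarrow> x \<notin> darts G \<Longrightarrow> lk c x = 0"
  by (simp add: chains_iff)

lemma H1_chains: "c \<in> H1 G \<Longrightarrow> c \<in> chains G"
  by (simp add: H1_def)

lemma H1_boundary: "c \<in> H1 G \<Longrightarrow> v \<in> verts G \<Longrightarrow> boundary G c v = 0"
  by (simp add: H1_def)

lemma H1_zero: "0 \<in> H1 G"
  by (simp add: H1_def chains_iff boundary_def)

lemma chains_zero: "0 \<in> chains G"
  by (simp add: chains_iff)

lemma chains_add: "c \<in> chains G \<Longrightarrow> d \<in> chains G \<Longrightarrow> c + d \<in> chains G"
  by (simp add: chains_iff lookup_add)

lemma chains_uminus: "c \<in> chains G \<Longrightarrow> - c \<in> chains G"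
  by (simp add: chains_iff)

lemma chains_sum: "(\<And>w. w \<in> W \<Longrightarrow> f w \<in> chains G) \<Longrightarrow> (\<Sum>w\<in>W. f w) \<in> chains G"
  by (induction W rule: infinite_finite_induct) (auto intro: chains_zero chains_add)

lemma boundary_add: "boundary G (c + d) v = boundary G c v + boundary G d v"
  by (simp add: boundary_def lookup_add sum.distrib)

lemma boundary_uminus: "boundary G (- c) v = - boundary G c v"
  by (simp add: boundary_def sum_negf)

lemma boundary_sum: "boundary G (\<Sum>w\<in>W. f w) v = (\<Sum>w\<in>W. boundary G (f w) v)"
  unfolding boundary_def lookup_sum by (rule sum.swap)

lemma H1_add: "c \<in> H1 G \<Longrightarrow> d \<in> H1 G \<Longrightarrow> c + d \<in> H1 G"
  by (simp add: H1_def chains_add boundary_add)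

lemma H1_uminus: "c \<in> H1 G \<Longrightarrow> - c \<in> H1 G"
  by (simp add: H1_def chains_uminus boundary_uminus)

lemma lookup_dart_chain:
  assumes "x \<in> darts G" "y \<in> darts G"
  shows "lk (dart_chain G x a) y = (a when x = y) - (a when x = opp G y)"
  using opp_eq_iff[OF assms] by (simp add: dart_chain_def lookup_minus lookup_single)

lemma dart_chain_eq_0: "y \<noteq> x \<Longrightarrow> y \<noteq> opp G x \<Longrightarrow> lk (dart_chain G x a) y = 0"
  by (simp add: dart_chain_def lookup_minus lookup_single)

text \<open>Following positive darts forward gives a self-map of a finite set of vertices; on a minimal
  invariant subset it is a permutation, and its orbits are directed cycles.\<close>

lemma conformal_cycle:
  fixes c :: "'e \<Rightarrow>\<^sub>0 'a::linordered_idom"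
  assumes c: "c \<in> H1 G" "c \<noteq> 0"
  shows "\<exists>u\<in>(H1 G :: ('e \<Rightarrow>\<^sub>0 int) set). u \<noteq> 0 \<and>
    (\<forall>x. lk u x \<noteq> 0 \<longrightarrow> (lk u x = 1 \<and> 0 < lk c x) \<or> (lk u x = -1 \<and> lk c x < 0))"
proof -
  note cc = H1_chains[OF c(1)]
  define P where "P = {x \<in> darts G. 0 < lk c x}"
  define W where "W = src G ` P"
  have P: "P \<subseteq> darts G" by (auto simp: P_def)
  have finP: "finite P" using P finite_darts finite_subset by blast
  have Popp: "opp G x \<notin> P" if "x \<in> P" for x
    using that chain_opp[OF cc, of x] by (auto simp: P_def)
  obtain x0 where "lk c x0 \<noteq> 0" using c(2) by (metis lookup_zero poly_mapping_eqI)
  moreover have "x0 \<in> darts G" using calculation chain_out[OF cc] by blast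
  ultimately have "x0 \<in> P \<or> opp G x0 \<in> P"
    using chain_opp[OF cc, of x0] opp_in by (auto simp: P_def neq_iff)
  then have Wne: "W \<noteq> {}" by (auto simp: W_def)
  have finW: "finite W" using finP by (simp add: W_def)
  \<comment> \<open>Otherwise all darts into \<open>tgt G x\<close> have nonnegative value, and
    \<open>x\<close> a positive one, against the vanishing boundary.\<close>
  have step: "tgt G x \<in> W" if x: "x \<in> P" for x
  proof (rule ccontr)
    assume nW: "tgt G x \<notin> W"
    have xd: "x \<in> darts G" using x P by blast
    have "0 \<le> lk c y" if y: "y \<in> darts G" "tgt G y = tgt G x" for y
    proof (rule ccontr)
      assume "\<not> 0 \<le> lk c y"
      then have "opp G y \<in> P" using y opp_in chain_opp[OF cc] by (simp add: P_def)
      moreover have "src G (opp G y) = tgt G x" using y src_opp by simp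
      ultimately show False using nW unfolding W_def by (metis imageI)
    qed
    then have "boundary G c (tgt G x) \<noteq> 0"
      unfolding boundary_def using x xd finite_darts
      by (subst sum_nonneg_eq_0_iff) (auto simp: P_def)
    then show False using H1_boundary[OF c(1) tgt_in[OF xd]] by simp
  qed
  have "\<exists>x. x \<in> P \<and> src G x = v" if "v \<in> W" for v using that by (auto simp: W_def)
  then obtain nxt where nxt: "\<And>v. v \<in> W \<Longrightarrow> nxt v \<in> P \<and> src G (nxt v) = v" by metis
  define f where "f v = tgt G (nxt v)" for v
  have fW: "f ` W \<subseteq> W" using nxt step by (auto simp: f_def)
  let ?F = "{V. V \<subseteq> W \<and> V \<noteq> {} \<and> f ` V \<subseteq> V}"
  have "finite ?F" by (rule finite_subset[of _ "Pow W"]) (use finW in auto)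
  moreover have "?F \<noteq> {}" using fW Wne by blast
  ultimately have "\<exists>V\<in>?F. \<forall>U\<in>?F. U \<subseteq> V \<longrightarrow> V = U" by (rule finite_has_minimal)
  then obtain V where V: "V \<in> ?F" and min: "\<forall>U\<in>?F. U \<subseteq> V \<longrightarrow> V = U" by (elim bexE)
  have VW: "V \<subseteq> W" and Vne: "V \<noteq> {}" and fVV: "f ` V \<subseteq> V" using V by auto
  have "f ` V \<in> ?F" using VW Vne fVV by (auto intro: subset_trans)
  then have fV: "f ` V = V" using min fVV by blast
  have finV: "finite V" using VW finW finite_subset by blast
  have injf: "inj_on f V" using eq_card_imp_inj_on[OF finV, of f] fV by simp
  have injn: "inj_on nxt V" by (rule inj_on_inverseI[of _ "src G"]) (use nxt VW in blast)
  have nP: "nxt v \<in> P" "nxt v \<in> darts G" "src G (nxt v) = v" if "v \<in> V" for v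
    using nxt that VW P by blast+
  have nVP: "nxt ` V \<subseteq> P" using nP(1) by blast
  define u :: "'e \<Rightarrow>\<^sub>0 int" where "u = (\<Sum>v\<in>V. dart_chain G (nxt v) 1)"
  have uc: "u \<in> chains G" unfolding u_def by (intro chains_sum dart_chain_in_chains nP)
  have "boundary G u w = 0" for w
  proof -
    have "boundary G u w = (\<Sum>v\<in>V. (1 when w = f v) - (1 when w = v))"
      unfolding u_def boundary_sum by (intro sum.cong refl) (simp add: boundary_dart_chain nP f_def)
    also have "\<dots> = (\<Sum>v\<in>V. 1 when w = f v) - (\<Sum>v\<in>V. 1 when w = id v)"
      by (simp add: sum_subtractf)
    also have "\<dots> = 0"
      unfolding sum_when_inj[OF finV injf] sum_when_inj[OF finV inj_on_id] fV by simp
    finally show ?thesis .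
  qed
  then have uH: "u \<in> H1 G" using uc by (simp add: H1_def)
  have lku: "lk u x = (if x \<in> nxt ` V then 1 else 0) - (if opp G x \<in> nxt ` V then 1 else 0)"
    if x: "x \<in> darts G" for x
  proof -
    have "lk u x = (\<Sum>v\<in>V. (1 when x = nxt v) - (1 when opp G x = nxt v))"
      unfolding u_def lookup_sum
      by (intro sum.cong refl) (simp add: lookup_dart_chain nP x eq_commute[of "nxt _"])
    also have "\<dots> = (\<Sum>v\<in>V. 1 when x = nxt v) - (\<Sum>v\<in>V. 1 when opp G x = nxt v)"
      by (simp add: sum_subtractf)
    finally show ?thesis unfolding sum_when_inj[OF finV injn] .
  qed
  have "(lk u x = 1 \<and> 0 < lk c x) \<or> (lk u x = -1 \<and> lk c x < 0)" if nz: "lk u x \<noteq> 0" for x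
  proof -
    have x: "x \<in> darts G" using nz chain_out[OF uc] by blast
    show ?thesis
    proof (cases "x \<in> nxt ` V")
      case True
      then have "x \<in> P" using nP by blast
      then have "opp G x \<notin> nxt ` V" using Popp nVP by (meson subsetD)
      then show ?thesis using True lku[OF x] \<open>x \<in> P\<close> by (simp add: P_def)
    next
      case False
      then have o: "opp G x \<in> nxt ` V" using nz lku[OF x] by (auto split: if_splits)
      then have "opp G x \<in> P" using nVP by (meson subsetD)
      then have "lk c x < 0" using chain_opp[OF cc x] by (simp add: P_def)
      then show ?thesis using False o lku[OF x] by simp
    qed
  qed
  moreover have "u \<noteq> 0"
  proof
    assume "u = 0"
    obtain v where v: "v \<in> V" using Vne by blast
    have "opp G (nxt v) \<notin> nxt ` V" using Popp[OF nP(1)[OF v]] nVP by (meson subsetD)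
    then show False using lku[OF nP(2)[OF v]] v \<open>u = 0\<close> by simp
  qed
  ultimately show ?thesis using uH by blast
qed

text \<open>Sum the boundary over \<open>A\<close>: darts inside \<open>A\<close> cancel against
  their opposites, and the flow through the cut is left.\<close>

lemma H1_cut:
  fixes c :: "'e \<Rightarrow>\<^sub>0 'a::linordered_idom"
  assumes c: "c \<in> H1 G" and A: "A \<subseteq> verts G"
  shows "(\<Sum>x | x \<in> darts G \<and> tgt G x \<in> A \<and> src G x \<notin> A. lk c x) = 0"
proof -
  have finA: "finite A" using A finite_verts finite_subset by blast
  let ?I = "{x \<in> darts G. tgt G x \<in> A \<and> src G x \<in> A}"
  let ?C = "{x \<in> darts G. tgt G x \<in> A \<and> src G x \<notin> A}"
  have "0 = (\<Sum>v\<in>A. boundary G c v)" using H1_boundary[OF c] A by (intro sum.neutral[symmetric])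
    blast
  also have "\<dots> = (\<Sum>v\<in>A. \<Sum>x\<in>{x \<in> {x \<in> darts G. tgt G x \<in> A}. tgt G x = v}. lk c x)"
    unfolding boundary_def by (intro sum.cong refl) auto
  also have "\<dots> = (\<Sum>x\<in>{x \<in> darts G. tgt G x \<in> A}. lk c x)"
    by (rule sum.group) (use finA finite_darts in auto)
  also have "{x \<in> darts G. tgt G x \<in> A} = ?I \<union> ?C" by blast
  also have "(\<Sum>x\<in>?I \<union> ?C. lk c x) = (\<Sum>x\<in>?I. lk c x) + (\<Sum>x\<in>?C. lk c x)"
    using finite_darts by (intro sum.union_disjoint) auto
  finally have *: "(\<Sum>x\<in>?I. lk c x) + (\<Sum>x\<in>?C. lk c x) = 0" by simp
  have "(\<Sum>x\<in>?I. lk c x) = (\<Sum>x\<in>?I. lk c (opp G x))"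
    by (rule sum.reindex_bij_witness[of _ "opp G" "opp G"]) (auto simp: opp_in opp_opp src_opp
      tgt_opp)
  also have "\<dots> = (\<Sum>x\<in>?I. - lk c x)"
    using chain_opp[OF H1_chains[OF c]] by (intro sum.cong) auto
  finally have "(\<Sum>x\<in>?I. lk c x) = 0" by (simp add: sum_negf)
  then show ?thesis using * by simp
qed

lemma path_chain:
  assumes "(u, v) \<in> ((\<lambda>x. (src G x, tgt G x)) ` D)\<^sup>*" "D \<subseteq> darts G"
  shows "\<exists>p::'e \<Rightarrow>\<^sub>0 int. p \<in> chains G \<and> (\<forall>x. lk p x \<noteq> 0 \<longrightarrow> x \<in> D \<or> opp G x \<in> D) \<and>
    (\<forall>w. boundary G p w = (1 when w = v) - (1 when w = u))"
  using assms(1)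
proof (induction rule: rtrancl_induct)
  case base
  then show ?case using chains_zero by (intro exI[of _ 0]) (simp add: boundary_def)
next
  case (step v v')
  then obtain p :: "'e \<Rightarrow>\<^sub>0 int" where p: "p \<in> chains G" "\<forall>x. lk p x \<noteq> 0 \<longrightarrow> x \<in> D \<or> opp G x \<in> D"
    "\<forall>w. boundary G p w = (1 when w = v) - (1 when w = u)" by blast
  obtain x where x: "x \<in> D" "v = src G x" "v' = tgt G x" using step.hyps(2) by blast
  have xd: "x \<in> darts G" using x assms(2) by blast
  have "p + dart_chain G x 1 \<in> chains G" by (intro chains_add p dart_chain_in_chains xd)
  moreover have "y \<in> D \<or> opp G y \<in> D" if nz: "lk (p + dart_chain G x 1) y \<noteq> 0" for y
  proof -
    have "lk p y \<noteq> 0 \<or> y = x \<or> y = opp G x"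
      using nz dart_chain_eq_0[of y x "1::int"] by (cases "lk p y = 0") (auto simp: lookup_add)
    then show ?thesis using p(2) x opp_opp[OF xd] by (elim disjE) auto
  qed
  moreover have "boundary G (p + dart_chain G x 1) w = (1 when w = v') - (1 when w = u)" for w
    using p(3) x by (simp add: boundary_add boundary_dart_chain[OF xd])
  ultimately show ?case by blast
qed

section \<open>Deletion of edges: components, cycles and cuts\<close>

lemma finite_graph_delete_edges: "finite_graph (delete_edges G S)"
  by standard (use finite_verts finite_darts src_in tgt_in opp_in opp_opp opp_neq src_eq_tgt_opp
    dart_edge_opp in auto)

lemma joined_sym_rel: "sym (((\<lambda>x. (src G x, tgt G x)) ` darts G)\<^sup>*)"
proof (rule sym_rtrancl, rule symI)
  fix u v assume "(u, v) \<in> (\<lambda>x. (src G x, tgt G x)) ` darts G"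
  then obtain x where x: "x \<in> darts G" "u = src G x" "v = tgt G x" by blast
  show "(v, u) \<in> (\<lambda>x. (src G x, tgt G x)) ` darts G"
    by (rule image_eqI[of _ _ "opp G x"]) (use x opp_in src_opp tgt_opp in auto)
qed

lemma equiv_joined: "equiv (verts G) (joined G)"
proof (rule equivI)
  show "refl_on (verts G) (joined G)" by (auto simp: refl_on_def joined_def)
  show "sym (joined G)" using joined_sym_rel by (auto simp: sym_def joined_def)
  show "trans (joined G)" by (rule transI) (auto simp: joined_def)
qed (auto simp: joined_def)

lemma joined_dart: "x \<in> darts G \<Longrightarrow> (src G x, tgt G x) \<in> joined G"
  using src_in tgt_in by (auto simp: joined_def)

lemma joined_delete_edges: "joined (delete_edges G S) \<subseteq> joined G"
proof -
  have "((\<lambda>x. (src G x, tgt G x)) ` {x \<in> darts G. dart_edge G x \<notin> S})\<^sup>* \<subseteq> ((\<lambda>x. (src G x,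
      tgt G x)) ` darts G)\<^sup>*"
    by (rule rtrancl_mono) blast
  then show ?thesis by (auto simp: joined_def)
qed

text \<open>If the ends of all deleted darts stay joined, the relation does not change; otherwise it
  becomes strictly finer and its classes more numerous.\<close>

lemma num_components_delete_edges:
  "num_components G < num_components (delete_edges G S) \<longleftrightarrow>
    (\<exists>x\<in>darts G. dart_edge G x \<in> S \<and> (src G x, tgt G x) \<notin> joined (delete_edges G S))"
proof -
  interpret D: finite_graph "delete_edges G S" by (rule finite_graph_delete_edges)
  have eqD: "equiv (verts G) (joined (delete_edges G S))" using D.equiv_joined by simp
  show ?thesis
  proof
    assume less: "num_components G < num_components (delete_edges G S)"
    show "\<exists>x\<in>darts G. dart_edge G x \<in> S \<and> (src G x, tgt G x) \<notin> joined (delete_edges G S)"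
    proof (rule ccontr)
      assume *: "\<not> ?thesis"
      let ?r = "((\<lambda>x. (src G x, tgt G x)) ` {x \<in> darts G. dart_edge G x \<notin> S})\<^sup>*"
      have "(\<lambda>x. (src G x, tgt G x)) ` darts G \<subseteq> ?r"
      proof
        fix p assume "p \<in> (\<lambda>x. (src G x, tgt G x)) ` darts G"
        then obtain x where x: "x \<in> darts G" "p = (src G x, tgt G x)" by blast
        show "p \<in> ?r"
        proof (cases "dart_edge G x \<in> S")
          case True
          then show ?thesis using * x by (auto simp: joined_def)
        next
          case False
          then show ?thesis using x by blast
        qed
      qed
      then have "((\<lambda>x. (src G x, tgt G x)) ` darts G)\<^sup>* \<subseteq> ?r"
        by (rule rtrancl_subset_rtrancl)
      then have "joined G = joined (delete_edges G S)"
        using joined_delete_edges by (auto simp: joined_def)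
      then show False using less by (simp add: num_components_def)
    qed
  next
    assume "\<exists>x\<in>darts G. dart_edge G x \<in> S \<and> (src G x, tgt G x) \<notin> joined (delete_edges G S)"
    then obtain x where "x \<in> darts G" "(src G x, tgt G x) \<notin> joined (delete_edges G S)" by blast
    then show "num_components G < num_components (delete_edges G S)"
      unfolding num_components_def
      using card_quotient_less[OF finite_verts eqD equiv_joined joined_delete_edges joined_dart]
        by simp
  qed
qed

text \<open>The dart \<open>x\<close> is closed up by a path between its ends that avoids
  \<open>S\<close>.\<close>

lemma cycle_avoiding:
  assumes x: "x \<in> darts G" "dart_edge G x \<in> S"
    and j: "(src G x, tgt G x) \<in> joined (delete_edges G S)"
  shows "\<exists>c\<in>H1 G. lk c x = (1::int) \<and> (\<forall>y\<in>darts G. dart_edge G y \<in> S \<longrightarrow>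
      dart_edge G y \<noteq> dart_edge G x \<longrightarrow> lk c y = 0)"
proof -
  let ?D = "{x \<in> darts G. dart_edge G x \<notin> S}"
  have "(src G x, tgt G x) \<in> ((\<lambda>x. (src G x, tgt G x)) ` ?D)\<^sup>*" using j by (simp add: joined_def)
  then obtain p :: "'e \<Rightarrow>\<^sub>0 int" where p: "p \<in> chains G" "\<And>y. lk p y \<noteq> 0 \<Longrightarrow> y \<in> ?D \<or> opp G y \<in> ?D"
    "\<And>w. boundary G p w = (1 when w = tgt G x) - (1 when w = src G x)"
    using path_chain[of _ _ ?D] by blast
  have p0: "lk p y = 0" if "y \<in> darts G" "dart_edge G y \<in> S" for y
    using p(2)[of y] that dart_edge_opp[of y] by auto
  let ?c = "dart_chain G x 1 + - p"
  have "?c \<in> chains G" by (intro chains_add chains_uminus p dart_chain_in_chains x)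
  then have "?c \<in> H1 G"
    using p(3) by (simp add: H1_def boundary_add boundary_uminus boundary_dart_chain[OF x(1)] del:
      add_uminus_conv_diff)
  moreover have "lk ?c x = 1"
    using p0[OF x] lookup_dart_chain[OF x(1,1), of "1::int"] opp_neq[OF x(1)]
      by (simp add: lookup_add lookup_minus)
  moreover have "lk ?c y = 0" if "y \<in> darts G" "dart_edge G y \<in> S" "dart_edge G y \<noteq> dart_edge G x"
    for y
  proof -
    have "y \<noteq> x" "y \<noteq> opp G x" using that dart_edge_opp[OF x(1)] by auto
    then show ?thesis using dart_chain_eq_0[of y x "1::int"] p0[OF that(1,2)]
      by (simp add: lookup_minus)
  qed
  ultimately show ?thesis by blast
qed

text \<open>Take the cut around the component of \<open>src G y\<close> left by the deletion. A dart
  of the cut outside \<open>S\<close> would join its two sides.\<close>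

lemma cut_through:
  assumes y: "y \<in> darts G" and j: "(src G y, tgt G y) \<notin> joined (delete_edges G S)"
  shows "\<exists>C\<subseteq>darts G. opp G y \<in> C \<and> (\<forall>z\<in>C. dart_edge G z \<in> S \<and> opp G z \<notin> C) \<and>
    (\<forall>c\<in>(H1 G :: ('e \<Rightarrow>\<^sub>0 'a::linordered_idom) set). (\<Sum>z\<in>C. lk c z) = 0)"
proof -
  interpret D: finite_graph "delete_edges G S" by (rule finite_graph_delete_edges)
  define A where "A = {v \<in> verts G. (src G y, v) \<in> joined (delete_edges G S)}"
  let ?C = "{x \<in> darts G. tgt G x \<in> A \<and> src G x \<notin> A}"
  have AS: "A \<subseteq> verts G" by (auto simp: A_def)
  have refl: "(src G y, src G y) \<in> joined (delete_edges G S)"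
    using src_in[OF y] by (simp add: joined_def)
  have 1: "opp G y \<in> ?C"
    using y opp_in tgt_opp src_opp refl src_in j by (simp add: A_def)
  have 2: "dart_edge G z \<in> S" if z: "z \<in> ?C" for z
  proof (rule ccontr)
    assume "dart_edge G z \<notin> S"
    then have "opp G z \<in> darts (delete_edges G S)" using z opp_in dart_edge_opp by simp
    then have "(tgt G z, src G z) \<in> joined (delete_edges G S)"
      using D.joined_dart[of "opp G z"] z src_opp tgt_opp by simp
    moreover have "trans (joined (delete_edges G S))" using D.equiv_joined by (simp add: equiv_def)
    ultimately have "src G z \<in> A" using z src_in by (auto simp: A_def dest: transD)
    then show False using z by simp
  qed
  have 3: "opp G z \<notin> ?C" if "z \<in> ?C" for z using that src_opp tgt_opp by auto
  have "(\<Sum>z\<in>?C. lk c z) = 0" if "c \<in> H1 G" for c :: "'e \<Rightarrow>\<^sub>0 'a" using H1_cut[OF that AS] .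
  then show ?thesis using 1 2 3 by (intro exI[of _ ?C]) blast
qed

text \<open>A separating edge is a cut by itself, and no cycle flows through it.\<close>

lemma separating_zero:
  fixes c :: "'e \<Rightarrow>\<^sub>0 'a::linordered_idom"
  assumes "x \<in> darts G" "separating G (dart_edge G x)" "c \<in> H1 G"
  shows "lk c x = 0"
proof -
  obtain y where y: "y \<in> darts G" "dart_edge G y = dart_edge G x"
    "(src G y, tgt G y) \<notin> joined (delete_edges G {dart_edge G x})"
    using assms(2) num_components_delete_edges by (auto simp: separating_def)
  obtain C where C: "C \<subseteq> darts G" "opp G y \<in> C" "\<forall>z\<in>C. dart_edge G z \<in> {dart_edge G x} \<and>
      opp G z \<notin> C"
    "(\<Sum>z\<in>C. lk c z) = 0"
    using cut_through[OF y(1,3)] assms(3) by blast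
  have "z = opp G y" if z: "z \<in> C" for z
  proof -
    have "dart_edge G z = dart_edge G y" using C(3) z y(2) by simp
    then have "z = y \<or> z = opp G y" using dart_edge_eq_iff C(1) z y(1) by blast
    moreover have "y \<notin> C" using C(2,3) opp_opp[OF y(1)] by metis
    ultimately show ?thesis using z by blast
  qed
  then have "C = {opp G y}" using C(2) by blast
  then have "lk c y = 0" using C(4) chain_opp[OF H1_chains[OF assms(3)] y(1)] by simp
  moreover have "x = y \<or> x = opp G y" using dart_edge_eq_iff[OF assms(1) y(1)] y(2) by simp
  ultimately show ?thesis using chain_opp[OF H1_chains[OF assms(3)] y(1)] by auto
qed

lemma nonseparating_cycle:
  assumes "x \<in> darts G" "\<not> separating G (dart_edge G x)"
  shows "\<exists>c\<in>H1 G. lk c x = (1::int)"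
proof -
  have "dart_edge G x \<in> edges G" using assms(1) by (auto simp: edges_def)
  then have "(src G x, tgt G x) \<in> joined (delete_edges G {dart_edge G x})"
    using assms num_components_delete_edges[of "{dart_edge G x}"] by (auto simp: separating_def)
  then show ?thesis using cycle_avoiding[OF assms(1)] by blast
qed

text \<open>The cut provided by the deletion consists of darts of these two edges. Each edge lies on
  a cycle, being nonseparating, so neither can form the cut alone; the flows through both
  cancel.\<close>

lemma separating_pair_parallel:
  assumes x: "x \<in> darts G" and y: "y \<in> darts G"
    and sep: "separating_pair G (dart_edge G x) (dart_edge G y)"
  shows "\<exists>s\<in>{1, -1}. \<forall>c\<in>H1 G. lk c x = s * (lk c y :: int)"
proof -
  let ?S = "{dart_edge G x, dart_edge G y}"
  obtain w where w: "w \<in> darts G" "(src G w, tgt G w) \<notin> joined (delete_edges G ?S)"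
    using sep num_components_delete_edges[of ?S] by (auto simp: separating_pair_def)
  obtain C where C: "C \<subseteq> darts G" "opp G w \<in> C" "\<forall>z\<in>C. dart_edge G z \<in> ?S \<and> opp G z \<notin> C"
    "\<forall>c\<in>(H1 G :: ('e \<Rightarrow>\<^sub>0 int) set). (\<Sum>z\<in>C. lk c z) = 0"
    using cut_through[OF w] by blast
  have nx: "\<exists>c\<in>H1 G. lk c x = (1::int)" and ny: "\<exists>c\<in>H1 G. lk c y = (1::int)"
    using nonseparating_cycle x y sep by (auto simp: separating_pair_def)
  have neq: "dart_edge G x \<noteq> dart_edge G y" using sep by (simp add: separating_pair_def)
  have Csub: "C \<subseteq> {x, opp G x, y, opp G y}"
  proof
    fix z assume z: "z \<in> C"
    then have "dart_edge G z = dart_edge G x \<or> dart_edge G z = dart_edge G y" "z \<in> darts G"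
      using C by auto
    then show "z \<in> {x, opp G x, y, opp G y}" using dart_edge_eq_iff x y by blast
  qed
  have cx: "lk c (opp G x) = - lk c x" and cy: "lk c (opp G y) = - lk c y" if "c \<in> H1 G"
    for c :: "'e \<Rightarrow>\<^sub>0 int"
    using that chain_opp H1_chains x y by blast+
  have xn: "x \<noteq> y" "x \<noteq> opp G y" "opp G x \<noteq> y" "opp G x \<noteq> opp G y" "x \<noteq> opp G x" "y \<noteq> opp G y"
    using neq dart_edge_opp x y opp_neq by metis+
  have Cx: "\<not> (x \<in> C \<and> opp G x \<in> C)" and Cy: "\<not> (y \<in> C \<and> opp G y \<in> C)" using C(3) by blast+
  \<comment> \<open>\<open>sx\<close> and \<open>sy\<close> record the direction in which the cut is
    crossed by \<open>x\<close> and \<open>y\<close>, with 0 for an edge outside the cut.\<close>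
  define sx :: int where "sx = (if x \<in> C then 1 else if opp G x \<in> C then -1 else 0)"
  define sy :: int where "sy = (if y \<in> C then 1 else if opp G y \<in> C then -1 else 0)"
  have sum: "sx * lk c x + sy * lk c y = 0" if c: "c \<in> H1 G" for c
  proof -
    have "(\<Sum>z\<in>C. lk c z) = (\<Sum>z\<in>{x, opp G x, y, opp G y}. if z \<in> C then lk c z else 0)"
      using Csub by (simp add: sum.inter_restrict[symmetric] Int_absorb1)
    also have "\<dots> = sx * lk c x + sy * lk c y"
      using xn Cx Cy cx[OF c] cy[OF c] by (auto simp: sx_def sy_def)
    finally show ?thesis using C(4) c by simp
  qed
  have "sx \<noteq> 0 \<or> sy \<noteq> 0" using C(2) Csub by (auto simp: sx_def sy_def)
  moreover have "sx = 0 \<longleftrightarrow> sy = 0"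
  proof
    assume "sx = 0"
    then show "sy = 0" using sum ny by fastforce
  next
    assume "sy = 0"
    then show "sx = 0" using sum nx by fastforce
  qed
  ultimately have s: "sx \<in> {1, -1}" "sy \<in> {1, -1}" by (auto simp: sx_def sy_def split: if_splits)
  have "lk c x = (- sx * sy) * lk c y" if "c \<in> H1 G" for c
    using sum[OF that] s by auto
  moreover have "- sx * sy \<in> {1, -1}" using s by auto
  ultimately show ?thesis by blast
qed

lemma nonseparating_pair_cycle:
  assumes x: "x \<in> darts G" and y: "y \<in> darts G" and "dart_edge G x \<noteq> dart_edge G y"
    and "\<not> separating G (dart_edge G x)" "\<not> separating G (dart_edge G y)"
    and nsep: "\<not> separating_pair G (dart_edge G x) (dart_edge G y)"
  shows "\<exists>c\<in>H1 G. lk c x = 0 \<and> lk c y = (1::int)"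
proof -
  have "dart_edge G x \<in> edges G" "dart_edge G y \<in> edges G" using x y by (auto simp: edges_def)
  then have "(src G y, tgt G y) \<in> joined (delete_edges G {dart_edge G x, dart_edge G y})"
    using assms num_components_delete_edges[of "{dart_edge G x, dart_edge G y}"]
    by (auto simp: separating_pair_def)
  then show ?thesis using cycle_avoiding[OF y, of "{dart_edge G x, dart_edge G y}"] x assms(3)
    by blast
qed

end


section \<open>Circuits and cones in terms of cycles\<close>

text \<open>Chains are antisymmetric, so the darts of an orientation provide independent coordinates
  on them.\<close>

definition orientation :: "('v, 'e) graph \<Rightarrow> 'e set \<Rightarrow> bool" where
  "orientation G D \<longleftrightarrow> D \<subseteq> darts G \<and> (\<forall>x\<in>darts G. x \<in> D \<longleftrightarrow> opp G x \<notin> D)"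

lemma lookup_map_of_int [simp]:
  "lk (Poly_Mapping.map of_int c) x = (of_int (lk c x) :: 'a::ring_1)"
  by (simp add: Poly_Mapping.map.rep_eq when_def)

lemma lookup_scaleR [simp]: "lk (r *\<^sub>R v) x = r *\<^sub>R lk v x"
  by (simp add: scaleR_poly_mapping_def)

text \<open>The norm is the sum of the absolute values and so dominates each coordinate.\<close>

lemma bounded_linear_lookup: "bounded_linear (\<lambda>v :: 'e \<Rightarrow>\<^sub>0 real. lk v x)"
proof (rule bounded_linear_intro[where K = 1])
  fix v :: "'e \<Rightarrow>\<^sub>0 real"
  have "norm v = (\<Sum>y\<in>Poly_Mapping.keys v. \<bar>lk v y\<bar>)"
    by (simp add: norm_poly_mapping_def dist_poly_mapping_def)
  moreover have "\<bar>lk v x\<bar> \<le> (\<Sum>y\<in>Poly_Mapping.keys v. \<bar>lk v y\<bar>)"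
  proof (cases "x \<in> Poly_Mapping.keys v")
    case True
    then show ?thesis using member_le_sum[of x "Poly_Mapping.keys v" "\<lambda>y. \<bar>lk v y\<bar>"] by simp
  next
    case False
    then show ?thesis by (simp add: in_keys_iff sum_nonneg)
  qed
  ultimately show "norm (lk v x) \<le> norm v * 1" by simp
qed (simp_all add: lookup_add)

lemma continuous_on_lookup: "continuous_on S (\<lambda>v :: 'e \<Rightarrow>\<^sub>0 real. lk v x)"
  by (rule linear_continuous_on[OF bounded_linear_lookup])

context finite_graph
begin

lemma ex_orientation: "\<exists>D. orientation G D"
  using exists_orientation by (auto simp: orientation_def)

lemma orientationD:
  assumes "orientation G D"
  shows "D \<subseteq> darts G" "x \<in> darts G \<Longrightarrow> x \<in> D \<or> opp G x \<in> D" "x \<in> D \<Longrightarrow> opp G x \<notin> D"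
  using assms by (auto simp: orientation_def)

lemma orientation_chain_0:
  assumes D: "orientation G D" and c: "c \<in> chains G" and 0: "\<And>x. x \<in> D \<Longrightarrow> lk c x = 0"
  shows "lk c x = 0"
proof (cases "x \<in> darts G")
  case True
  then consider "x \<in> D" | "opp G x \<in> D" using orientationD[OF D] by blast
  then show ?thesis using 0 chain_opp[OF c True] by cases auto
qed (use chain_out[OF c] in blast)

lemma int_lattice_H1: "orientation G D \<Longrightarrow> int_lattice (H1 G) D"
proof
  assume D: "orientation G D"
  show "finite D" using orientationD(1)[OF D] finite_darts finite_subset by blast
  fix c :: "'e \<Rightarrow>\<^sub>0 int" assume "c \<in> H1 G" and 0: "\<And>x. x \<in> D \<Longrightarrow> lk c x = 0"
  then show "c = 0" using orientation_chain_0[OF D H1_chains 0] by (auto intro: poly_mapping_eqI)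
qed (simp_all add: H1_zero H1_add H1_uminus)

lemma unimodular_lattice_H1:
  assumes D: "orientation G D"
  shows "unimodular_lattice (H1 G) D"
proof -
  interpret int_lattice "H1 G" D by (rule int_lattice_H1[OF D])
  show ?thesis
  proof
    fix c :: "'e \<Rightarrow>\<^sub>0 int" assume "c \<in> H1 G" "c \<noteq> 0"
    from conformal_cycle[OF this] obtain u :: "'e \<Rightarrow>\<^sub>0 int" where u: "u \<in> H1 G" "u \<noteq> 0"
      "\<And>x. lk u x \<noteq> 0 \<Longrightarrow> (lk u x = 1 \<and> 0 < lk c x) \<or> (lk u x = -1 \<and> lk c x < 0)" by blast
    have "lk u x \<in> {0, sgn (lk c x)}" for x using u(3)[of x] by (cases "lk u x = 0") auto
    then show "\<exists>u\<in>H1 G. u \<noteq> 0 \<and> (\<forall>i\<in>D. lk u i \<in> {0, sgn (lk c i)})" using u(1,2) by blast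
  qed
qed

lemma simple_lattice_H1:
  assumes D: "orientation G D" and nsep: "\<And>e. \<not> separating G e" "\<And>e f. \<not> separating_pair G e f"
  shows "simple_lattice (H1 G) D"
proof -
  interpret int_lattice "H1 G" D by (rule int_lattice_H1[OF D])
  show ?thesis
  proof
    fix x assume "x \<in> D"
    then have x: "x \<in> darts G" using orientationD(1)[OF D] by blast
    obtain c :: "'e \<Rightarrow>\<^sub>0 int" where "c \<in> H1 G" "lk c x = 1"
      using nonseparating_cycle[OF x nsep(1)] by blast
    then show "\<exists>c\<in>H1 G. lk c x \<noteq> (0::int)" by (intro bexI[of _ c]) auto
  next
    fix x y assume xy: "x \<in> D" "y \<in> D" "x \<noteq> y"
    then have d: "x \<in> darts G" "y \<in> darts G" using orientationD(1)[OF D] by auto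
    have "dart_edge G x \<noteq> dart_edge G y"
      using dart_edge_eq_iff[OF d] xy orientationD(3)[OF D] by metis
    from nonseparating_pair_cycle[OF d this nsep(1) nsep(1) nsep(2)]
    obtain c :: "'e \<Rightarrow>\<^sub>0 int" where "c \<in> H1 G" "lk c x = 0" "lk c y = 1" by blast
    then show "\<exists>c\<in>H1 G. lk c x = 0 \<and> lk c y \<noteq> (0::int)" by (intro bexI[of _ c]) auto
  qed
qed

lemma bij_betw_dart_edge: "orientation G D \<Longrightarrow> bij_betw (dart_edge G) D (edges G)"
  unfolding bij_betw_def
proof
  assume D: "orientation G D"
  show "inj_on (dart_edge G) D"
    using dart_edge_eq_iff orientationD[OF D] by (intro inj_onI) (metis subsetD)
  have "dart_edge G x \<in> dart_edge G ` D" if "x \<in> darts G" for x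
    using orientationD(2)[OF D that] dart_edge_opp[OF that] by (metis imageI)
  then show "dart_edge G ` D = edges G" using orientationD(1)[OF D] by (auto simp: edges_def)
qed

lemma compat_iff_darts:
  assumes D: "orientation G D" and c: "c \<in> chains G" "d \<in> chains G"
  shows "compat D c d \<longleftrightarrow> (\<forall>x\<in>darts G. 0 \<le> lk c x * lk d x)"
proof
  assume *: "compat D c d"
  show "\<forall>x\<in>darts G. 0 \<le> lk c x * lk d x"
  proof
    fix x assume x: "x \<in> darts G"
    then consider "x \<in> D" | "opp G x \<in> D" using orientationD(2)[OF D] by blast
    then show "0 \<le> lk c x * lk d x"
    proof cases
      case 2
      then have "0 \<le> lk c (opp G x) * lk d (opp G x)" using * by (simp add: compat_def)
      then show ?thesis using chain_opp[OF c(1) x] chain_opp[OF c(2) x] by simp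
    qed (use * in \<open>simp add: compat_def\<close>)
  qed
qed (use orientationD(1)[OF D] in \<open>auto simp: compat_def\<close>)

section \<open>The real fan: common cones in terms of signs\<close>

lemma H1_scaleR: "c \<in> H1 G \<Longrightarrow> r *\<^sub>R c \<in> (H1 G :: ('e \<Rightarrow>\<^sub>0 real) set)"
  by (simp add: H1_def chains_iff boundary_def flip: sum_distrib_left)

lemma H1_map_of_int:
  assumes "c \<in> H1 G"
  shows "Poly_Mapping.map of_int c \<in> (H1 G :: ('e \<Rightarrow>\<^sub>0 real) set)"
proof -
  have "boundary G (Poly_Mapping.map of_int c) v = (of_int (boundary G c v) :: real)" for v
    by (simp add: boundary_def)
  then show ?thesis using assms by (simp add: H1_def chains_iff)
qed

lemma pairing_eq_lookup:
  assumes "v \<in> chains G" "x \<in> darts G"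
  shows "pairing G v (dart_chain G x 1) = lk v x"
proof -
  have "(\<Sum>y\<in>darts G. lk v y * lk (dart_chain G x 1) y) =
      (\<Sum>y\<in>darts G. (if y = x then lk v y else 0) - (if y = opp G x then lk v y else 0))"
    using opp_neq[OF assms(2)]
    by (intro sum.cong) (auto simp: dart_chain_def lookup_minus lookup_single when_def)
  also have "\<dots> = lk v x - lk v (opp G x)"
    using assms(2) finite_darts opp_in[OF assms(2)] by (simp add: sum_subtractf)
  finally show ?thesis using chain_opp[OF assms] by (simp add: pairing_def)
qed

text \<open>Perturbing \<open>c + c'\<close> by a generic cycle gives an interior point of a chamber
  around both. At a separating edge every cycle vanishes, hence the exception.\<close>

lemma ex_sign_generic:
  fixes c c' :: "'e \<Rightarrow>\<^sub>0 int"
  assumes c: "c \<in> H1 G" "c' \<in> H1 G" and *: "\<forall>x\<in>darts G. 0 \<le> lk c x * lk c' x"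
  shows "\<exists>w\<in>H1 G. \<forall>x\<in>darts G. 0 \<le> lk w x * lk c x \<and> 0 \<le> lk w x * lk c' x \<and>
    (lk w x \<noteq> (0::int) \<or> separating G (dart_edge G x))"
proof -
  obtain D where D: "orientation G D" using ex_orientation by blast
  interpret int_lattice "H1 G" D by (rule int_lattice_H1[OF D])
  let ?F = "{x \<in> D. \<not> separating G (dart_edge G x)}"
  have "\<exists>g\<in>H1 G. \<forall>x\<in>?F. lk g x \<noteq> (0::int)"
  proof (rule ex_generic[OF _ zero_mem cmul_mem add_mem])
    show "finite ?F" using finite_E by simp
    fix x assume "x \<in> ?F"
    then have "x \<in> darts G" "\<not> separating G (dart_edge G x)" using orientationD(1)[OF D] by auto
    then obtain c :: "'e \<Rightarrow>\<^sub>0 int" where "c \<in> H1 G" "lk c x = 1" using nonseparating_cycle by blast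
    then show "\<exists>c\<in>H1 G. lk c x \<noteq> (0::int)" by (intro bexI[of _ c]) auto
  qed
  then obtain g :: "'e \<Rightarrow>\<^sub>0 int" where g: "g \<in> H1 G" "\<And>x. x \<in> ?F \<Longrightarrow> lk g x \<noteq> 0" by blast
  obtain w where w: "w \<in> H1 G"
    "\<And>x. x \<in> D \<Longrightarrow> sgn (lk w x) = (if lk (c + c') x = 0 then sgn (lk g x) else sgn (lk (c + c') x))"
    using perturb[OF add_mem[OF c] g(1)] by blast
  have D1: "0 \<le> lk w x * lk c x \<and> 0 \<le> lk w x * lk c' x \<and> (lk w x \<noteq> 0 \<or> separating G (dart_edge G
      x))"
    if x: "x \<in> D" for x
  proof -
    have prod: "0 \<le> lk c x * lk c' x" using * x orientationD(1)[OF D] by blast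
    show ?thesis
    proof (cases "lk (c + c') x = 0")
      case True
      then have "lk c' x = - lk c x" by (simp add: lookup_add)
      then have "lk c x * lk c x \<le> 0" using prod by simp
      then have "lk c x = 0" by (auto simp: mult_le_0_iff)
      then have "lk c x = 0" "lk c' x = 0" using \<open>lk c' x = - lk c x\<close> by simp_all
      moreover have "lk w x = 0 \<Longrightarrow> lk g x = 0" using w(2)[OF x] True by (simp add: sgn_0_0)
      ultimately show ?thesis using g(2)[of x] x by auto
    next
      case False
      then have sgn: "sgn (lk w x) = sgn (lk c x + lk c' x)" using w(2)[OF x]
        by (simp add: lookup_add)
      have "(0 \<le> lk c x \<and> 0 \<le> lk c' x) \<or> (lk c x \<le> 0 \<and> lk c' x \<le> 0)"
        using prod by (auto simp: zero_le_mult_iff)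
      then show ?thesis
      proof
        assume p: "0 \<le> lk c x \<and> 0 \<le> lk c' x"
        then have "0 < lk c x + lk c' x" using False by (simp add: lookup_add)
        then have "0 < lk w x" using sgn by (simp add: sgn_1_pos)
        then show ?thesis using p by simp
      next
        assume p: "lk c x \<le> 0 \<and> lk c' x \<le> 0"
        then have "lk c x + lk c' x < 0" using False by (simp add: lookup_add)
        then have "lk w x < 0" using sgn by (simp add: sgn_1_neg)
        then show ?thesis using p by (simp add: mult_nonpos_nonpos)
      qed
    qed
  qed
  have "0 \<le> lk w x * lk c x \<and> 0 \<le> lk w x * lk c' x \<and> (lk w x \<noteq> 0 \<or> separating G (dart_edge G x))"
    if x: "x \<in> darts G" for x
  proof (cases "x \<in> D")
    case False
    then have "opp G x \<in> D" using orientationD(2)[OF D x] by blast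
    from D1[OF this] show ?thesis
      using chain_opp[OF H1_chains[OF c(1)] x] chain_opp[OF H1_chains[OF c(2)] x]
        chain_opp[OF H1_chains[OF w(1)] x] dart_edge_opp[OF x] by simp
  qed (use D1 in blast)
  then show ?thesis using w(1) by blast
qed

lemma arrangement_complement:
  "H1 G - \<Union>(cographic_arrangement G) =
    {v \<in> H1 G. \<forall>x\<in>darts G. (\<exists>w\<in>H1 G. lk w x \<noteq> (0::real)) \<longrightarrow> lk v x \<noteq> 0}"
proof -
  have pair: "pairing G v (dart_chain G x 1) = lk v x" if "v \<in> H1 G" "x \<in> darts G" for v x
    using pairing_eq_lookup[OF H1_chains[OF that(1)] that(2)] .
  have "v \<in> \<Union>(cographic_arrangement G) \<longleftrightarrow>
      (\<exists>x\<in>darts G. (\<exists>w\<in>H1 G. lk w x \<noteq> (0::real)) \<and> lk v x = 0)" if v: "v \<in> H1 G" for v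
  proof -
    have "v \<in> \<Union>(cographic_arrangement G) \<longleftrightarrow> (\<exists>x\<in>darts G.
        (\<exists>w\<in>H1 G. pairing G w (dart_chain G x 1) \<noteq> 0) \<and> pairing G v (dart_chain G x 1) = 0)"
      using v by (auto simp: cographic_arrangement_def)
    also have "\<dots> \<longleftrightarrow> (\<exists>x\<in>darts G. (\<exists>w\<in>H1 G. lk w x \<noteq> (0::real)) \<and> lk v x = 0)"
      using pair v by (intro bex_cong refl conj_cong) auto
    finally show ?thesis .
  qed
  then show ?thesis by blast
qed

lemma connected_sign:
  fixes C :: "('e \<Rightarrow>\<^sub>0 real) set"
  assumes "connected C" "\<And>v. v \<in> C \<Longrightarrow> lk v x \<noteq> 0" "a \<in> C" "b \<in> C"
  shows "0 < lk a x * lk b x"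
proof (rule ccontr)
  assume "\<not> 0 < lk a x * lk b x"
  then have sgn: "(lk a x \<le> 0 \<and> 0 \<le> lk b x) \<or> (lk b x \<le> 0 \<and> 0 \<le> lk a x)"
    by (auto simp: zero_less_mult_iff not_less)
  have "connected ((\<lambda>v. lk v x) ` C)"
    by (rule connected_continuous_image[OF continuous_on_lookup assms(1)])
  from connected_contains_Icc[OF this imageI[OF assms(3)] imageI[OF assms(4)]]
    connected_contains_Icc[OF this imageI[OF assms(4)] imageI[OF assms(3)]]
  have "{lk a x..lk b x} \<union> {lk b x..lk a x} \<subseteq> (\<lambda>v. lk v x) ` C" by simp
  moreover have "0 \<in> {lk a x..lk b x} \<union> {lk b x..lk a x}" using sgn by auto
  ultimately have "0 \<in> (\<lambda>v. lk v x) ` C" by (rule subsetD)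
  then show False using assms(2) by auto
qed

text \<open>On a component of the complement each coordinate that is not identically zero keeps its
  sign, and the closure inherits it weakly. Conversely, the real cycles with the strict signs of a
  generic point form a convex set, which is a whole component; \<open>c\<close> and
  \<open>c'\<close> enter it by arbitrarily small moves towards that point, hence lie in its
  closure.\<close>

lemma in_common_cone_iff:
  fixes c c' :: "'e \<Rightarrow>\<^sub>0 int"
  assumes c: "c \<in> H1 G" "c' \<in> H1 G"
  shows "in_common_cone G c c' \<longleftrightarrow> (\<forall>x\<in>darts G. 0 \<le> lk c x * lk c' x)"
proof
  let ?U = "H1 G - \<Union>(cographic_arrangement G)"
  assume "in_common_cone G c c'"
  then obtain C F where C: "C \<in> components ?U" and F: "F face_of closure C"
    "Poly_Mapping.map of_int c \<in> F" "Poly_Mapping.map of_int c' \<in> F"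
    by (auto simp: in_common_cone_def cographic_fan_def)
  have cl: "Poly_Mapping.map of_int c \<in> closure C" "Poly_Mapping.map of_int c' \<in> closure C"
    using F face_of_imp_subset by blast+
  have conn: "connected C" using C by (rule in_components_connected)
  have CU: "C \<subseteq> ?U" using C by (rule in_components_subset)
  obtain a where a: "a \<in> C" using C in_components_nonempty by blast
  show "\<forall>x\<in>darts G. 0 \<le> lk c x * lk c' x"
  proof
    fix x assume x: "x \<in> darts G"
    have "0 \<le> lk a x * lk v x" if v: "v \<in> closure C" for v
    proof -
      have "0 \<le> lk a x * lk v x" if v: "v \<in> C" for v
      proof (cases "\<exists>w\<in>H1 G. lk w x \<noteq> (0::real)")
        case True
        then have "lk v x \<noteq> 0" if "v \<in> C" for v using CU that x unfolding arrangement_complement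
          by blast
        then show ?thesis using connected_sign[OF conn _ a v, of x] by force
      next
        case False
        then have "lk v x = 0" using CU v by blast
        then show ?thesis by simp
      qed
      then have "C \<subseteq> {v. 0 \<le> lk a x * lk v x}" by blast
      moreover have "closed {v :: 'e \<Rightarrow>\<^sub>0 real. 0 \<le> lk a x * lk v x}"
        by (intro closed_Collect_le continuous_intros continuous_on_lookup)
      ultimately have "closure C \<subseteq> {v. 0 \<le> lk a x * lk v x}" by (rule closure_minimal)
      then show ?thesis using v by blast
    qed
    from this[OF cl(1)] this[OF cl(2)]
    have ac: "0 \<le> lk a x * real_of_int (lk c x)" "0 \<le> lk a x * real_of_int (lk c' x)" by simp_all
    show "0 \<le> lk c x * lk c' x"
    proof (cases "\<exists>w\<in>H1 G. lk w x \<noteq> (0::real)")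
      case True
      then have "lk a x \<noteq> 0" using CU a x unfolding arrangement_complement by blast
      then show ?thesis using ac by (auto simp: zero_le_mult_iff)
    next
      case False
      then have "lk (Poly_Mapping.map of_int c) x = (0::real)" using H1_map_of_int[OF c(1)] by blast
      then show ?thesis by simp
    qed
  qed
next
  let ?U = "H1 G - \<Union>(cographic_arrangement G)"
  assume *: "\<forall>x\<in>darts G. 0 \<le> lk c x * lk c' x"
  obtain w :: "'e \<Rightarrow>\<^sub>0 int" where w: "w \<in> H1 G"
    "\<And>x. x \<in> darts G \<Longrightarrow> 0 \<le> lk w x * lk c x \<and> 0 \<le> lk w x * lk c' x \<and>
        (lk w x \<noteq> 0 \<or> separating G (dart_edge G x))"
    using ex_sign_generic[OF c *] by blast
  define z where "z = (Poly_Mapping.map of_int w :: 'e \<Rightarrow>\<^sub>0 real)"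
  define N where "N = {x \<in> darts G. \<exists>w\<in>H1 G. lk w x \<noteq> (0::real)}"
  have zH: "z \<in> H1 G" using H1_map_of_int[OF w(1)] by (simp add: z_def)
  have zN: "lk z x \<noteq> 0" if "x \<in> N" for x
    using that w(2)[of x] separating_zero[of x] by (auto simp: N_def z_def)
  have U: "?U = {v \<in> H1 G. \<forall>x\<in>N. lk v x \<noteq> 0}"
    unfolding arrangement_complement N_def by blast
  define Q where "Q = {v \<in> H1 G. \<forall>x\<in>N. 0 < lk v x * lk z x}"
  have zQ: "z \<in> Q" using zH zN by (simp add: Q_def zero_less_mult_iff) (metis
    linorder_neqE_linordered_idom)
  have "convex Q"
  proof (rule convexI)
    fix a b and u v :: real assume ab: "a \<in> Q" "b \<in> Q" and uv: "0 \<le> u" "0 \<le> v" "u + v = 1"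
    have "0 < lk (u *\<^sub>R a + v *\<^sub>R b) x * lk z x" if x: "x \<in> N" for x
    proof -
      have p: "0 < lk a x * lk z x" "0 < lk b x * lk z x" using ab x by (auto simp: Q_def)
      have "lk (u *\<^sub>R a + v *\<^sub>R b) x * lk z x = u * (lk a x * lk z x) + v * (lk b x * lk z x)"
        by (simp add: lookup_add algebra_simps)
      moreover have "0 < u \<or> 0 < v" using uv by linarith
      then have "0 < u * (lk a x * lk z x) + v * (lk b x * lk z x)"
      proof
        assume "0 < u"
        then show ?thesis using p uv by (intro add_pos_nonneg) auto
      next
        assume "0 < v"
        then show ?thesis using p uv by (intro add_nonneg_pos) auto
      qed
      ultimately show ?thesis by simp
    qed
    then show "u *\<^sub>R a + v *\<^sub>R b \<in> Q" using ab by (simp add: Q_def H1_add H1_scaleR)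
  qed
  have QU: "Q \<subseteq> ?U" unfolding U by (auto simp: Q_def)
  define C where "C = connected_component_set ?U z"
  have "Q \<subseteq> C"
    unfolding C_def by (rule connected_component_maximal[OF zQ convex_connected[OF \<open>convex Q\<close>] QU])
  moreover have "C \<subseteq> Q"
  proof
    fix v assume v: "v \<in> C"
    have CU: "C \<subseteq> ?U" unfolding C_def by (rule connected_component_subset)
    have "connected C" unfolding C_def by (rule connected_connected_component)
    moreover have "z \<in> C" using \<open>Q \<subseteq> C\<close> zQ by blast
    ultimately have "0 < lk v x * lk z x" if "x \<in> N" for x
      using connected_sign[of C x v z] v CU that unfolding U by blast
    then show "v \<in> Q" using v CU by (auto simp: Q_def)
  qed
  ultimately have CQ: "C = Q" by blast
  have comp: "C \<in> components ?U" using QU zQ by (auto simp: C_def components_def)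
  have cl: "Poly_Mapping.map of_int d \<in> closure C" if d: "d \<in> H1 G" "\<And>x. x \<in> darts G \<Longrightarrow>
      0 \<le> lk w x * lk d x" for d
    unfolding closure_approachable
  proof (intro allI impI)
    fix e :: real assume e: "0 < e"
    let ?d = "Poly_Mapping.map of_int d :: 'e \<Rightarrow>\<^sub>0 real"
    \<comment> \<open>The move by \<open>t\<close> along \<open>z\<close> is shorter than
      \<open>e\<close>; adding 1 covers the case \<open>z = 0\<close>.\<close>
    define t where "t = e / (norm z + 1)"
    have t: "0 < t" using e by (simp add: t_def add_nonneg_pos)
    have "norm z + 1 \<noteq> 0" using norm_ge_zero[of z] by linarith
    then have "t * (norm z + 1) = e" by (simp add: t_def)
    then have "t * norm z < e" using t by (simp add: distrib_left)
    have "0 < lk (?d + t *\<^sub>R z) x * lk z x" if x: "x \<in> N" for x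
    proof -
      have "0 \<le> real_of_int (lk w x * lk d x)" using d(2)[of x] x
        by (simp add: N_def del: of_int_mult)
      then have "0 \<le> lk ?d x * lk z x" by (simp add: z_def mult.commute)
      moreover have "0 < t * (lk z x * lk z x)" using t zN[OF x] by (simp add: zero_less_mult_iff)
        (metis linorder_neqE_linordered_idom)
      ultimately show ?thesis by (simp add: lookup_add algebra_simps)
    qed
    then have "?d + t *\<^sub>R z \<in> C"
      unfolding CQ using H1_map_of_int[OF d(1)] zH by (simp add: Q_def H1_add H1_scaleR)
    moreover have "dist (?d + t *\<^sub>R z) ?d < e" using t \<open>t * norm z < e\<close> by (simp add: dist_norm)
    ultimately show "\<exists>y\<in>C. dist y ?d < e" by blast
  qed
  have "closure C face_of closure C"
    using \<open>convex Q\<close> CQ by (intro face_of_refl convex_closure) simp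
  moreover have "closure C \<noteq> {}" using zQ CQ by auto
  ultimately have "closure C \<in> cographic_fan G"
    unfolding cographic_fan_def using comp by blast
  then show "in_common_cone G c c'"
    unfolding in_common_cone_def using cl c w(2) by blast
qed

section \<open>Cyclic subgraphs and minimal supports\<close>

lemma subgraph_H1:
  assumes "subgraph H G"
  shows "(H1 H :: ('e \<Rightarrow>\<^sub>0 'c::comm_ring_1) set) = {c \<in> H1 G. Poly_Mapping.keys c \<subseteq> darts H}"
proof -
  from assms obtain W F where H: "H = G\<lparr>verts := W, darts := F\<rparr>" "W \<subseteq> verts G" "F \<subseteq> darts G"
    and fg: "finite_graph H" unfolding subgraph_def by blast
  interpret H: finite_graph H by fact
  have [simp]: "darts H = F" "verts H = W" "opp H = opp G" "tgt H = tgt G" "src H = src G"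
    by (simp_all add: H(1))
  have oppF: "opp G x \<in> F \<longleftrightarrow> x \<in> F" if "x \<in> darts G" for x
    using H.opp_in opp_opp[OF that] by (metis \<open>darts H = F\<close> \<open>opp H = opp G\<close>)
  have chains: "c \<in> chains H \<longleftrightarrow> c \<in> chains G \<and> Poly_Mapping.keys c \<subseteq> F"
    for c :: "'e \<Rightarrow>\<^sub>0 'c::comm_ring_1"
    unfolding chains_iff H.chains_iff using H(3) oppF by (auto simp: in_keys_iff)
  have boundary: "boundary H c v = boundary G c v" if "Poly_Mapping.keys c \<subseteq> F"
    for c :: "'e \<Rightarrow>\<^sub>0 'c::comm_ring_1" and v
    unfolding boundary_def using that H(3) finite_darts
    by (intro sum.mono_neutral_left) (auto simp: in_keys_iff)
  have out: "boundary H c v = 0" if "v \<notin> W" for c :: "'e \<Rightarrow>\<^sub>0 'c::comm_ring_1" and v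
    unfolding boundary_def using that H.tgt_in by (intro sum.neutral) auto
  show ?thesis
  proof (rule Set.set_eqI)
    fix c :: "'e \<Rightarrow>\<^sub>0 'c::comm_ring_1"
    show "c \<in> H1 H \<longleftrightarrow> c \<in> {c \<in> H1 G. Poly_Mapping.keys c \<subseteq> darts H}"
    proof (cases "Poly_Mapping.keys c \<subseteq> F")
      case True
      \<comment> \<open>No dart of \<open>F\<close> ends outside \<open>W\<close>, so the cycle
        condition at the extra vertices of \<open>G\<close> holds by itself.\<close>
      have "boundary G c v = 0 \<or> v \<in> W" for v using out[of v c] boundary[OF True, of v] by auto
      then have "(\<forall>v\<in>verts G. boundary G c v = 0) \<longleftrightarrow> (\<forall>v\<in>W. boundary G c v = 0)" using H(2) by blast
      then show ?thesis using True chains boundary[OF True] by (simp add: H1_def)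
    next
      case False
      then show ?thesis using chains by (auto simp: H1_def)
    qed
  qed
qed

lemma keys_subset_iff_support:
  assumes D: "orientation G D" and "c \<in> chains G" "d \<in> chains G"
  shows "Poly_Mapping.keys c \<subseteq> Poly_Mapping.keys d \<longleftrightarrow> support D c \<subseteq> support D d"
proof
  assume "Poly_Mapping.keys c \<subseteq> Poly_Mapping.keys d"
  then show "support D c \<subseteq> support D d" by (auto simp: support_def in_keys_iff subset_iff)
next
  assume *: "support D c \<subseteq> support D d"
  show "Poly_Mapping.keys c \<subseteq> Poly_Mapping.keys d"
  proof
    fix x assume x: "x \<in> Poly_Mapping.keys c"
    then have xd: "x \<in> darts G" using assms(2) by (auto simp: chains_def)
    consider "x \<in> D" | "opp G x \<in> D" using orientationD(2)[OF D xd] by blast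
    then show "x \<in> Poly_Mapping.keys d"
      using * x chain_opp[OF assms(2) xd] chain_opp[OF assms(3) xd]
      by cases (auto simp: support_def in_keys_iff subset_iff)
  qed
qed

lemma dart_edge_support:
  assumes D: "orientation G D" and "c \<in> chains G"
  shows "dart_edge G ` support D c = dart_edge G ` Poly_Mapping.keys c"
proof
  show "dart_edge G ` support D c \<subseteq> dart_edge G ` Poly_Mapping.keys c"
    by (auto simp: support_def in_keys_iff)
  show "dart_edge G ` Poly_Mapping.keys c \<subseteq> dart_edge G ` support D c"
  proof (rule image_subsetI)
    fix x assume x: "x \<in> Poly_Mapping.keys c"
    then have xd: "x \<in> darts G" using assms(2) by (auto simp: chains_def)
    consider "x \<in> D" | "opp G x \<in> D" using orientationD(2)[OF D xd] by blast
    then show "dart_edge G x \<in> dart_edge G ` support D c"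
    proof cases
      case 1
      then show ?thesis using x by (auto simp: support_def in_keys_iff)
    next
      case 2
      then have "opp G x \<in> support D c"
        using x chain_opp[OF assms(2) xd] by (simp add: support_def in_keys_iff)
      then show ?thesis using dart_edge_opp[OF xd] by (metis imageI)
    qed
  qed
qed

text \<open>All real cycles are multiples of one cycle, which is nonzero at every dart because each
  nonseparating edge lies on some cycle.\<close>

lemma keys_eq_darts_of_dim_1:
  assumes nsep: "\<And>e. \<not> separating G e" and dim: "betti1 G = 1"
    and c: "(c :: 'e \<Rightarrow>\<^sub>0 int) \<in> H1 G" "c \<noteq> 0"
  shows "Poly_Mapping.keys c = darts G"
proof -
  obtain B where B: "B \<subseteq> (H1 G :: ('e \<Rightarrow>\<^sub>0 real) set)" "H1 G \<subseteq> span B" "card B = 1"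
    using basis_exists[of "H1 G :: ('e \<Rightarrow>\<^sub>0 real) set"] dim unfolding betti1_def by metis
  then obtain b where b: "B = {b}" by (auto simp: card_1_singleton_iff)
  have mult: "\<exists>k. v = k *\<^sub>R b" if "v \<in> H1 G" for v
    using B(2) that unfolding b span_singleton by blast
  obtain k where k: "Poly_Mapping.map of_int c = k *\<^sub>R b" using mult[OF H1_map_of_int[OF c(1)]]
    by blast
  have lkc: "real_of_int (lk c x) = k * lk b x" for x
    using arg_cong[OF k, of "\<lambda>v. lk v x"] by simp
  have "k \<noteq> 0" using lkc c(2) by (metis mult_zero_left of_int_eq_0_iff poly_mapping_eqI lookup_zero)
  moreover have "lk b x \<noteq> 0" if x: "x \<in> darts G" for x
  proof -
    obtain d :: "'e \<Rightarrow>\<^sub>0 int" where d: "d \<in> H1 G" "lk d x = 1" using nonseparating_cycle[OF x nsep]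
      by blast
    obtain l where l: "Poly_Mapping.map of_int d = l *\<^sub>R b" using mult[OF H1_map_of_int[OF d(1)]]
      by blast
    have "1 = l * lk b x" using arg_cong[OF l, of "\<lambda>v. lk v x"] d(2) by simp
    then show ?thesis by auto
  qed
  ultimately have "lk c x \<noteq> 0" if "x \<in> darts G" for x using lkc[of x] that by auto
  then show ?thesis using H1_chains[OF c(1)] by (auto simp: chains_def in_keys_iff)
qed

text \<open>A cyclic subgraph carries one cycle up to scaling, and every nonzero cycle in it uses
  all its darts, so its support is minimal. Conversely, the darts of an element of minimal support
  form a subgraph in which restricting the cycle to a component, or clearing one of its coordinates,
  would produce a smaller support.\<close>

lemma circuits_eq:
  assumes D: "orientation G D"
  shows "circuits G = (`) (dart_edge G) ` min_supports (H1 G) D"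
proof (intro Set.set_eqI iffI)
  fix X assume "X \<in> circuits G"
  then obtain H where H: "subgraph H G" "cyclic_graph H" "X = edges H" unfolding circuits_def
    by blast
  interpret H: finite_graph H using H(1) by (simp add: subgraph_def)
  have dH: "dart_edge H = dart_edge G" "darts H \<subseteq> darts G"
    using H(1) by (auto simp: subgraph_def dart_edge_def[abs_def])
  have nsep: "\<And>e. \<not> separating H e" and betti: "betti1 H = 1" using H(2)
    by (auto simp: cyclic_graph_def)
  note full = H.keys_eq_darts_of_dim_1[OF nsep betti]
  have "H1 H \<noteq> {0 :: 'e \<Rightarrow>\<^sub>0 real}"
  proof
    assume "H1 H = {0 :: 'e \<Rightarrow>\<^sub>0 real}"
    moreover have "dim {0 :: 'e \<Rightarrow>\<^sub>0 real} = 0" by (rule dim_unique[of "{}"]) (auto simp: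
      real_vector.independent_empty)
    ultimately show False using betti unfolding betti1_def by simp
  qed
  \<comment> \<open>The Betti number gives a nonzero real cycle; its conformal part is an integral
    one.\<close>
  then obtain r :: "'e \<Rightarrow>\<^sub>0 real" where "r \<in> H1 H" "r \<noteq> 0" using H.H1_zero by blast
  from H.conformal_cycle[OF this] obtain u :: "'e \<Rightarrow>\<^sub>0 int" where u: "u \<in> H1 H" "u \<noteq> 0" by blast
  have ku: "Poly_Mapping.keys u = darts H" by (rule full[OF u])
  have uG: "u \<in> H1 G" using u(1) unfolding subgraph_H1[OF H(1)] by blast
  have "support D u \<in> min_supports (H1 G) D"
    unfolding min_supports_def
  proof (rule CollectI, intro conjI ballI impI)
    show "support D u \<in> support D ` (H1 G - {0})" using uG u(2) by blast
    fix S assume "S \<in> support D ` (H1 G - {0})" "S \<subseteq> support D u"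
    then obtain d where d: "d \<in> H1 G" "d \<noteq> 0" "S = support D d" "support D d \<subseteq> support D u" by blast
    have "Poly_Mapping.keys d \<subseteq> darts H"
      using keys_subset_iff_support[OF D H1_chains[OF d(1)] H1_chains[OF uG]] d(4) ku by blast
    then have "d \<in> H1 H" unfolding subgraph_H1[OF H(1)] using d(1) by blast
    then have "Poly_Mapping.keys d = Poly_Mapping.keys u" using full d(2) ku by blast
    then show "S = support D u" unfolding d(3) by (auto simp: support_def set_eq_iff in_keys_iff)
  qed
  moreover have "X = dart_edge G ` support D u"
    unfolding dart_edge_support[OF D H1_chains[OF uG]] ku H(3) edges_def dH(1) ..
  ultimately show "X \<in> (`) (dart_edge G) ` min_supports (H1 G) D" by blast
next
  fix X assume "X \<in> (`) (dart_edge G) ` min_supports (H1 G) D"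
  then obtain C where "X = dart_edge G ` C" "C \<in> min_supports (H1 G) D" by blast
  then obtain c :: "'e \<Rightarrow>\<^sub>0 int" where c: "c \<in> H1 G" "c \<noteq> 0" "X = dart_edge G ` support D c"
    and min0: "\<And>S. S \<in> support D ` (H1 G - {0}) \<Longrightarrow> S \<subseteq> support D c \<Longrightarrow> S = support D c"
    unfolding min_supports_def by blast
  note cc = H1_chains[OF c(1)]
  let ?F = "Poly_Mapping.keys c"
  have min: "Poly_Mapping.keys d = ?F" if "d \<in> H1 G" "d \<noteq> 0" "Poly_Mapping.keys d \<subseteq> ?F"
    for d :: "'e \<Rightarrow>\<^sub>0 int"
  proof -
    have "support D d = support D c"
      by (rule min0) (use that keys_subset_iff_support[OF D H1_chains[OF that(1)] cc] in blast)+
    then show ?thesis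
      using keys_subset_iff_support[OF D H1_chains[OF that(1)] cc]
        keys_subset_iff_support[OF D cc H1_chains[OF that(1)]] by blast
  qed
  have F: "?F \<subseteq> darts G" using cc by (simp add: chains_def)
  have Fopp: "opp G x \<in> ?F" if "x \<in> ?F" for x
    using that F chain_opp[OF cc, of x] by (auto simp: in_keys_iff subset_iff)
  \<comment> \<open>Only end points of the darts are kept, since an isolated vertex would be a
    component of its own.\<close>
  define W where "W = src G ` ?F"
  have WV: "W \<subseteq> verts G" using F src_in by (auto simp: W_def)
  have tgtW: "tgt G x \<in> W" if "x \<in> ?F" for x
    using Fopp[OF that] src_opp[of x] that F unfolding W_def by (metis imageI subsetD)
  define H where "H = G\<lparr>verts := W, darts := ?F\<rparr>"
  have [simp]: "darts H = ?F" "verts H = W" "opp H = opp G" "tgt H = tgt G" "src H = src G"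
    by (simp_all add: H_def)
  have dH: "dart_edge H = dart_edge G" by (auto simp: dart_edge_def[abs_def])
  have fg: "finite_graph H"
  proof
    show "finite (verts H)" by (simp add: W_def)
    show "src H x \<in> verts H" if "x \<in> darts H" for x using that by (simp add: W_def)
  qed (use F Fopp tgtW opp_opp opp_neq src_eq_tgt_opp in auto)
  interpret H: finite_graph H by (rule fg)
  have sub: "subgraph H G" unfolding subgraph_def using fg WV F H_def by blast
  note H1H = subgraph_H1[OF sub]
  have cH: "c \<in> H1 H" unfolding H1H using c(1) by simp
  have Fne: "?F \<noteq> {}" using c(2) by simp
  have conn: "num_components H = 1"
  proof -
    obtain x0 where x0: "x0 \<in> ?F" using Fne by blast
    \<comment> \<open>The restriction \<open>d\<close> of \<open>c\<close> to the component
      \<open>A\<close> is again a cycle; by minimality it has all the darts of \<open>c\<close>, so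
      the component is everything.\<close>
    define A where "A = {v \<in> W. (src G x0, v) \<in> joined H}"
    have x0A: "src G x0 \<in> A" using H.equiv_joined x0 by (auto simp: A_def W_def equiv_def
      refl_on_def)
    have AS: "tgt G x \<in> A \<longleftrightarrow> src G x \<in> A" if x: "x \<in> ?F" for x
    proof -
      have "(src G x, tgt G x) \<in> joined H" using H.joined_dart[of x] x by simp
      moreover have "sym (joined H)" "trans (joined H)" using H.equiv_joined
        by (auto simp: equiv_def)
      ultimately show ?thesis using x tgtW by (auto simp: A_def W_def dest: symD transD)
    qed
    define d :: "'e \<Rightarrow>\<^sub>0 int" where "d = (\<Sum>x\<in>{x \<in> ?F. src G x \<in> A}. Poly_Mapping.single x (lk c x))"
    have lkd: "lk d x = (if src G x \<in> A then lk c x else 0)" for x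
    proof -
      have "lk d x = (\<Sum>y\<in>{x \<in> ?F. src G x \<in> A}. if y = x then lk c y else 0)"
        unfolding d_def lookup_sum by (intro sum.cong) (auto simp: lookup_single when_def)
      then show ?thesis by (auto simp: in_keys_iff)
    qed
    have "d \<in> chains G"
      unfolding chains_iff lkd
    proof (intro conjI allI impI ballI)
      fix x assume x: "x \<in> darts G"
      show "(if src G (opp G x) \<in> A then lk c (opp G x) else 0) = - (if src G x \<in> A then lk c x
          else 0)"
      proof (cases "x \<in> ?F")
        case True
        then show ?thesis using AS[OF True] src_opp[OF x] chain_opp[OF cc x] by simp
      next
        case False
        then show ?thesis using chain_opp[OF cc x] by (simp add: in_keys_iff)
      qed
    qed (use chain_out[OF cc] in simp)
    moreover have "boundary G d v = 0" if v: "v \<in> verts G" for v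
    proof -
      have "boundary G d v = (\<Sum>x | x \<in> darts G \<and> tgt G x = v. if v \<in> A then lk c x else 0)"
        unfolding boundary_def lkd using AS by (intro sum.cong) (auto simp: in_keys_iff)
      also have "\<dots> = (if v \<in> A then boundary G c v else 0)" by (simp add: boundary_def)
      also have "\<dots> = 0" using H1_boundary[OF c(1) v] by simp
      finally show ?thesis .
    qed
    ultimately have dH1: "d \<in> H1 G" by (simp add: H1_def)
    have "lk d x0 \<noteq> 0" using x0A x0 by (simp add: lkd in_keys_iff)
    then have "d \<noteq> 0" by auto
    moreover have "Poly_Mapping.keys d \<subseteq> ?F" by (auto simp: in_keys_iff lkd split: if_splits)
    ultimately have "Poly_Mapping.keys d = ?F" using min[OF dH1] by blast
    then have "src G x \<in> A" if "x \<in> ?F" for x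
      using that by (auto simp: in_keys_iff lkd set_eq_iff split: if_splits)
    then have "W \<subseteq> A" by (auto simp: W_def)
    then have "joined H `` {src G x0} = W" using H.equiv_joined by (auto simp: A_def joined_def)
    moreover have "joined H `` {v} = joined H `` {src G x0}" if "v \<in> W" for v
    proof (rule equiv_class_eq[OF H.equiv_joined])
      have "(src G x0, v) \<in> joined H" using that \<open>W \<subseteq> A\<close> by (auto simp: A_def)
      then show "(v, src G x0) \<in> joined H" using H.equiv_joined by (auto simp: equiv_def dest: symD)
    qed
    ultimately have "W // joined H = {W}"
      using x0 unfolding quotient_def W_def by blast
    then show ?thesis by (simp add: num_components_def)
  qed
  have nsep: "\<not> separating H e" for e
  proof
    assume sep: "separating H e"
    then obtain x where x: "x \<in> ?F" "e = dart_edge H x" by (auto simp: separating_def edges_def)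
    then have "lk c x = 0" using H.separating_zero[of x c] sep cH by simp
    then show False using x by (simp add: in_keys_iff)
  qed
  have betti: "betti1 H = 1"
    unfolding betti1_def
  proof (rule dim_unique)
    let ?c = "Poly_Mapping.map of_int c :: 'e \<Rightarrow>\<^sub>0 real"
    show "{?c} \<subseteq> H1 H" using H.H1_map_of_int[OF cH] by simp
    obtain x0 where x0: "x0 \<in> ?F" using Fne by blast
    then have cx0: "lk ?c x0 \<noteq> 0" by (simp add: in_keys_iff)
    then have "?c \<noteq> 0" by (metis lookup_zero)
    then show "independent {?c}" by simp
    show "card {?c} = 1" by simp
    show "H1 H \<subseteq> span {?c}"
    proof
      fix d :: "'e \<Rightarrow>\<^sub>0 real" assume d: "d \<in> H1 H"
      \<comment> \<open>The multiple of \<open>c\<close> is chosen to clear the coordinate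
        \<open>x0\<close>. A nonzero remainder would have an integral conformal part supported in
        \<open>c\<close> but missing \<open>x0\<close>.\<close>
      define e where "e = d + (- (lk d x0 / lk ?c x0)) *\<^sub>R ?c"
      have eH: "e \<in> H1 H" unfolding e_def by (intro H.H1_add d H.H1_scaleR H.H1_map_of_int cH)
      have ex0: "lk e x0 = 0" unfolding e_def lookup_add lookup_scaleR using cx0 by simp
      have "e = 0"
      proof (rule ccontr)
        assume "e \<noteq> 0"
        from H.conformal_cycle[OF eH this] obtain u :: "'e \<Rightarrow>\<^sub>0 int" where u: "u \<in> H1 H" "u \<noteq> 0"
          "\<And>x. lk u x \<noteq> 0 \<Longrightarrow> lk e x \<noteq> 0" by fastforce
        then have "u \<in> H1 G" "Poly_Mapping.keys u \<subseteq> ?F" unfolding H1H by auto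
        then have "Poly_Mapping.keys u = ?F" using min u(2) by blast
        then have "lk u x0 \<noteq> 0" using x0 by (auto simp: in_keys_iff set_eq_iff)
        then show False using u(3) ex0 by blast
      qed
      then have "d = (lk d x0 / lk ?c x0) *\<^sub>R ?c" by (simp add: e_def add_eq_0_iff2)
      then show "d \<in> span {?c}" unfolding span_singleton by blast
    qed
  qed
  have "edges H = X"
    unfolding edges_def dH c(3) dart_edge_support[OF D cc] by simp
  then show "X \<in> circuits G" unfolding circuits_def using sub conn nsep betti
    by (auto simp: cyclic_graph_def)
qed

end


section \<open>Contraction and the main theorem\<close>

lemma darts_contract [simp]:
  "darts (contract G x) = darts G - dart_edge G x" "opp (contract G x) = opp G"
  "verts (contract G x) = (\<lambda>v. if v = tgt G x then src G x else v) ` verts G"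
  "src (contract G x) y = (if src G y = tgt G x then src G x else src G y)"
  "tgt (contract G x) y = (if tgt G y = tgt G x then src G x else tgt G y)"
  by (simp_all add: contract_def Let_def)

lemma dart_edge_contract [simp]: "dart_edge (contract G x) = dart_edge G"
  by (simp add: dart_edge_def[abs_def])

text \<open>Contraction of an edge acts on cycles by forgetting its two darts.\<close>

definition drop_keys :: "'i set \<Rightarrow> ('i \<Rightarrow>\<^sub>0 'a::comm_monoid_add) \<Rightarrow> ('i \<Rightarrow>\<^sub>0 'a)" where
  "drop_keys S c = (\<Sum>y\<in>Poly_Mapping.keys c - S. Poly_Mapping.single y (lk c y))"

lemma lookup_drop_keys [simp]: "lk (drop_keys S c) y = (if y \<in> S then 0 else lk c y)"
proof -
  have "lk (drop_keys S c) y = (\<Sum>z\<in>Poly_Mapping.keys c - S. if z = y then lk c z else 0)"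
    unfolding drop_keys_def lookup_sum by (intro sum.cong) (auto simp: lookup_single when_def)
  then show ?thesis by (auto simp: in_keys_iff)
qed

lemma drop_keys_add: "drop_keys S (c + d) = drop_keys S c + drop_keys S d"
  by (rule poly_mapping_eqI) (simp add: lookup_add)

abbreviation ring_equiv :: "'k::field itself \<Rightarrow> ('v, 'e) graph \<Rightarrow> ('w, 'f) graph \<Rightarrow> bool" where
  "ring_equiv K G H \<equiv> (cographic_ring G :: (('e \<Rightarrow>\<^sub>0 int) \<Rightarrow>\<^sub>0 'k) ring) \<simeq>
     (cographic_ring H :: (('f \<Rightarrow>\<^sub>0 int) \<Rightarrow>\<^sub>0 'k) ring)"

section \<open>Loops, and the effect of a contraction on cycles\<close>

context finite_graph
begin

lemma circuits_sub: "X \<in> circuits G \<Longrightarrow> X \<subseteq> edges G"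
  by (auto simp: circuits_def subgraph_def edges_def dart_edge_def)

lemma loop_cycle:
  assumes "x \<in> darts G" "src G x = tgt G x"
  shows "dart_chain G x (a::'a::comm_ring_1) \<in> H1 G"
  using assms dart_chain_in_chains by (simp add: H1_def boundary_dart_chain)

text \<open>A loop is itself a cycle, nonzero at \<open>x\<close>.\<close>

lemma separating_not_loop:
  assumes "x \<in> darts G" "separating G (dart_edge G x)"
  shows "src G x \<noteq> tgt G x"
proof
  assume "src G x = tgt G x"
  then have "lk (dart_chain G x (1::int)) x = 0"
    using separating_zero[OF assms loop_cycle[OF assms(1)]] by simp
  then show False using lookup_dart_chain[OF assms(1,1), of "1::int"] opp_neq[OF assms(1)] by simp
qed

text \<open>A loop is a cycle that is nonzero at \<open>x\<close> and zero at \<open>y\<close>,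
  against the proportionality of the two coordinates.\<close>

lemma separating_pair_not_loop:
  assumes "x \<in> darts G" "y \<in> darts G" "separating_pair G (dart_edge G x) (dart_edge G y)"
  shows "src G x \<noteq> tgt G x"
proof
  assume loop: "src G x = tgt G x"
  obtain s :: int where "\<forall>c\<in>H1 G. lk c x = s * lk c y"
    using separating_pair_parallel[OF assms] by blast
  then have eq: "lk (dart_chain G x (1::int)) x = s * lk (dart_chain G x 1) y"
    using loop_cycle[OF assms(1) loop] by blast
  have "dart_edge G y \<noteq> dart_edge G x" using assms(3) by (auto simp: separating_pair_def)
  then have "y \<noteq> x" "y \<noteq> opp G x" using dart_edge_opp[OF assms(1)] by auto
  then have "lk (dart_chain G x (1::int)) y = 0" by (rule dart_chain_eq_0)
  then show False
    using eq lookup_dart_chain[OF assms(1,1), of "1::int"] opp_neq[OF assms(1)] by simp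
qed

context
  fixes x
  assumes x: "x \<in> darts G"
begin

lemma mem_dart_edge_opp: "y \<in> darts G \<Longrightarrow> opp G y \<in> dart_edge G x \<longleftrightarrow> y \<in> dart_edge G x"
  unfolding dart_edge_def insert_iff empty_iff using opp_eq_iff[OF _ x] opp_opp[OF x] opp_opp[of
    y] by metis

lemma finite_graph_contract: "finite_graph (contract G x)"
proof
  fix y assume "y \<in> darts (contract G x)"
  then have y: "y \<in> darts G" "y \<notin> dart_edge G x" by auto
  show "opp (contract G x) y \<in> darts (contract G x)"
    using y opp_in mem_dart_edge_opp by simp
  show "src (contract G x) y \<in> verts (contract G x)" using src_in[OF y(1)] by simp
  show "tgt (contract G x) y \<in> verts (contract G x)" using tgt_in[OF y(1)] by simp
  show "src (contract G x) y = tgt (contract G x) (opp (contract G x) y)"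
    using src_eq_tgt_opp[OF y(1)] by simp
qed (use finite_verts finite_darts opp_opp opp_neq in auto)

lemma chains_contract:
  "c \<in> chains (contract G x) \<longleftrightarrow> c \<in> chains G \<and> (\<forall>y\<in>dart_edge G x. lk c y = 0)"
proof -
  interpret H: finite_graph "contract G x" by (rule finite_graph_contract)
  have sub: "dart_edge G x \<subseteq> darts G" using x opp_in by (simp add: dart_edge_def)
  show ?thesis
    unfolding chains_iff H.chains_iff using sub mem_dart_edge_opp
    by (auto; metis DiffI minus_zero)
qed

lemma drop_chain: "c \<in> chains G \<Longrightarrow> drop_keys (dart_edge G x) c \<in> chains (contract G x)"
  unfolding chains_contract chains_iff using mem_dart_edge_opp by simp

text \<open>The merged vertex \<open>src G x\<close> collects the boundary of both ends, where the
  values at the two forgotten darts cancel. No dart ends at \<open>tgt G x\<close> any more.\<close>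

lemma boundary_drop:
  assumes c: "c \<in> chains G" and nl: "src G x \<noteq> tgt G x"
  shows "boundary (contract G x) (drop_keys (dart_edge G x) c) v =
    (if v = src G x then boundary G c (src G x) + boundary G c (tgt G x) else
     if v = tgt G x then 0 else boundary G c v)"
proof -
  let ?d = "drop_keys (dart_edge G x) c" and ?T = "\<lambda>w. {y \<in> darts G. tgt G y = w}"
  have fin: "finite (?T w)" for w using finite_darts by simp
  have d: "(\<Sum>y\<in>?T w. lk ?d y) = boundary G c w - (if w = tgt G x then lk c x else 0) -
     (if w = src G x then lk c (opp G x) else 0)" for w
  proof -
    have "(\<Sum>y\<in>?T w. lk ?d y) = (\<Sum>y\<in>?T w. lk c y - (if y = x then lk c y else 0) - (if y
        = opp G x then lk c y else 0))"
      using opp_neq[OF x] by (intro sum.cong) (auto simp: dart_edge_def)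
    also have "\<dots> = boundary G c w - (\<Sum>y\<in>?T w. if y = x then lk c y else 0) - (\<Sum>y\<in>?T w.
        if y = opp G x then lk c y else 0)"
      by (simp add: sum_subtractf boundary_def)
    also have "\<dots> = boundary G c w - (if w = tgt G x then lk c x else 0) - (if w
        = src G x then lk c (opp G x) else 0)"
      using fin x opp_in[OF x] tgt_opp[OF x] by (simp add: eq_commute[of w])
    finally show ?thesis .
  qed
  let ?H = "{y \<in> darts (contract G x). tgt (contract G x) y = v}"
  consider (s) "v = src G x" | (t) "v = tgt G x" | (o) "v \<noteq> src G x" "v \<noteq> tgt G x" by blast
  then show ?thesis
  proof cases
    case s
    have "boundary (contract G x) ?d v = (\<Sum>y\<in>?T (src G x) \<union> ?T (tgt G x). lk ?d y)"
      unfolding boundary_def using finite_darts s by (intro sum.mono_neutral_left) (auto split: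
        if_splits)
    also have "\<dots> = (\<Sum>y\<in>?T (src G x). lk ?d y) + (\<Sum>y\<in>?T (tgt G x). lk ?d y)"
      using fin nl by (intro sum.union_disjoint) auto
    also have "\<dots> = boundary G c (src G x) + boundary G c (tgt G x)"
      unfolding d using nl chain_opp[OF c x] by simp
    finally show ?thesis using s by simp
  next
    case t
    then have "?H = {}" using nl by auto
    then show ?thesis using t nl unfolding boundary_def by (simp only: sum.empty) simp
  next
    case o
    have "boundary (contract G x) ?d v = (\<Sum>y\<in>?T v. lk ?d y)"
      unfolding boundary_def using finite_darts o by (intro sum.mono_neutral_left) (auto split:
        if_splits)
    then show ?thesis unfolding d using o by simp
  qed
qed

text \<open>A cycle of the contraction extends in exactly one way: the balance at
  \<open>tgt G x\<close> dictates the value at \<open>x\<close>. A loop would be free to take any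
  value.\<close>

lemma bij_betw_drop_keys:
  assumes nl: "src G x \<noteq> tgt G x"
  shows "bij_betw (drop_keys (dart_edge G x)) (H1 G) (H1 (contract G x) :: ('e \<Rightarrow>\<^sub>0
      'a::comm_ring_1) set)"
proof -
  let ?R = "drop_keys (dart_edge G x) :: ('e \<Rightarrow>\<^sub>0 'a) \<Rightarrow> _"
  have into: "?R c \<in> H1 (contract G x)" if c: "c \<in> H1 G" for c
  proof -
    have "boundary (contract G x) (?R c) v = 0" if "v \<in> verts (contract G x)" for v
    proof -
      have "v \<in> verts G" using that src_in[OF x] by (auto split: if_splits)
      then show ?thesis
        unfolding boundary_drop[OF H1_chains[OF c] nl] using H1_boundary[OF c] src_in[OF x]
          tgt_in[OF x] by simp
    qed
    then show ?thesis using drop_chain[OF H1_chains[OF c]] by (simp add: H1_def)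
  qed
  have inj: "c = d" if cd: "c \<in> H1 G" "d \<in> H1 G" "?R c = ?R d" for c d
  proof -
    have eq: "lk c y = lk d y" if "y \<notin> dart_edge G x" for y
      using arg_cong[OF cd(3), of "\<lambda>f. lk f y"] that by simp
    have e: "c + - d \<in> H1 G" using cd H1_add H1_uminus by blast
    have "0 = boundary G (c + - d) (tgt G x)" using H1_boundary[OF e tgt_in[OF x]] by simp
    also have "\<dots> = (\<Sum>y | y \<in> darts G \<and> tgt G y = tgt G x. if y = x then lk c x - lk d x else 0)"
      unfolding boundary_def
    proof (intro sum.cong refl)
      fix y assume y: "y \<in> {y \<in> darts G. tgt G y = tgt G x}"
      then have "y \<noteq> opp G x" using tgt_opp[OF x] nl by auto
      then show "lk (c + - d) y = (if y = x then lk c x - lk d x else 0)"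
        using eq[of y] by (auto simp: lookup_add lookup_minus dart_edge_def)
    qed
    also have "\<dots> = lk c x - lk d x" using x finite_darts by simp
    finally have eqx: "lk c x = lk d x" by simp
    show "c = d"
    proof (rule poly_mapping_eqI)
      fix y
      consider "y \<notin> dart_edge G x" | "y = x" | "y = opp G x" by (auto simp: dart_edge_def)
      then show "lk c y = lk d y"
        using eq[of y] eqx chain_opp[OF H1_chains[OF cd(1)] x] chain_opp[OF H1_chains[OF cd(2)] x]
        by cases auto
    qed
  qed
  have surj: "c' \<in> ?R ` H1 G" if c': "c' \<in> H1 (contract G x)" for c'
  proof -
    interpret H: finite_graph "contract G x" by (rule finite_graph_contract)
    have ch: "c' \<in> chains G" "\<forall>y\<in>dart_edge G x. lk c' y = 0"
      using H.H1_chains[OF c'] unfolding chains_contract by auto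
    have R': "?R c' = c'" using ch(2) by (intro poly_mapping_eqI) simp
    note bd = boundary_drop[OF ch(1) nl, unfolded R']
    \<comment> \<open>The excess of \<open>c'\<close> at \<open>tgt G x\<close>, to be carried off
      along \<open>x\<close>; the balance at the merged vertex then gives the one at
      \<open>src G x\<close>.\<close>
    define b where "b = boundary G c' (tgt G x)"
    let ?c = "c' + - dart_chain G x b"
    have cc: "?c \<in> chains G" by (intro chains_add chains_uminus ch dart_chain_in_chains x)
    have "boundary G ?c v = 0" if v: "v \<in> verts G" for v
    proof -
      have *: "boundary G ?c v = boundary G c' v - ((b when v = tgt G x) - (b when v = src G x))"
        using boundary_add boundary_uminus boundary_dart_chain[OF x] by (metis add_uminus_conv_diff)
      consider (s) "v = src G x" | (t) "v = tgt G x" | (o) "v \<noteq> src G x" "v \<noteq> tgt G x" by blast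
      then show ?thesis
      proof cases
        case s
        have "src G x \<in> verts (contract G x)" using src_in[OF x] nl by force
        then have "boundary G c' (src G x) + b = 0"
          using bd[of "src G x"] H.H1_boundary[OF c'] by (simp add: b_def)
        then show ?thesis unfolding * using s nl by simp
      next
        case t
        then show ?thesis unfolding * using nl by (simp add: b_def)
      next
        case o
        have "v \<in> verts (contract G x)" using v o by force
        then have "boundary G c' v = 0" using bd[of v] o H.H1_boundary[OF c'] by simp
        then show ?thesis unfolding * using o by simp
      qed
    qed
    then have cH: "?c \<in> H1 G" using cc by (simp add: H1_def)
    have "?R ?c = c'"
    proof (rule poly_mapping_eqI)
      fix y show "lk (?R ?c) y = lk c' y"
        using ch(2) dart_chain_eq_0[of y x b] by (auto simp: lookup_add lookup_minus dart_edge_def)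
    qed
    then show ?thesis using cH by (intro image_eqI[OF sym])
  qed
  show ?thesis
    unfolding bij_betw_def using into inj surj by (auto intro!: inj_onI)
qed

text \<open>Forgetting \<open>x\<close> loses no condition of compatibility: the values there are
  zero, or those at another edge up to a common sign, which is squared in the product.\<close>

lemma cographic_ring_contract:
  assumes nl: "src G x \<noteq> tgt G x"
    and par: "(\<forall>c\<in>H1 G. lk c x = (0::int)) \<or>
      (\<exists>y\<in>darts G. dart_edge G y \<noteq> dart_edge G x \<and> (\<exists>s\<in>{1, -1}. \<forall>c\<in>H1 G. lk c x = s * (lk c y ::
        int)))"
  shows "ring_equiv TYPE('k::field) G (contract G x)"
    "ring_equiv TYPE('k::field) (contract G x) G"
proof -
  interpret H: finite_graph "contract G x" by (rule finite_graph_contract)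
  let ?R = "drop_keys (dart_edge G x) :: ('e \<Rightarrow>\<^sub>0 int) \<Rightarrow> _"
  note bij = bij_betw_drop_keys[OF nl, where 'a = int]
  have cc: "in_common_cone (contract G x) (?R c) (?R d) \<longleftrightarrow> in_common_cone G c d"
    if cd: "c \<in> H1 G" "d \<in> H1 G" for c d
  proof -
    have RH: "?R c \<in> H1 (contract G x)" "?R d \<in> H1 (contract G x)"
      using bij cd by (auto simp: bij_betw_def)
    have "(\<forall>y\<in>darts (contract G x). 0 \<le> lk (?R c) y * lk (?R d) y) \<longleftrightarrow>
        (\<forall>y\<in>darts G - dart_edge G x. 0 \<le> lk c y * lk d y)" by auto
    also have "\<dots> \<longleftrightarrow> (\<forall>y\<in>darts G. 0 \<le> lk c y * lk d y)"
    proof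
      assume *: "\<forall>y\<in>darts G - dart_edge G x. 0 \<le> lk c y * lk d y"
      have xx: "0 \<le> lk c x * lk d x"
        using par
      proof
        assume "\<forall>c\<in>H1 G. lk c x = (0::int)"
        then show ?thesis using cd by simp
      next
        assume "\<exists>y\<in>darts G. dart_edge G y \<noteq> dart_edge G x \<and> (\<exists>s\<in>{1, -1}. \<forall>c\<in>H1 G.
            lk c x = s * (lk c y :: int))"
        then obtain y s where y: "y \<in> darts G" "dart_edge G y \<noteq> dart_edge G x"
          and s: "s \<in> {1, -1::int}" "\<forall>c\<in>H1 G. lk c x = s * (lk c y :: int)" by blast
        have "y \<noteq> x" "y \<noteq> opp G x" using y(2) dart_edge_opp[OF x] by auto
        then have "y \<notin> dart_edge G x" by (simp add: dart_edge_def)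
        then have "0 \<le> lk c y * lk d y" using * y(1) by blast
        moreover have "lk c x = s * lk c y" "lk d x = s * lk d y" using s(2) cd by auto
        ultimately show ?thesis using s(1) by auto
      qed
      then have "0 \<le> lk c (opp G x) * lk d (opp G x)"
        using chain_opp[OF H1_chains[OF cd(1)] x] chain_opp[OF H1_chains[OF cd(2)] x] by simp
      then show "\<forall>y\<in>darts G. 0 \<le> lk c y * lk d y" using * xx by (auto simp: dart_edge_def)
    qed blast
    finally show ?thesis unfolding in_common_cone_iff[OF cd] H.in_common_cone_iff[OF RH] .
  qed
  have R0: "?R 0 = 0" by (rule poly_mapping_eqI) simp
  note add = drop_keys_add[of "dart_edge G x"]
  show "ring_equiv TYPE('k::field) G (contract G x)"
    unfolding cographic_ring_eq by (rule sring_iso[where \<phi> = ?R and cc = "in_common_cone G"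
      and cc' = "in_common_cone (contract G x)", OF bij H1_zero R0 H1_add cc add])
  show "ring_equiv TYPE('k::field) (contract G x) G"
    unfolding cographic_ring_eq by (rule sring_iso_sym[where \<phi> = ?R and cc = "in_common_cone G"
      and cc' = "in_common_cone (contract G x)", OF bij H1_zero R0 H1_add cc add])
qed

text \<open>A cycle through a surviving edge remains one after the contraction. So the phase that
  contracts separating pairs creates no separating edges.\<close>

lemma nonseparating_contract:
  assumes nl: "src G x \<noteq> tgt G x" and nsep: "\<And>e. \<not> separating G e"
  shows "\<not> separating (contract G x) e"
proof
  interpret H: finite_graph "contract G x" by (rule finite_graph_contract)
  assume sep: "separating (contract G x) e"
  then obtain y where y: "y \<in> darts (contract G x)" "e = dart_edge G y"
    by (auto simp: separating_def edges_def)
  then have "y \<in> darts G" by simp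
  then obtain c :: "'e \<Rightarrow>\<^sub>0 int" where c: "c \<in> H1 G" "lk c y = 1" using nonseparating_cycle nsep
    by blast
  have RH: "drop_keys (dart_edge G x) c \<in> H1 (contract G x)"
    using bij_betw_drop_keys[OF nl] c(1) by (auto simp: bij_betw_def)
  have "lk (drop_keys (dart_edge G x) c) y = 0"
    by (rule H.separating_zero[OF y(1) _ RH]) (use sep y(2) in simp)
  then show False using c(2) y(1) by simp
qed

lemma card_darts_contract: "card (darts (contract G x)) < card (darts G)"
  using x finite_darts by (intro psubset_card_mono) (auto simp: dart_edge_def)

end

end

section \<open>Iterated contraction and the ring\<close>

lemma contract_separating_step:
  fixes G :: "('v, 'e) graph"
  assumes "finite_graph G" "contract_separating G H"
  shows "finite_graph H" "card (darts H) < card (darts G)"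
    "ring_equiv TYPE('k::field) G H"
    "ring_equiv TYPE('k::field) H G"
proof -
  interpret finite_graph G by fact
  obtain x where x: "x \<in> darts G" "separating G (dart_edge G x)" and H: "H = contract G x"
    using assms(2) by (auto simp: contract_separating_def)
  have par: "(\<forall>c\<in>H1 G. lk c x = (0::int)) \<or>
      (\<exists>y\<in>darts G. dart_edge G y \<noteq> dart_edge G x \<and> (\<exists>s\<in>{1, -1}. \<forall>c\<in>H1 G. lk c x = s * (lk c y ::
        int)))"
    using separating_zero[OF x] by blast
  note nl = separating_not_loop[OF x]
  show "finite_graph H" "card (darts H) < card (darts G)"
    unfolding H by (rule finite_graph_contract[OF x(1)] card_darts_contract[OF x(1)])+
  show "ring_equiv TYPE('k::field) G H"
    "ring_equiv TYPE('k::field) H G"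
    unfolding H by (rule cographic_ring_contract[OF x(1) nl par])+
qed

lemma contract_separating_pair_step:
  fixes G :: "('v, 'e) graph"
  assumes "finite_graph G" "contract_separating_pair G H"
  shows "finite_graph H" "card (darts H) < card (darts G)"
    "(\<And>e. \<not> separating G e) \<Longrightarrow> \<not> separating H f"
    "ring_equiv TYPE('k::field) G H"
    "ring_equiv TYPE('k::field) H G"
proof -
  interpret finite_graph G by fact
  obtain x e where x: "x \<in> darts G" "separating_pair G (dart_edge G x) e" and H: "H = contract G x"
    using assms(2) by (auto simp: contract_separating_pair_def)
  obtain y where y: "y \<in> darts G" "e = dart_edge G y"
    using x(2) by (auto simp: separating_pair_def edges_def)
  have sep: "separating_pair G (dart_edge G x) (dart_edge G y)" using x(2) y(2) by simp
  have "dart_edge G y \<noteq> dart_edge G x" using sep by (auto simp: separating_pair_def)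
  then have par: "(\<forall>c\<in>H1 G. lk c x = (0::int)) \<or>
      (\<exists>y\<in>darts G. dart_edge G y \<noteq> dart_edge G x \<and> (\<exists>s\<in>{1, -1}. \<forall>c\<in>H1 G. lk c x = s * (lk c y ::
        int)))"
    using separating_pair_parallel[OF x(1) y(1) sep] y(1) by blast
  note nl = separating_pair_not_loop[OF x(1) y(1) sep]
  show "finite_graph H" "card (darts H) < card (darts G)"
    unfolding H by (rule finite_graph_contract[OF x(1)] card_darts_contract[OF x(1)])+
  show "\<not> separating H f" if "\<And>e. \<not> separating G e"
    unfolding H by (rule nonseparating_contract[OF x(1) nl that])
  show "ring_equiv TYPE('k::field) G H"
    "ring_equiv TYPE('k::field) H G"
    unfolding H by (rule cographic_ring_contract[OF x(1) nl par])+
qed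

lemma rtranclp_terminates:
  fixes m :: "'a \<Rightarrow> nat"
  assumes step: "\<And>x y. I x \<Longrightarrow> R x y \<Longrightarrow> I y \<and> m y < m x" and "I x"
  shows "\<exists>y. R\<^sup>*\<^sup>* x y \<and> I y \<and> (\<forall>z. \<not> R y z)"
  using assms(2)
proof (induction "m x" arbitrary: x rule: less_induct)
  case less
  show ?case
  proof (cases "\<exists>z. R x z")
    case True
    then obtain z where z: "R x z" by blast
    then have "\<exists>y. R\<^sup>*\<^sup>* z y \<and> I y \<and> (\<forall>z. \<not> R y z)" using less step by blast
    then show ?thesis using z by (meson converse_rtranclp_into_rtranclp)
  next
    case False
    then show ?thesis using less.prems by blast
  qed
qed

lemma ex_three_edge_connectivization:
  assumes "finite_graph G"
  shows "\<exists>H. three_edge_connectivization G H"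
proof -
  obtain G1 where G1: "contract_separating\<^sup>*\<^sup>* G G1" "finite_graph G1" "\<forall>H.
      \<not> contract_separating G1 H"
    using rtranclp_terminates[of finite_graph contract_separating "\<lambda>G. card (darts G)" G]
      contract_separating_step(1,2) assms by blast
  have nsep: "\<not> separating G1 e" for e
  proof
    assume sep: "separating G1 e"
    then obtain x where "x \<in> darts G1" "e = dart_edge G1 x" by (auto simp: separating_def edges_def)
    then show False using G1(3) sep by (auto simp: contract_separating_def)
  qed
  obtain H where H: "contract_separating_pair\<^sup>*\<^sup>* G1 H" "\<forall>K. \<not> contract_separating_pair H K"
    using rtranclp_terminates[of finite_graph contract_separating_pair "\<lambda>G. card (darts G)" G1]
      contract_separating_pair_step(1,2) G1(2) by blast
  have "\<not> separating_pair H e f" for e f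
  proof
    assume sep: "separating_pair H e f"
    then obtain x where "x \<in> darts H" "e = dart_edge H x" by (auto simp: separating_pair_def
      edges_def)
    then show False using H(2) sep by (auto simp: contract_separating_pair_def)
  qed
  then show ?thesis using G1(1) nsep H(1) unfolding three_edge_connectivization_def by blast
qed

lemma is_ring_iso_refl: "R \<simeq> R"
  unfolding is_ring_iso_def using ring_iso_set_refl by blast

lemma three_edge_connectivization_ring:
  fixes G :: "('v, 'e) graph"
  assumes "finite_graph G" "three_edge_connectivization G H"
  shows "finite_graph H" "\<not> separating H e" "\<not> separating_pair H e f"
    "ring_equiv TYPE('k::field) G H"
    "ring_equiv TYPE('k::field) H G"
proof -
  obtain G1 where G1: "contract_separating\<^sup>*\<^sup>* G G1" "\<And>e. \<not> separating G1 e"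
    "contract_separating_pair\<^sup>*\<^sup>* G1 H" "\<And>e f. \<not> separating_pair H e f"
    using assms(2) unfolding three_edge_connectivization_def by blast
  have 1: "finite_graph G1 \<and>
    ring_equiv TYPE('k::field) G G1 \<and>
    ring_equiv TYPE('k::field) G1 G"
    using G1(1)
  proof (induction rule: rtranclp_induct)
    case base
    then show ?case using assms(1) is_ring_iso_refl by blast
  next
    case (step K K')
    then have K: "finite_graph K" by blast
    note st = contract_separating_step(1)[OF K step.hyps(2)]
      contract_separating_step(3,4)[OF K step.hyps(2), where 'k = 'k]
    show ?case using step.IH st is_ring_iso_trans by blast
  qed
  have 2: "finite_graph H \<and> (\<forall>e. \<not> separating H e) \<and>
    ring_equiv TYPE('k::field) G H \<and>
    ring_equiv TYPE('k::field) H G"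
    using G1(3)
  proof (induction rule: rtranclp_induct)
    case base
    then show ?case using 1 G1(2) by blast
  next
    case (step K K')
    then have K: "finite_graph K" "\<And>e. \<not> separating K e" by blast+
    note st = contract_separating_pair_step(1)[OF K(1) step.hyps(2)]
      contract_separating_pair_step(3)[OF K(1) step.hyps(2) K(2)]
      contract_separating_pair_step(4,5)[OF K(1) step.hyps(2), where 'k = 'k]
    show ?case using step.IH st is_ring_iso_trans by blast
  qed
  show "finite_graph H" "\<not> separating H e" "\<not> separating_pair H e f"
    "ring_equiv TYPE('k::field) G H"
    "ring_equiv TYPE('k::field) H G"
    using 2 G1(4) by blast+
qed

section \<open>Cyclic equivalence in terms of coordinates\<close>

lemma cyclic_equivalentI:
  assumes "finite_graph G" "finite_graph G'" and D: "orientation G D" and D': "orientation G' D'"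
    and \<epsilon>: "bij_betw \<epsilon> D D'" and min: "(`) \<epsilon> ` min_supports (H1 G) D = min_supports (H1 G') D'"
  shows "cyclic_equivalent G G'"
proof -
  interpret A: finite_graph G by fact
  interpret B: finite_graph G' by fact
  let ?i = "inv_into D (dart_edge G)"
  define \<eta> where "\<eta> = dart_edge G' \<circ> \<epsilon> \<circ> ?i"
  have bijD: "bij_betw (dart_edge G) D (edges G)" by (rule A.bij_betw_dart_edge[OF D])
  have \<eta>: "bij_betw \<eta> (edges G) (edges G')"
    unfolding \<eta>_def
    by (rule bij_betw_trans[OF bij_betw_inv_into[OF bijD] bij_betw_trans[OF \<epsilon>
      B.bij_betw_dart_edge[OF D']], unfolded o_assoc])
  have img: "\<eta> ` dart_edge G ` C = dart_edge G' ` \<epsilon> ` C" if "C \<subseteq> D" for C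
    unfolding image_image \<eta>_def o_def
    using that bijD by (intro image_cong) (auto simp: bij_betw_def subset_iff)
  have "(`) \<eta> ` circuits G = (`) (dart_edge G') ` (`) \<epsilon> ` min_supports (H1 G) D"
    unfolding A.circuits_eq[OF D] image_image[of "(`) \<eta>"] image_image[of "(`) (dart_edge G')"]
    by (intro image_cong refl img) (auto simp: min_supports_def support_def)
  then have "(`) \<eta> ` circuits G = circuits G'"
    unfolding min B.circuits_eq[OF D'] .
  moreover have "inj_on ((`) \<eta>) (circuits G)"
  proof (rule inj_onI)
    fix X Y assume XY: "X \<in> circuits G" "Y \<in> circuits G" "\<eta> ` X = \<eta> ` Y"
    then show "X = Y"
      using inj_on_image_eq_iff[of \<eta> "edges G" X Y] \<eta> A.circuits_sub by (auto simp: bij_betw_def)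
  qed
  ultimately show ?thesis unfolding cyclic_equivalent_def using \<eta> by (auto simp: bij_betw_def)
qed

lemma cyclic_equivalent_sym:
  assumes "finite_graph G" "cyclic_equivalent G G'"
  shows "cyclic_equivalent G' G"
proof -
  interpret finite_graph G by fact
  obtain \<eta> where \<eta>: "bij_betw \<eta> (edges G) (edges G')" "bij_betw ((`) \<eta>) (circuits G) (circuits G')"
    using assms(2) by (auto simp: cyclic_equivalent_def)
  let ?i = "inv_into (edges G) \<eta>"
  have inv: "?i ` \<eta> ` X = X" if "X \<in> circuits G" for X
    using that circuits_sub \<eta>(1) by (intro inv_into_image_cancel) (auto simp: bij_betw_def)
  have "bij_betw ((`) ?i) (circuits G') (circuits G)"
  proof (rule bij_betw_byWitness[where f' = "(`) \<eta>"])
    have img: "circuits G' = (`) \<eta> ` circuits G" using \<eta>(2) by (simp add: bij_betw_def)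
    show "\<forall>Y\<in>circuits G'. \<eta> ` ?i ` Y = Y" unfolding img using inv by simp
    show "\<forall>X\<in>circuits G. ?i ` \<eta> ` X = X" using inv by simp
    show "(`) ?i ` circuits G' \<subseteq> circuits G" unfolding img using inv by auto
    show "(`) \<eta> ` circuits G \<subseteq> circuits G'" unfolding img by simp
  qed
  then show ?thesis unfolding cyclic_equivalent_def using bij_betw_inv_into[OF \<eta>(1)] by blast
qed

lemma cyclic_equivalent_trans:
  assumes "cyclic_equivalent G G'" "cyclic_equivalent G' G''"
  shows "cyclic_equivalent G G''"
proof -
  obtain \<eta> where \<eta>: "bij_betw \<eta> (edges G) (edges G')" "bij_betw ((`) \<eta>) (circuits G) (circuits G')"
    using assms(1) by (auto simp: cyclic_equivalent_def)
  obtain \<eta>' where \<eta>': "bij_betw \<eta>' (edges G') (edges G'')" "bij_betw ((`) \<eta>') (circuits G')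
      (circuits G'')"
    using assms(2) by (auto simp: cyclic_equivalent_def)
  have "(`) \<eta>' \<circ> (`) \<eta> = (`) (\<eta>' \<circ> \<eta>)" by (auto simp: fun_eq_iff image_comp)
  then have "bij_betw ((`) (\<eta>' \<circ> \<eta>)) (circuits G) (circuits G'')"
    using bij_betw_trans[OF \<eta>(2) \<eta>'(2)] by simp
  then show ?thesis unfolding cyclic_equivalent_def using bij_betw_trans[OF \<eta>(1) \<eta>'(1)] by blast
qed

lemma cyclic_equivalentD:
  assumes "finite_graph G" "finite_graph G'" and D: "orientation G D" and D': "orientation G' D'"
    and eq: "cyclic_equivalent G G'"
  shows "\<exists>\<epsilon>. bij_betw \<epsilon> D D' \<and> (`) \<epsilon> ` min_supports (H1 G) D = min_supports (H1 G') D'"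
proof -
  interpret A: finite_graph G by fact
  interpret B: finite_graph G' by fact
  obtain \<eta> where \<eta>: "bij_betw \<eta> (edges G) (edges G')" "bij_betw ((`) \<eta>) (circuits G) (circuits G')"
    using eq by (auto simp: cyclic_equivalent_def)
  let ?i = "inv_into D' (dart_edge G')"
  define \<epsilon> where "\<epsilon> = ?i \<circ> \<eta> \<circ> dart_edge G"
  have bijD': "bij_betw (dart_edge G') D' (edges G')" by (rule B.bij_betw_dart_edge[OF D'])
  have "bij_betw \<epsilon> D D'"
    unfolding \<epsilon>_def
    by (rule bij_betw_trans[OF A.bij_betw_dart_edge[OF D] bij_betw_trans[OF \<eta>(1)
      bij_betw_inv_into[OF bijD']]])
  moreover have "(`) \<epsilon> ` min_supports (H1 G) D = (`) ?i ` (`) \<eta> ` circuits G"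
    unfolding A.circuits_eq[OF D] \<epsilon>_def image_image by (simp add: image_comp)
  moreover have "(`) \<eta> ` circuits G = circuits G'" using \<eta>(2) by (simp add: bij_betw_def)
  moreover have "(`) ?i ` circuits G' = min_supports (H1 G') D'"
  proof -
    have "?i ` dart_edge G' ` C = C" if "C \<in> min_supports (H1 G') D'" for C
    proof (rule inv_into_image_cancel)
      show "inj_on (dart_edge G') D'" using bijD' by (simp add: bij_betw_def)
      show "C \<subseteq> D'" using that by (auto simp: min_supports_def support_def)
    qed
    then show ?thesis unfolding B.circuits_eq[OF D'] image_image by simp
  qed
  ultimately show ?thesis by auto
qed

lemma in_common_cone_compat:
  assumes "finite_graph G" "orientation G D" "c \<in> H1 G" "d \<in> H1 G"
  shows "in_common_cone G c d \<longleftrightarrow> compat D c d"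
proof -
  interpret finite_graph G by fact
  show ?thesis
    unfolding in_common_cone_iff[OF assms(3,4)] compat_iff_darts[OF assms(2) H1_chains[OF
      assms(3)] H1_chains[OF assms(4)]] ..
qed

text \<open>The signs \<open>s i\<close> of the lattice isomorphism drop out of products of two
  entries, so compatibility is preserved.\<close>

lemma cyclic_equivalent_imp_ring_iso:
  fixes G :: "('v, 'e) graph" and G' :: "('w, 'f) graph"
  assumes G: "finite_graph G" "finite_graph G'" and eq: "cyclic_equivalent G G'"
  shows "(cographic_ring G :: (('e \<Rightarrow>\<^sub>0 int) \<Rightarrow>\<^sub>0 'k::field) ring) \<simeq> (cographic_ring G' :: (('f \<Rightarrow>\<^sub>0
      int) \<Rightarrow>\<^sub>0 'k) ring)"
proof -
  interpret A: finite_graph G by fact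
  interpret B: finite_graph G' by fact
  obtain D D' where D: "orientation G D" and D': "orientation G' D'"
    using A.ex_orientation B.ex_orientation by blast
  obtain \<epsilon> where \<epsilon>: "bij_betw \<epsilon> D D'" "(`) \<epsilon> ` min_supports (H1 G) D = min_supports (H1 G') D'"
    using cyclic_equivalentD[OF G D D' eq] by blast
  from unimodular_unique[OF A.unimodular_lattice_H1[OF D] B.unimodular_lattice_H1[OF D'] \<epsilon>]
  obtain \<phi> :: "('e \<Rightarrow>\<^sub>0 int) \<Rightarrow> ('f \<Rightarrow>\<^sub>0 int)" and s where *: "bij_betw \<phi> (H1 G) (H1 G') \<and> (\<forall>c\<in>H1 G.
      \<forall>d\<in>H1 G. \<phi> (c + d) = \<phi> c + \<phi> d) \<and>
    (\<forall>i\<in>D. s i \<in> {1, -1}) \<and> (\<forall>c\<in>H1 G. \<forall>i\<in>D. lk (\<phi> c) (\<epsilon> i) = s i * lk c i)" by (elim exE)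
  then have \<phi>: "bij_betw \<phi> (H1 G) (H1 G')" by blast
  have add: "\<phi> (c + d) = \<phi> c + \<phi> d" if "c \<in> H1 G" "d \<in> H1 G" for c d using * that by blast
  have s: "s i \<in> {1, -1}" if "i \<in> D" for i using * that by blast
  have lk: "lk (\<phi> c) (\<epsilon> i) = s i * lk c i" if "c \<in> H1 G" "i \<in> D" for c i using * that by blast
  have zero: "\<phi> 0 = 0" using add[OF A.H1_zero A.H1_zero] by simp
  have cc: "in_common_cone G' (\<phi> c) (\<phi> d) \<longleftrightarrow> in_common_cone G c d" if cd: "c \<in> H1 G" "d \<in> H1 G"
    for c d
  proof -
    have \<phi>H: "\<phi> c \<in> H1 G'" "\<phi> d \<in> H1 G'" using \<phi> cd by (auto simp: bij_betw_def)
    have "D' = \<epsilon> ` D" using \<epsilon>(1) by (simp add: bij_betw_def)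
    moreover have "lk (\<phi> c) (\<epsilon> i) * lk (\<phi> d) (\<epsilon> i) = lk c i * lk d i" if "i \<in> D" for i
      using lk[OF cd(1) that] lk[OF cd(2) that] s[OF that] by auto
    ultimately have "compat D' (\<phi> c) (\<phi> d) \<longleftrightarrow> compat D c d" by (simp add: compat_def)
    then show ?thesis
      unfolding in_common_cone_compat[OF G(1) D cd] in_common_cone_compat[OF G(2) D' \<phi>H] .
  qed
  show ?thesis
    unfolding cographic_ring_eq by (rule sring_iso[where \<phi> = \<phi> and cc = "in_common_cone G"
      and cc' = "in_common_cone G'", OF \<phi> A.H1_zero zero A.H1_add cc add])
qed

lemma ring_iso_imp_cyclic_equivalent:
  fixes G :: "('v, 'e) graph" and G' :: "('w, 'f) graph"
  assumes G: "finite_graph G" "finite_graph G'"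
    and nsep: "\<And>e. \<not> separating G e" "\<And>e f. \<not> separating_pair G e f"
      "\<And>e. \<not> separating G' e" "\<And>e f. \<not> separating_pair G' e f"
    and iso: "(cographic_ring G :: (('e \<Rightarrow>\<^sub>0 int) \<Rightarrow>\<^sub>0 'k::field) ring) \<simeq> (cographic_ring G' :: (('f
        \<Rightarrow>\<^sub>0 int) \<Rightarrow>\<^sub>0 'k) ring)"
  shows "cyclic_equivalent G G'"
proof -
  interpret A: finite_graph G by fact
  interpret B: finite_graph G' by fact
  obtain D D' where D: "orientation G D" and D': "orientation G' D'"
    using A.ex_orientation B.ex_orientation by blast
  obtain \<epsilon> where "bij_betw \<epsilon> D D'" "(`) \<epsilon> ` min_supports (H1 G) D = min_supports (H1 G') D'"
    using sring_iso_min_supports[OF A.simple_lattice_H1[OF D nsep(1,2)] B.simple_lattice_H1[OF D'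
      nsep(3,4)]
      in_common_cone_compat[OF G(1) D] in_common_cone_compat[OF G(2) D'] iso[unfolded
        cographic_ring_eq]] by blast
  then show ?thesis by (rule cyclic_equivalentI[OF G D D'])
qed

section \<open>Copies on the natural numbers\<close>

lemma push_H1:
  assumes "finite_graph G" "finite_graph G'" and f: "bij_betw f (verts G) (verts G')"
    and g: "bij_betw g (darts G) (darts G')"
    and opp: "\<And>x. x \<in> darts G \<Longrightarrow> opp G' (g x) = g (opp G x)"
    and tgt: "\<And>x. x \<in> darts G \<Longrightarrow> tgt G' (g x) = f (tgt G x)" and c: "(c :: 'e \<Rightarrow>\<^sub>0 int) \<in> H1 G"
  shows "push g c \<in> H1 G'"
proof -
  interpret A: finite_graph G by fact
  interpret B: finite_graph G' by fact
  have inj: "inj_on g (darts G)" and img: "g ` darts G = darts G'" using g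
    by (auto simp: bij_betw_def)
  have keys: "Poly_Mapping.keys c \<subseteq> darts G" using A.H1_chains[OF c] by (simp add: chains_def)
  note lkp = lookup_push[OF inj keys]
  have "push g c \<in> chains G'"
    unfolding B.chains_iff
  proof (intro conjI allI impI ballI)
    fix y assume "y \<notin> darts G'"
    then show "lk (push g c) y = 0" using lookup_push_outside[OF keys, of y g] img by simp
  next
    fix y assume "y \<in> darts G'"
    then obtain x where x: "x \<in> darts G" "y = g x" using img by blast
    then show "lk (push g c) (opp G' y) = - lk (push g c) y"
      using opp[OF x(1)] lkp A.opp_in A.chain_opp[OF A.H1_chains[OF c] x(1)] by simp
  qed
  moreover have "boundary G' (push g c) v' = 0" if v': "v' \<in> verts G'" for v'
  proof -
    obtain v where v: "v \<in> verts G" "v' = f v" using f v' by (auto simp: bij_betw_def)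
    have "{y \<in> darts G'. tgt G' y = v'} = g ` {x \<in> darts G. tgt G x = v}"
    proof (rule Set.set_eqI)
      fix y
      have "f (tgt G x) = f v \<longleftrightarrow> tgt G x = v" if "x \<in> darts G" for x
        using f v(1) A.tgt_in[OF that] by (auto simp: bij_betw_def dest: inj_onD)
      then show "y \<in> {y \<in> darts G'. tgt G' y = v'} \<longleftrightarrow> y \<in> g ` {x \<in> darts G. tgt G x = v}"
        using tgt v(2) unfolding img[symmetric] by auto
    qed
    moreover have "inj_on g {x \<in> darts G. tgt G x = v}" using inj by (auto intro: inj_on_subset)
    ultimately have "boundary G' (push g c) v' = (\<Sum>x | x \<in> darts G \<and> tgt G x = v.
        lk (push g c) (g x))"
      unfolding boundary_def by (simp add: sum.reindex)
    also have "\<dots> = boundary G c v" unfolding boundary_def using lkp by (intro sum.cong) auto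
    finally show ?thesis using A.H1_boundary[OF c v(1)] by simp
  qed
  ultimately show ?thesis by (simp add: H1_def)
qed

text \<open>The classes consist of graphs on natural numbers; this keeps the equality of two of them
  from being one of empty sets.\<close>

lemma ex_nat_graph:
  fixes G :: "('v, 'e) graph"
  assumes "finite_graph G"
  shows "\<exists>K :: (nat, nat) graph. finite_graph K \<and> cyclic_equivalent K G"
proof -
  interpret finite_graph G by fact
  obtain f :: "'v \<Rightarrow> nat" where f: "inj_on f (verts G)"
    using finite_imp_inj_to_nat_seg[OF finite_verts] by blast
  obtain g :: "'e \<Rightarrow> nat" where g: "inj_on g (darts G)"
    using finite_imp_inj_to_nat_seg[OF finite_darts] by blast
  let ?j = "inv_into (darts G) g"
  have j: "?j (g x) = x" if "x \<in> darts G" for x using inv_into_f_f[OF g that] .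
  define K :: "(nat, nat) graph" where
    "K = \<lparr>verts = f ` verts G, darts = g ` darts G, opp = \<lambda>n. g (opp G (?j n)),
       src = \<lambda>n. f (src G (?j n)), tgt = \<lambda>n. f (tgt G (?j n))\<rparr>"
  have [simp]: "verts K = f ` verts G" "darts K = g ` darts G" by (simp_all add: K_def)
  have K: "opp K (g x) = g (opp G x)" "src K (g x) = f (src G x)" "tgt K (g x) = f (tgt G x)"
    if "x \<in> darts G" for x
    using j[OF that] by (simp_all add: K_def)
  have fK: "finite_graph K"
  proof
    fix n assume "n \<in> darts K"
    then obtain x where x: "x \<in> darts G" "n = g x" by auto
    note o = opp_in[OF x(1)]
    show "src K n \<in> verts K" "tgt K n \<in> verts K" using K[OF x(1)] x src_in tgt_in by simp_all
    show "opp K n \<in> darts K" using K[OF x(1)] x o by simp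
    show "opp K (opp K n) = n" using K[OF x(1)] K[OF o] x opp_opp by simp
    show "opp K n \<noteq> n" using K[OF x(1)] x o opp_neq g by (auto dest: inj_onD)
    show "src K n = tgt K (opp K n)" using K[OF x(1)] K[OF o] x src_eq_tgt_opp by simp
  qed (use finite_verts finite_darts in simp_all)
  interpret K: finite_graph K by (rule fK)
  have bf: "bij_betw f (verts G) (verts K)" and bg: "bij_betw g (darts G) (darts K)"
    using f g by (simp_all add: bij_betw_def)
  have pushG: "push g c \<in> H1 K" if "c \<in> H1 G" for c :: "'e \<Rightarrow>\<^sub>0 int"
    by (rule push_H1[OF assms fK bf bg K(1,3) that])
  have pushK: "push ?j d \<in> H1 G" if d: "d \<in> H1 K" for d :: "nat \<Rightarrow>\<^sub>0 int"
  proof (rule push_H1[OF fK assms bij_betw_inv_into[OF bf] bij_betw_inv_into[OF bg] _ _ d])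
    fix n assume "n \<in> darts K"
    then obtain x where x: "x \<in> darts G" "n = g x" by auto
    show "opp G (?j n) = ?j (opp K n)" using K[OF x(1)] j x opp_in by simp
    show "tgt G (?j n) = inv_into (verts G) f (tgt K n)"
      using K[OF x(1)] j x inv_into_f_f[OF f tgt_in[OF x(1)]] by simp
  qed
  obtain D where D: "orientation G D" using ex_orientation by blast
  have DG: "D \<subseteq> darts G" by (rule orientationD(1)[OF D])
  have injD: "inj_on g D" using g DG by (rule inj_on_subset)
  have DK: "orientation K (g ` D)"
    unfolding orientation_def
  proof (intro conjI ballI)
    show "g ` D \<subseteq> darts K" using DG by auto
    fix n assume "n \<in> darts K"
    then obtain x where x: "x \<in> darts G" "n = g x" by auto
    have mem: "g y \<in> g ` D \<longleftrightarrow> y \<in> D" if "y \<in> darts G" for y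
      using inj_on_image_mem_iff[OF g that DG] .
    show "n \<in> g ` D \<longleftrightarrow> opp K n \<notin> g ` D"
      unfolding x(2) K(1)[OF x(1)] mem[OF x(1)] mem[OF opp_in[OF x(1)]]
      using D x(1) by (simp add: orientation_def)
  qed
  interpret LG: int_lattice "H1 G" D by (rule int_lattice_H1[OF D])
  interpret LK: int_lattice "H1 K" "g ` D" by (rule K.int_lattice_H1[OF DK])
  have supp: "support (g ` D) d = g ` support D c"
    if "\<And>x. x \<in> darts G \<Longrightarrow> lk d (g x) = lk c x" for c :: "'e \<Rightarrow>\<^sub>0 int" and d :: "nat \<Rightarrow>\<^sub>0 int"
    using that DG by (auto simp: support_def)
  have "support (g ` D) ` H1 K = (`) g ` support D ` H1 G"
  proof
    show "support (g ` D) ` H1 K \<subseteq> (`) g ` support D ` H1 G"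
    proof (rule image_subsetI)
      fix d :: "nat \<Rightarrow>\<^sub>0 int" assume d: "d \<in> H1 K"
      have kd: "Poly_Mapping.keys d \<subseteq> darts K" using K.H1_chains[OF d] by (simp add: chains_def)
      have ij: "inj_on ?j (darts K)" using bij_betw_inv_into[OF bg] by (simp add: bij_betw_def)
      have "support (g ` D) d = g ` support D (push ?j d)"
      proof (rule supp)
        fix x assume x: "x \<in> darts G"
        show "lk d (g x) = lk (push ?j d) x"
          using lookup_push[OF ij kd, of "g x"] x j[OF x] by simp
      qed
      then show "support (g ` D) d \<in> (`) g ` support D ` H1 G" using pushK[OF d] by blast
    qed
    show "(`) g ` support D ` H1 G \<subseteq> support (g ` D) ` H1 K"
    proof (unfold image_image, rule image_subsetI)
      fix c :: "'e \<Rightarrow>\<^sub>0 int" assume c: "c \<in> H1 G"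
      have kc: "Poly_Mapping.keys c \<subseteq> darts G" using H1_chains[OF c] by (simp add: chains_def)
      have "support (g ` D) (push g c) = g ` support D c"
        by (rule supp) (rule lookup_push[OF g kc])
      then show "g ` support D c \<in> support (g ` D) ` H1 K" using pushG[OF c] by (metis imageI)
    qed
  qed
  moreover have "support D ` H1 G \<subseteq> Pow D" by (auto simp: support_def)
  ultimately have "(`) g ` min_supports (H1 G) D = min_supports (H1 K) (g ` D)"
    unfolding LG.min_supports_alt LK.min_supports_alt using image_minimals[OF injD] by simp
  then have "cyclic_equivalent G K"
    using injD by (intro cyclic_equivalentI[OF assms fK D DK]) (simp_all add: bij_betw_def)
  then show ?thesis using fK cyclic_equivalent_sym[OF assms] by blast
qed

theorem theorem7p1:
  fixes G :: "('v, 'e) graph" and G' :: "('w, 'f) graph"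
  assumes "finite_graph G" and "finite_graph G'"
  shows "(cographic_ring G :: (('e \<Rightarrow>\<^sub>0 int) \<Rightarrow>\<^sub>0 'k::field) ring)
           \<simeq> (cographic_ring G' :: (('f \<Rightarrow>\<^sub>0 int) \<Rightarrow>\<^sub>0 'k) ring)
         \<longleftrightarrow> three_edge_class G = three_edge_class G'"
proof
  assume iso: "(cographic_ring G :: (('e \<Rightarrow>\<^sub>0 int) \<Rightarrow>\<^sub>0 'k::field) ring)
           \<simeq> (cographic_ring G' :: (('f \<Rightarrow>\<^sub>0 int) \<Rightarrow>\<^sub>0 'k) ring)"
  \<comment> \<open>Needed for arbitrary pairs, since a member of a class comes with a
    connectivization \<open>J\<close> of its own. Independence of the choices is contained in
    this.\<close>
  have equiv: "cyclic_equivalent H H'"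
    if H: "three_edge_connectivization G H" and H': "three_edge_connectivization G' H'" for H H'
  proof -
    note h = three_edge_connectivization_ring(1-3)[OF assms(1) H]
      and h' = three_edge_connectivization_ring(1-3)[OF assms(2) H']
    have "(cographic_ring H :: (('e \<Rightarrow>\<^sub>0 int) \<Rightarrow>\<^sub>0 'k) ring) \<simeq> (cographic_ring H' :: (('f \<Rightarrow>\<^sub>0 int)
        \<Rightarrow>\<^sub>0 'k) ring)"
      by (rule is_ring_iso_trans[OF three_edge_connectivization_ring(5)[OF assms(1) H]
            is_ring_iso_trans[OF iso three_edge_connectivization_ring(4)[OF assms(2) H']]])
    then show ?thesis by (rule ring_iso_imp_cyclic_equivalent[OF h(1) h'(1) h(2,3) h'(2,3)])
  qed
  obtain H where H: "three_edge_connectivization G H"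
    using ex_three_edge_connectivization[OF assms(1)] by blast
  obtain H' where H': "three_edge_connectivization G' H'"
    using ex_three_edge_connectivization[OF assms(2)] by blast
  show "three_edge_class G = three_edge_class G'"
  proof (rule Set.set_eqI)
    fix K
    show "K \<in> three_edge_class G \<longleftrightarrow> K \<in> three_edge_class G'"
    proof
      assume "K \<in> three_edge_class G"
      then obtain J where J: "three_edge_connectivization G J" "finite_graph K"
        "cyclic_equivalent K J"
        by (auto simp: three_edge_class_def cyc_class_def)
      then show "K \<in> three_edge_class G'"
        using cyclic_equivalent_trans[OF J(3) equiv[OF J(1) H']] H'
        by (auto simp: three_edge_class_def cyc_class_def)
    next
      assume "K \<in> three_edge_class G'"
      then obtain J where J: "three_edge_connectivization G' J" "finite_graph K"
        "cyclic_equivalent K J"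
        by (auto simp: three_edge_class_def cyc_class_def)
      have "cyclic_equivalent J H"
        by (rule cyclic_equivalent_sym[OF three_edge_connectivization_ring(1)[OF assms(1) H]
          equiv[OF H J(1)]])
      then show "K \<in> three_edge_class G"
        using cyclic_equivalent_trans[OF J(3)] J(2) H
        by (auto simp: three_edge_class_def cyc_class_def)
    qed
  qed
next
  assume eq: "three_edge_class G = three_edge_class G'"
  obtain H where H: "three_edge_connectivization G H"
    using ex_three_edge_connectivization[OF assms(1)] by blast
  note h = three_edge_connectivization_ring(1)[OF assms(1) H]
  \<comment> \<open>A common member of both classes links a connectivization of \<open>G\<close> to
    one of \<open>G'\<close>.\<close>
  obtain K :: "(nat, nat) graph" where K: "finite_graph K" "cyclic_equivalent K H"
    using ex_nat_graph[OF h] by blast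
  then have "K \<in> three_edge_class G'"
    using H unfolding eq[symmetric] by (auto simp: three_edge_class_def cyc_class_def)
  then obtain H' where H': "three_edge_connectivization G' H'" "cyclic_equivalent K H'"
    by (auto simp: three_edge_class_def cyc_class_def)
  note h' = three_edge_connectivization_ring(1)[OF assms(2) H'(1)]
  have "cyclic_equivalent H H'"
    by (rule cyclic_equivalent_trans[OF cyclic_equivalent_sym[OF K] H'(2)])
  then have "(cographic_ring H :: (('e \<Rightarrow>\<^sub>0 int) \<Rightarrow>\<^sub>0 'k) ring) \<simeq> (cographic_ring H' :: (('f \<Rightarrow>\<^sub>0
      int) \<Rightarrow>\<^sub>0 'k) ring)"
    by (rule cyclic_equivalent_imp_ring_iso[OF h h'])
  from is_ring_iso_trans[OF this three_edge_connectivization_ring(5)[OF assms(2) H'(1)]]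
  show "(cographic_ring G :: (('e \<Rightarrow>\<^sub>0 int) \<Rightarrow>\<^sub>0 'k::field) ring)
           \<simeq> (cographic_ring G' :: (('f \<Rightarrow>\<^sub>0 int) \<Rightarrow>\<^sub>0 'k) ring)"
    by (rule is_ring_iso_trans[OF three_edge_connectivization_ring(4)[OF assms(1) H]])
qed

end
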